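(* Let $m$ and $\beta$ be positive integers and $R>0$. Then, for any estimator $\widehat f$ of the regression function $f$ in the Gaussian white noise model $dY_x=f(x)\,dx+n^{-1/2}\,dW_x$, $x\in[0,1]$, with parameter space $S^\beta(R)$, there exists a non-randomized estimator $\widehat\theta=(\widehat\theta_1,\dots,\widehat\theta_m)$ in the Gaussian sequence model $$X_i=\theta_i+\frac1{\sqrt n}\varepsilon_i,\qquad i=1,\dots,m,\qquad \varepsilon_i\sim\mathcal N(0,1)\ \text{independent},$$ with parameter space $\Theta_m^\beta(R):=\{\theta\in\mathbb R^m:\|\theta\|_2\le R/(\Gamma_\beta m^\beta)\}$, such that $$\sup_{\theta\in\Theta_m^\beta(R)}\big\|E_\theta[\widehat\theta]-\theta\big\|_2^2\ \le\ \sup_{f\in S^\beta(R)}\mathrm{IBias}^2_f(\widehat f)\quad\text{and}\quad \sup_{\theta\in\Theta_m^\beta(R)}\sum_{i=1}^m\mathrm{Var}_\theta(\widehat\theta_i)\ \le\ \sup_{f\in S^\beta(R)}\mathrm{IVar}_f(\widehat f).$$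
   Context: White noise model: one observes $Y=(Y_x)_{x\in[0,1]}$, with $W$ an unobserved standard Brownian motion; $E_f,\mathrm{Var}_f$ are expectation and variance under the law of $Y$. An estimator $\widehat f=(\widehat f(x))_{x\in[0,1]}$ is a (jointly measurable) function of $Y$ with values in the real-valued functions on $[0,1]$ such that $E_f[\widehat f(x)]$ exists and is finite for all $f$ in the parameter space. $\mathrm{IBias}^2_f(\widehat f):=\int_0^1(E_f[\widehat f(x)]-f(x))^2dx$, $\mathrm{IVar}_f(\widehat f):=\int_0^1\mathrm{Var}_f(\widehat f(x))\,dx$. In the sequence model $E_\theta,\mathrm{Var}_\theta$ are expectation and variance under the law of $X=(X_1,\dots,X_m)$; a non-randomized estimator is a measurable function $\mathbb R^m\to\mathbb R^m$ of $X$. $\|\cdot\|_2$ is the Euclidean norm. For a domain $D$, $\|f\|_{S^\beta(D)}^2:=\|f\|_{L^2(D)}^2+\|f^{(\beta)}\|_{L^2(D)}^2$; $S^\beta(R)$ is the set of $f\in L^2([0,1])$ in the $L^2$-Sobolev space of index $\beta$ with $\|f\|_{S^\beta([0,1])}\le R$. $\Gamma_\beta:=\inf\{\|K\|_{S^\beta(\mathbb R)}:\|K\|_{L^2(\mathbb R)}=1,\ \mathrm{supp}\,K\subset[-1/2,1/2]\}$. *)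

theory Defs
  imports "HOL-Probability.Probability"
begin

section \<open>Sobolev spaces on the line\<close>

text \<open>
  Elements of \<open>L\<^sup>2(D)\<close> are represented by functions that are Borel measurable on \<open>D\<close>; the values
  outside \<open>D\<close> are irrelevant.
\<close>

definition square_integrable_on :: "real set \<Rightarrow> (real \<Rightarrow> real) \<Rightarrow> bool" where
  "square_integrable_on D f \<longleftrightarrow>
     set_borel_measurable lborel D f \<and> set_integrable lborel D (\<lambda>x. (f x)\<^sup>2)"

definition L2_norm_on :: "real set \<Rightarrow> (real \<Rightarrow> real) \<Rightarrow> real" where
  "L2_norm_on D f = sqrt (LINT x:D|lborel. (f x)\<^sup>2)"

text \<open>
  Smooth functions with compact support in the interior of \<open>D\<close>, so that closed intervals and the
  whole line can both be used as domains.
\<close>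

definition test_function :: "real set \<Rightarrow> (real \<Rightarrow> real) \<Rightarrow> bool" where
  "test_function D \<phi> \<longleftrightarrow>
     (\<forall>k x. (deriv ^^ k) \<phi> differentiable (at x)) \<and>
     compact (closure {x. \<phi> x \<noteq> 0}) \<and> closure {x. \<phi> x \<noteq> 0} \<subseteq> interior D"

definition locally_integrable_on :: "real set \<Rightarrow> (real \<Rightarrow> real) \<Rightarrow> bool" where
  "locally_integrable_on D f \<longleftrightarrow>
     (\<forall>C. compact C \<and> C \<subseteq> interior D \<longrightarrow> set_integrable lborel C f)"

definition is_weak_deriv :: "nat \<Rightarrow> real set \<Rightarrow> (real \<Rightarrow> real) \<Rightarrow> (real \<Rightarrow> real) \<Rightarrow> bool" where
  "is_weak_deriv k D f g \<longleftrightarrow>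
     locally_integrable_on D f \<and> locally_integrable_on D g \<and>
     (\<forall>\<phi>. test_function D \<phi> \<longrightarrow>
        (LINT x:D|lborel. f x * (deriv ^^ k) \<phi> x) = (-1) ^ k * (LINT x:D|lborel. g x * \<phi> x))"

definition sobolev_space :: "nat \<Rightarrow> real set \<Rightarrow> (real \<Rightarrow> real) set" where
  "sobolev_space \<beta> D =
     {f. square_integrable_on D f \<and>
         (\<forall>k\<le>\<beta>. \<exists>g. square_integrable_on D g \<and> is_weak_deriv k D f g)}"

text \<open>
  The weak derivative is unique up to null sets, so the choice does not affect the norm below.
\<close>

definition weak_deriv :: "nat \<Rightarrow> real set \<Rightarrow> (real \<Rightarrow> real) \<Rightarrow> real \<Rightarrow> real" where
  "weak_deriv k D f = (SOME g. square_integrable_on D g \<and> is_weak_deriv k D f g)"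

definition sobolev_norm :: "nat \<Rightarrow> real set \<Rightarrow> (real \<Rightarrow> real) \<Rightarrow> real" where
  "sobolev_norm \<beta> D f = sqrt ((L2_norm_on D f)\<^sup>2 + (L2_norm_on D (weak_deriv \<beta> D f))\<^sup>2)"

definition sobolev_ball :: "nat \<Rightarrow> real \<Rightarrow> (real \<Rightarrow> real) set" where
  "sobolev_ball \<beta> R = {f \<in> sobolev_space \<beta> {0..1}. sobolev_norm \<beta> {0..1} f \<le> R}"

text \<open>The support of a class in \<open>L\<^sup>2\<close> is its essential support.\<close>

definition Gamma_const :: "nat \<Rightarrow> real" where
  "Gamma_const \<beta> =
     Inf {sobolev_norm \<beta> UNIV K | K.
            K \<in> sobolev_space \<beta> UNIV \<and> L2_norm_on UNIV K = 1 \<and>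
            (AE x in lborel. x \<notin> {-1/2..1/2} \<longrightarrow> K x = 0)}"


section \<open>Variance and estimators\<close>

text \<open>The variance as an extended number: it is infinite if there is no finite second moment.\<close>

definition ext_variance :: "'a measure \<Rightarrow> ('a \<Rightarrow> real) \<Rightarrow> ennreal" where
  "ext_variance P T = (\<integral>\<^sup>+y. ennreal ((T y - (\<integral>z. T z \<partial>P))\<^sup>2) \<partial>P)"

definition standard_brownian_motion :: "'a measure \<Rightarrow> (real \<Rightarrow> 'a \<Rightarrow> real) \<Rightarrow> bool" where
  "standard_brownian_motion M W \<longleftrightarrow>
     prob_space M \<and>
     (\<forall>t\<in>{0..1}. W t \<in> borel_measurable M) \<and>
     (\<forall>\<omega>\<in>space M. W 0 \<omega> = 0 \<and> continuous_on {0..1} (\<lambda>t. W t \<omega>)) \<and>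
     (\<forall>s t. 0 \<le> s \<and> s < t \<and> t \<le> 1 \<longrightarrow>
        distributed M lborel (\<lambda>\<omega>. W t \<omega> - W s \<omega>) (\<lambda>x. ennreal (normal_density 0 (sqrt (t - s)) x))) \<and>
     (\<forall>(k::nat) (t::nat \<Rightarrow> real). (\<forall>i\<le>k. t i \<in> {0..1}) \<and> (\<forall>i<k. t i < t (Suc i)) \<longrightarrow>
        prob_space.indep_vars M (\<lambda>_. borel) (\<lambda>i \<omega>. W (t (Suc i)) \<omega> - W (t i) \<omega>) {..<k})"

text \<open>
  The space of continuous functions on the unit interval, with the sigma-algebra generated by
  the point evaluations.
\<close>

definition path_space :: "(real \<Rightarrow> real) measure" where
  "path_space = restrict_space (PiM {0..1} (\<lambda>_. borel)) {w. continuous_on {0..1} w}"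

text \<open>
  The law of \<open>Y\<close> with \<open>dY\<^sub>x = f(x) dx + n\<^bsup>-1/2\<^esup> dW\<^sub>x\<close> and \<open>Y\<^sub>0 = 0\<close>.
\<close>

definition white_noise_law ::
    "'a measure \<Rightarrow> (real \<Rightarrow> 'a \<Rightarrow> real) \<Rightarrow> real \<Rightarrow> (real \<Rightarrow> real) \<Rightarrow> (real \<Rightarrow> real) measure" where
  "white_noise_law M W n f =
     distr M path_space (\<lambda>\<omega>. \<lambda>x\<in>{0..1}. (LINT t:{0..x}|lborel. f t) + W x \<omega> / sqrt n)"

text \<open>
  In an estimator \<open>fhat\<close>, the first argument is the observed path and the second one the point at
  which the regression function is estimated; \<open>P f\<close> is the law of the data under \<open>f\<close>.
\<close>

definition is_regression_estimator ::
    "((real \<Rightarrow> real) \<Rightarrow> (real \<Rightarrow> real) measure) \<Rightarrow> (real \<Rightarrow> real) set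
      \<Rightarrow> ((real \<Rightarrow> real) \<Rightarrow> real \<Rightarrow> real) \<Rightarrow> bool" where
  "is_regression_estimator P F fhat \<longleftrightarrow>
     (\<lambda>(y, x). fhat y x) \<in> borel_measurable (path_space \<Otimes>\<^sub>M restrict_space borel {0..1}) \<and>
     (\<forall>f\<in>F. \<forall>x\<in>{0..1}. integrable (P f) (\<lambda>y. fhat y x))"

definition IBias_sq ::
    "((real \<Rightarrow> real) \<Rightarrow> (real \<Rightarrow> real) measure) \<Rightarrow> (real \<Rightarrow> real)
      \<Rightarrow> ((real \<Rightarrow> real) \<Rightarrow> real \<Rightarrow> real) \<Rightarrow> ennreal" where
  "IBias_sq P f fhat = (\<integral>\<^sup>+x\<in>{0..1}. ennreal (((\<integral>y. fhat y x \<partial>P f) - f x)\<^sup>2) \<partial>lborel)"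

definition IVar ::
    "((real \<Rightarrow> real) \<Rightarrow> (real \<Rightarrow> real) measure) \<Rightarrow> (real \<Rightarrow> real)
      \<Rightarrow> ((real \<Rightarrow> real) \<Rightarrow> real \<Rightarrow> real) \<Rightarrow> ennreal" where
  "IVar P f fhat = (\<integral>\<^sup>+x\<in>{0..1}. ext_variance (P f) (\<lambda>y. fhat y x) \<partial>lborel)"


section \<open>The Gaussian sequence model\<close>

text \<open>
  \<open>\<real>\<^sup>m\<close> is represented by the extensional functions on \<open>{1..m}\<close>; the Euclidean norm on it is
  \<open>\<lambda>\<theta>. L2_set \<theta> {1..m}\<close>.
\<close>

abbreviation Rm :: "nat \<Rightarrow> (nat \<Rightarrow> real) measure" where
  "Rm m \<equiv> PiM {1..m} (\<lambda>_. borel)"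

definition sequence_law :: "nat \<Rightarrow> real \<Rightarrow> (nat \<Rightarrow> real) \<Rightarrow> (nat \<Rightarrow> real) measure" where
  "sequence_law m n \<theta> =
     distr (PiM {1..m} (\<lambda>_. density lborel (\<lambda>x. ennreal (std_normal_density x)))) (Rm m)
       (\<lambda>\<epsilon>. \<lambda>i\<in>{1..m}. \<theta> i + \<epsilon> i / sqrt n)"

definition Theta_ball :: "nat \<Rightarrow> nat \<Rightarrow> real \<Rightarrow> (nat \<Rightarrow> real) set" where
  "Theta_ball m \<beta> R =
     {\<theta> \<in> space (Rm m). L2_set \<theta> {1..m} \<le> R / (Gamma_const \<beta> * real m ^ \<beta>)}"

end

theory Submission
  imports Defs "HOL-Complex_Analysis.Great_Picard"
begin

text \<open>
  Let \<open>K\<close> be a kernel attaining \<open>\<Gamma>\<^sub>\<beta>\<close>. Its rescaled translates \<open>\<phi>\<^sub>i(x) = m\<^bsup>1/2\<^esup> K(m x - i + 1/2)\<close>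
  have disjoint supports, are orthonormal, and \<open>f\<^sub>\<theta> = \<Sum>\<^sub>i \<theta>\<^sub>i \<phi>\<^sub>i\<close> lies in \<open>S\<^sup>\<beta>(R)\<close> whenever \<open>\<theta>\<close> lies in the
  ball of the sequence model. Under \<open>f\<^sub>\<theta>\<close> the coefficients \<open>X\<^sub>i = \<integral> \<phi>\<^sub>i dY\<close> follow the sequence model, and
  the remainder of \<open>Y\<close> is a Gaussian process that is independent of \<open>X\<close> and whose law does not depend on
  \<open>\<theta>\<close>. The estimator \<open>\<theta>hat\<^sub>i = E[\<integral> fhat \<phi>\<^sub>i | X]\<close> is therefore a function of \<open>X\<close> alone, and Bessel's inequality
  (with Jensen's for the variance) bounds its bias and variance by those of \<open>fhat\<close>.

  That \<open>\<Gamma>\<^sub>\<beta>\<close> is attained follows from the compactness of a minimising sequence in \<open>L\<^sup>2\<close> (Arzela-Ascoli)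
  and the parallelogram law. Because the kernel vanishes at the ends of its support, the Wiener integral
  \<open>\<integral> \<phi>\<^sub>i dW\<close> is the pathwise integral \<open>-\<integral> W \<phi>\<^sub>i'\<close>, so no stochastic integration is needed; the laws are
  compared through characteristic functions of finitely many coordinates.
\<close>

section \<open>Smooth bump functions\<close>

text \<open>The radius of \<open>Theta_ball\<close> contains \<open>Gamma_const\<close> itself, so a
  kernel that merely comes close to the infimum would serve only a smaller ball. This is why
  attainment has to be proved. The conditional expectation is taken in an explicit version: a path
  is rebuilt from the sequence observation and an auxiliary Brownian motion, and the latter is
  integrated out. The outcome is one function of the observation that serves all \<theta> at once,
  with no choice of a version for each \<theta>. A further obstacle is that
  \<open>weak_deriv\<close> is an unspecified choice, determined only almost everywhere. Compactly
  supported Sobolev functions are therefore replaced by exact iterated primitives of a square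
  integrable function, for which boundary values, estimates and limits become pointwise matters.
  Since \<beta> is positive, the kernel has a square integrable first derivative, against which the
  Brownian path is integrated.\<close>

fun Ck :: "nat \<Rightarrow> (real \<Rightarrow> real) \<Rightarrow> bool" where
  "Ck 0 f \<longleftrightarrow> True"
| "Ck (Suc k) f \<longleftrightarrow> (\<exists>f'. (\<forall>x. (f has_real_derivative f' x) (at x)) \<and> Ck k f')"

lemma Ck_SucI: "(\<And>x. (f has_real_derivative f' x) (at x)) \<Longrightarrow> Ck k f' \<Longrightarrow> Ck (Suc k) f"
  by auto

lemma Ck_Suc_iff: "Ck (Suc k) f \<longleftrightarrow> (\<forall>x. f differentiable (at x)) \<and> Ck k (deriv f)"
proof
  assume "Ck (Suc k) f"
  then obtain f' where f': "\<And>x. (f has_real_derivative f' x) (at x)" "Ck k f'" by auto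
  then have "deriv f = f'" by (auto intro!: DERIV_imp_deriv)
  then show "(\<forall>x. f differentiable (at x)) \<and> Ck k (deriv f)"
    using f' real_differentiable_def by auto
next
  assume *: "(\<forall>x. f differentiable (at x)) \<and> Ck k (deriv f)"
  then have "(f has_real_derivative deriv f x) (at x)" for x
    using DERIV_deriv_iff_real_differentiable by blast
  then show "Ck (Suc k) f" using * by auto
qed

lemma Ck_Suc_imp: "Ck (Suc k) f \<Longrightarrow> Ck k f"
  by (induction k arbitrary: f) (auto simp: Ck_Suc_iff simp del: Ck.simps(2))

text \<open>The recursive predicate names a derivative at each stage and so suits induction; the
  iterated \<open>deriv\<close> is the form in which \<open>test_function\<close> asks for
  smoothness.\<close>

lemma Ck_iff_deriv: "Ck k f \<longleftrightarrow> (\<forall>j<k. \<forall>x. (deriv ^^ j) f differentiable (at x))"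
proof (induction k arbitrary: f)
  case (Suc k)
  have "(deriv ^^ j) (deriv f) = (deriv ^^ Suc j) f" for j
    by (simp only: funpow_Suc_right comp_apply)
  then show ?case
    by (simp only: Ck_Suc_iff Suc.IH All_less_Suc2) simp
qed simp

lemma smooth_iff_Ck: "(\<forall>k x. (deriv ^^ k) f differentiable (at x)) \<longleftrightarrow> (\<forall>k. Ck k f)"
  unfolding Ck_iff_deriv by blast

lemma Ck_const [simp]: "Ck k (\<lambda>x. c)"
  by (induction k arbitrary: c) (simp_all, metis DERIV_const)

lemma Ck_add: "Ck k f \<Longrightarrow> Ck k g \<Longrightarrow> Ck k (\<lambda>x. f x + g x)"
proof (induction k arbitrary: f g)
  case (Suc k)
  then obtain f' g' where "\<And>x. (f has_real_derivative f' x) (at x)" "Ck k f'"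
    "\<And>x. (g has_real_derivative g' x) (at x)" "Ck k g'" by auto
  then show ?case
    by (intro Ck_SucI[where f' = "\<lambda>x. f' x + g' x"] Suc.IH) (auto intro!: derivative_eq_intros)
qed simp

lemma Ck_mult: "Ck k f \<Longrightarrow> Ck k g \<Longrightarrow> Ck k (\<lambda>x. f x * g x)"
proof (induction k arbitrary: f g)
  case (Suc k)
  then obtain f' g' where *: "\<And>x. (f has_real_derivative f' x) (at x)" "Ck k f'"
    "\<And>x. (g has_real_derivative g' x) (at x)" "Ck k g'" by auto
  then show ?case
    using Suc.prems[THEN Ck_Suc_imp]
    by (intro Ck_SucI[where f' = "\<lambda>x. f' x * g x + f x * g' x"] Suc.IH Ck_add)
       (auto intro!: derivative_eq_intros)
qed simp

lemma Ck_affine: "Ck k f \<Longrightarrow> Ck k (\<lambda>x. f (c * x + d))"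
proof (induction k arbitrary: f)
  case (Suc k)
  then obtain f' where *: "\<And>x. (f has_real_derivative f' x) (at x)" "Ck k f'" by auto
  have "((\<lambda>x. c * x + d) has_real_derivative c) (at x)" for x
    by (auto intro!: derivative_eq_intros)
  from DERIV_chain2[OF *(1) this]
  show ?case
    by (rule Ck_SucI) (intro Ck_mult Ck_const Suc.IH *)
qed simp

text \<open>The polynomial in 1/t makes the family closed under differentiation, so smoothness of
  the classical exp(-c/t) needs a single derivative computation. Letting \<open>c\<close> tend to 0
  later produces indicators.\<close>

definition flat_exp :: "real \<Rightarrow> real poly \<Rightarrow> real \<Rightarrow> real" where
  "flat_exp c p t = (if t > 0 then poly p (1 / t) * exp (- c / t) else 0)"

text \<open>With s = 1/t the claim becomes the decay of s^k exp(-c s) at infinity, monomial by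
  monomial.\<close>

lemma flat_exp_tendsto_0:
  fixes c :: real
  assumes "c > 0"
  shows "((\<lambda>t. poly p (1 / t) * exp (- c / t)) \<longlongrightarrow> 0) (at_right 0)"
proof -
  have mono: "((\<lambda>s. s ^ k * exp (- c * s)) \<longlongrightarrow> 0) at_top" for k :: nat
  proof -
    have "filterlim (\<lambda>s. c * s) at_top at_top"
      by (rule filterlim_tendsto_pos_mult_at_top[OF tendsto_const assms filterlim_ident[of at_top]])
    from tendsto_mult_left[OF filterlim_compose[OF tendsto_power_div_exp_0 this], of "1 / c ^ k" k]
    show ?thesis using assms by (simp add: power_mult_distrib exp_minus field_simps)
  qed
  have "((\<lambda>s. \<Sum>i\<le>degree p. coeff p i * (s ^ i * exp (- c * s))) \<longlongrightarrow> (\<Sum>i\<le>degree p. coeff p i * 0)) at_top"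
    by (intro tendsto_intros mono)
  then have "((\<lambda>s. poly p s * exp (- c * s)) \<longlongrightarrow> 0) at_top"
    by (simp add: poly_altdef sum_distrib_right mult.assoc)
  from filterlim_compose[OF this filterlim_inverse_at_top_right]
  show ?thesis by (simp add: inverse_eq_divide)
qed

text \<open>For positive t, differentiating p(1/t) exp(-c/t) gives (c p - p')(1/t) exp(-c/t) / t^2,
  and the factor 1/t^2 is the double \<open>pCons 0\<close>. At 0 both one-sided difference
  quotients tend to 0.\<close>

lemma DERIV_flat_exp:
  assumes "c > 0"
  shows "(flat_exp c p has_real_derivative
           flat_exp c (smult c (pCons 0 (pCons 0 p)) - pCons 0 (pCons 0 (pderiv p))) t) (at t)"
    (is "(_ has_real_derivative flat_exp c ?q t) _")
proof -
  consider "t < 0" | "t = 0" | "t > 0" by linarith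
  then show ?thesis
  proof cases
    case 1
    then have "\<forall>\<^sub>F s in nhds t. flat_exp c p s = 0"
      using eventually_nhds_in_open[of "{..<0}" t] by (auto elim!: eventually_mono simp: flat_exp_def)
    from DERIV_cong_ev[OF refl this refl, THEN iffD2, OF DERIV_const]
    have "(flat_exp c p has_real_derivative 0) (at t)" .
    with 1 show ?thesis by (simp only: flat_exp_def) simp
  next
    case 3
    have "((\<lambda>t. poly p (1 / t) * exp (- c / t)) has_real_derivative poly ?q (1 / t) * exp (- c / t)) (at t)"
    proof -
      have "((\<lambda>t. 1 / t) has_real_derivative - (1 / t\<^sup>2)) (at t)"
        using 3 by (auto intro!: derivative_eq_intros simp: power2_eq_square)
      from DERIV_chain2[OF poly_DERIV this, of p]
      have "((\<lambda>t. poly p (1 / t)) has_real_derivative poly (pderiv p) (1 / t) * - (1 / t\<^sup>2)) (at t)" .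
      moreover have "((\<lambda>t. exp (- c / t)) has_real_derivative exp (- c / t) * (c / t\<^sup>2)) (at t)"
        using 3 by (auto intro!: derivative_eq_intros simp: power2_eq_square)
      ultimately have "((\<lambda>t. poly p (1 / t) * exp (- c / t)) has_real_derivative
          poly (pderiv p) (1 / t) * - (1 / t\<^sup>2) * exp (- c / t) + exp (- c / t) * (c / t\<^sup>2) * poly p (1 / t)) (at t)"
        by (rule DERIV_mult)
      then show ?thesis
      proof (rule DERIV_cong)
        define u where "u = 1 / t"
        have u: "1 / t\<^sup>2 = u * u" "c / t\<^sup>2 = c * (u * u)"
          by (simp_all add: u_def power2_eq_square)
        show "poly (pderiv p) (1 / t) * - (1 / t\<^sup>2) * exp (- c / t) + exp (- c / t) * (c / t\<^sup>2) * poly p (1 / t)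
            = poly ?q (1 / t) * exp (- c / t)"
          unfolding u u_def[symmetric] by (simp add: algebra_simps)
      qed
    qed
    moreover have "\<forall>\<^sub>F s in nhds t. flat_exp c p s = poly p (1 / s) * exp (- c / s)"
      using 3 eventually_nhds_in_open[of "{0<..}" t] by (auto elim!: eventually_mono simp: flat_exp_def)
    ultimately have "(flat_exp c p has_real_derivative poly ?q (1 / t) * exp (- c / t)) (at t)"
      by (simp only: DERIV_cong_ev[OF refl _ refl])
    with 3 show ?thesis by (simp only: flat_exp_def if_True)
  next
    case 2
    have "((\<lambda>h. flat_exp c p h / h) \<longlongrightarrow> 0) (at_left 0)"
      by (rule tendsto_eventually) (auto simp: eventually_at_left_field flat_exp_def intro!: exI[of _ "-1"])
    moreover have "((\<lambda>h. flat_exp c p h / h) \<longlongrightarrow> 0) (at_right 0)"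
      \<comment> \<open>Dividing by h multiplies the polynomial part by 1/h, so the quotient stays
        in the family.\<close>
      using flat_exp_tendsto_0[OF assms, of "pCons 0 p"]
      by (rule Lim_transform_eventually)
         (auto simp: eventually_at_right_field flat_exp_def field_simps intro!: exI[of _ 1])
    ultimately have "((\<lambda>h. flat_exp c p h / h) \<longlongrightarrow> 0) (at 0)"
      by (rule filterlim_split_at)
    then show ?thesis
      unfolding DERIV_def 2 by (simp add: flat_exp_def)
  qed
qed

lemma Ck_flat_exp: "c > 0 \<Longrightarrow> Ck k (flat_exp c p)"
proof (induction k arbitrary: p)
  case (Suc k)
  then show ?case by (intro Ck_SucI[OF DERIV_flat_exp]) auto
qed simp

text \<open>Left unnormalised, so that it is bounded by 1 uniformly in positive \<open>c\<close> and
  fits dominated convergence; each factor cuts off one side.\<close>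

definition bump :: "real \<Rightarrow> real \<Rightarrow> real \<Rightarrow> real \<Rightarrow> real" where
  "bump c a b x = flat_exp c 1 (x - a) * flat_exp c 1 (b - x)"

lemma Ck_bump: "c > 0 \<Longrightarrow> Ck k (bump c a b)"
  using Ck_mult[OF Ck_affine[OF Ck_flat_exp, of c k 1 1 "-a"] Ck_affine[OF Ck_flat_exp, of c k 1 "-1" b]]
  by (simp add: bump_def[abs_def])

lemma bump_range: "c > 0 \<Longrightarrow> bump c a b x \<in> {0..1}"
  by (auto simp: bump_def flat_exp_def intro!: mult_le_one)

lemma bump_eq_0_iff: "bump c a b x = 0 \<longleftrightarrow> x \<notin> {a<..<b}"
  by (auto simp: bump_def flat_exp_def)

text \<open>As \<open>c\<close> tends to 0 the exponential factors tend to 1 inside the interval.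
  Endpoints that approach from inside keep every bump zero off the limiting open interval, so the
  limit is also right at its ends.\<close>

lemma bump_tendsto_indicator:
  assumes "u \<longlonglongrightarrow> a" "v \<longlonglongrightarrow> b" "\<And>j. a \<le> u j" "\<And>j. v j \<le> b"
  shows "(\<lambda>j. bump (1 / real (Suc j)) (u j) (v j) x) \<longlonglongrightarrow> indicator {a<..<b} x"
proof (cases "x \<in> {a<..<b}")
  case True
  have "(\<lambda>j. exp (- (1 / real (Suc j)) / (x - u j)) * exp (- (1 / real (Suc j)) / (v j - x)))
     \<longlonglongrightarrow> exp (- 0 / (x - a)) * exp (- 0 / (b - x))"
    using True by (intro tendsto_intros LIMSEQ_Suc[OF lim_1_over_n] assms) auto
  moreover have "\<forall>\<^sub>F j in sequentially. u j < x" "\<forall>\<^sub>F j in sequentially. x < v j"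
    using True assms(1,2) by (auto dest: order_tendstoD)
  then have "\<forall>\<^sub>F j in sequentially. exp (- (1 / real (Suc j)) / (x - u j)) * exp (- (1 / real (Suc j)) / (v j - x))
      = bump (1 / real (Suc j)) (u j) (v j) x"
    by eventually_elim (simp add: bump_def flat_exp_def)
  ultimately show ?thesis
    using True by (auto intro: Lim_transform_eventually)
next
  case False
  then have "bump (1 / real (Suc j)) (u j) (v j) x = 0" for j
    using assms(3,4)[of j] by (auto simp: bump_eq_0_iff)
  with False show ?thesis by simp
qed

section \<open>Test functions and their derivatives\<close>

lemma test_functionI:
  assumes "\<And>k. Ck k \<phi>" "\<And>x. x \<notin> {a..b} \<Longrightarrow> \<phi> x = 0" "{a..b} \<subseteq> interior D"
  shows "test_function D \<phi>"
proof -
  have "{x. \<phi> x \<noteq> 0} \<subseteq> {a..b}"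
    using assms(2) by blast
  then have sub: "closure {x. \<phi> x \<noteq> 0} \<subseteq> {a..b}"
    by (rule closure_minimal) simp
  have "compact (closure {x. \<phi> x \<noteq> 0})"
    using bounded_subset[OF bounded_closed_interval sub] compact_eq_bounded_closed closed_closure by blast
  moreover have "\<forall>k x. (deriv ^^ k) \<phi> differentiable (at x)"
    unfolding smooth_iff_Ck using assms(1) by blast
  ultimately show ?thesis
    unfolding test_function_def using sub assms(3) by blast
qed

lemma test_functionD:
  assumes "test_function D \<phi>"
  shows "Ck k \<phi>" "x \<notin> D \<Longrightarrow> \<phi> x = 0"
    "\<exists>a b. a < b \<and> (\<forall>x. x \<notin> {a..b} \<longrightarrow> \<phi> x = 0)"
proof -
  have ck: "\<forall>k. Ck k \<phi>" and cpt: "compact (closure {x. \<phi> x \<noteq> 0})"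
    and sub: "closure {x. \<phi> x \<noteq> 0} \<subseteq> interior D"
    using assms[unfolded test_function_def smooth_iff_Ck] by simp_all
  show "Ck k \<phi>" by (rule ck[rule_format])
  show "\<phi> x = 0" if "x \<notin> D"
  proof (rule ccontr)
    assume "\<phi> x \<noteq> 0"
    then have "x \<in> closure {x. \<phi> x \<noteq> 0}" by (intro subsetD[OF closure_subset]) simp
    then have "x \<in> D" using sub interior_subset by (meson subsetD)
    with that show False by simp
  qed
  have "bounded (closure {x. \<phi> x \<noteq> 0})" by (rule compact_imp_bounded[OF cpt])
  then obtain B where B: "\<forall>x\<in>closure {x. \<phi> x \<noteq> 0}. norm x \<le> B"
    by (auto simp only: bounded_iff)
  have "\<phi> x = 0" if "x \<notin> {- \<bar>B\<bar> - 1..\<bar>B\<bar> + 1}" for x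
  proof (rule ccontr)
    assume "\<phi> x \<noteq> 0"
    then have "x \<in> closure {x. \<phi> x \<noteq> 0}" by (intro subsetD[OF closure_subset]) simp
    with B have "norm x \<le> B" by blast
    with that show False by (simp add: abs_if split: if_splits)
  qed
  then show "\<exists>a b. a < b \<and> (\<forall>x. x \<notin> {a..b} \<longrightarrow> \<phi> x = 0)"
    by (intro exI[of _ "- \<bar>B\<bar> - 1"] exI[of _ "\<bar>B\<bar> + 1"] conjI) auto
qed

lemma deriv_funpow_Ck:
  assumes "\<And>k. Ck k f"
  shows "Ck j ((deriv ^^ k) f)"
proof -
  have "(deriv ^^ i) ((deriv ^^ k) f) = (deriv ^^ (i + k)) f" for i
    by (simp add: funpow_add)
  with assms smooth_iff_Ck[of f] show ?thesis
    unfolding Ck_iff_deriv[of j] by simp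
qed

lemma DERIV_funpow_Ck:
  assumes "\<And>k. Ck k f"
  shows "((deriv ^^ k) f has_real_derivative (deriv ^^ Suc k) f x) (at x)"
  using deriv_funpow_Ck[OF assms, of "Suc 0" k] DERIV_deriv_iff_real_differentiable
  by (simp add: Ck_Suc_iff del: Ck.simps)

lemma continuous_on_Ck: "(\<And>k. Ck k f) \<Longrightarrow> continuous_on S ((deriv ^^ k) f)"
  by (meson DERIV_funpow_Ck DERIV_isCont continuous_at_imp_continuous_on)

lemma deriv_funpow_eq_0:
  assumes "open S" "\<And>x. x \<in> S \<Longrightarrow> \<phi> x = 0" "x \<in> S"
  shows "(deriv ^^ k) \<phi> x = 0"
  using assms(3)
proof (induction k arbitrary: x)
  case (Suc k)
  have "\<forall>\<^sub>F y in nhds x. (deriv ^^ k) \<phi> y = 0"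
    using Suc assms(1) by (auto simp: eventually_nhds)
  then have "deriv ((deriv ^^ k) \<phi>) x = deriv (\<lambda>_. 0) x" by (intro deriv_cong_ev) auto
  then show ?case by simp
qed (use assms in auto)

lemma deriv_funpow_test_0:
  "(\<And>x. x \<notin> {a..b} \<Longrightarrow> \<phi> x = 0) \<Longrightarrow> x \<notin> {a..b} \<Longrightarrow> (deriv ^^ k) \<phi> x = (0::real)"
  by (rule deriv_funpow_eq_0[of "- {a..b}"]) auto

lemma test_function_bump:
  "c > 0 \<Longrightarrow> {a..b} \<subseteq> interior D \<Longrightarrow> test_function D (bump c a b)"
  by (rule test_functionI[of _ a b]) (auto intro: Ck_bump simp: bump_eq_0_iff)

section \<open>The fundamental lemma of the calculus of variations\<close>

text \<open>A Dynkin argument: the sets over which \<open>h\<close> integrates to zero are closed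
  under complements and countable disjoint unions, and they contain the open intervals, an
  intersection-stable generator of the Borel sets.\<close>

lemma AE_zero_if_interval_integrals_zero:
  fixes h :: "real \<Rightarrow> real"
  assumes h: "integrable lborel h" and zero: "\<And>c d. c < d \<Longrightarrow> (LINT x:{c<..<d}|lborel. h x) = 0"
  shows "AE x in lborel. h x = 0"
proof (rule sigma_finite_measure.density_zero[OF sigma_finite_lborel h])
  have zero': "(LINT x:{c<..<d}|lborel. h x) = 0" for c d
    using zero[of c d] by (cases "c < d") (auto simp: set_lebesgue_integral_def)
  have si: "set_integrable lborel A h" if "A \<in> sets lborel" for A
    using h that unfolding set_integrable_def by (intro integrable_mult_indicator) simp_all
  \<comment> \<open>The complement step needs the integral over the whole line, obtained from
    growing intervals by dominated convergence.\<close>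
  have total: "integral\<^sup>L lborel h = 0"
  proof -
    have "(\<lambda>n. LINT x|lborel. indicator {- real n<..<real n} x *\<^sub>R h x) \<longlonglongrightarrow> integral\<^sup>L lborel h"
    proof (rule integral_dominated_convergence[where w = "\<lambda>x. norm (h x)"])
      show "AE x in lborel. (\<lambda>n. indicator {- real n<..<real n} x *\<^sub>R h x) \<longlonglongrightarrow> h x"
      proof (rule AE_I2, rule tendsto_eventually)
        fix x :: real
        obtain N where "\<bar>x\<bar> < real N" using reals_Archimedean2 by blast
        then show "\<forall>\<^sub>F n in sequentially. indicator {- real n<..<real n} x *\<^sub>R h x = h x"
          by (intro eventually_sequentiallyI[of N]) (auto simp: indicator_def)
      qed
      show "(\<lambda>x. indicator {- real n<..<real n} x *\<^sub>R h x) \<in> borel_measurable lborel" for n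
        using h borel_measurable_integrable[OF h] by measurable
    qed (use h in \<open>auto simp: indicator_def\<close>)
    moreover have "(LINT x|lborel. indicator {- real n<..<real n} x *\<^sub>R h x) = 0" for n
      using zero'[of "- real n" "real n"] by (simp add: set_lebesgue_integral_def)
    ultimately show ?thesis
      by (simp add: LIMSEQ_const_iff)
  qed
  fix A :: "real set" assume "A \<in> sets lborel"
  then have A: "A \<in> sigma_sets UNIV (range (\<lambda>(a, b). box a b :: real set))"
    by (simp add: borel_eq_box)
  have stab: "Int_stable (range (\<lambda>(a, b). box a b :: real set))"
  proof (rule Int_stableI)
    fix X Y :: "real set" assume "X \<in> range (\<lambda>(a, b). box a b)" "Y \<in> range (\<lambda>(a, b). box a b)"
    then obtain a b c d where "X = box a b" "Y = box c d" by fast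
    then have "X \<inter> Y = box (max a c) (min b d)" by simp
    then show "X \<inter> Y \<in> range (\<lambda>(a, b). box a b)" by (metis (mono_tags) case_prod_conv rangeI)
  qed
  have sub: "range (\<lambda>(a, b). box a b :: real set) \<subseteq> Pow UNIV" by simp
  from stab sub A show "(LINT x:A|lborel. h x) = 0"
  proof (induction rule: sigma_sets_induct_disjoint)
    case (basic A)
    then show ?case using zero' by (auto simp: box_real)
  next
    case empty
    then show ?case by (simp add: set_lebesgue_integral_def)
  next
    case (compl A)
    then have A: "A \<in> sets lborel" by (simp add: borel_eq_box)
    have "(LINT x:A \<union> (UNIV - A)|lborel. h x) = (LINT x:A|lborel. h x) + (LINT x:UNIV - A|lborel. h x)"
      using A by (intro set_integral_Un si) auto
    with compl total show ?case by (simp add: set_lebesgue_integral_def)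
  next
    case (union A)
    then have A: "A i \<in> sets lborel" for i by (simp add: borel_eq_box image_subset_iff)
    have "(LINT x:(\<Union>i. A i)|lborel. h x) = (\<Sum>i. LINT x:A i|lborel. h x)"
      using A union(1) by (intro lebesgue_integral_countable_add si) (auto simp: disjoint_family_on_def)
    with union show ?case by simp
  qed
qed

text \<open>Indicators of open intervals are bounded limits of test functions, so testing with the
  latter already yields all interval integrals of \<open>h\<close>.\<close>

lemma fundamental_lemma_interval:
  fixes h :: "real \<Rightarrow> real"
  assumes h: "set_integrable lborel {a..b} h"
    and zero: "\<And>\<phi>. test_function {a..b} \<phi> \<Longrightarrow> (LINT x:{a..b}|lborel. h x * \<phi> x) = 0"
  shows "AE x in lborel. x \<in> {a..b} \<longrightarrow> h x = 0"
proof -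
  define g where "g x = indicator {a..b} x * h x" for x
  have g: "integrable lborel g"
    using h by (simp add: g_def[abs_def] set_integrable_def)
  then have [measurable]: "g \<in> borel_measurable borel" by (auto dest: borel_measurable_integrable)
  have "AE x in lborel. g x = 0"
  proof (rule AE_zero_if_interval_integrals_zero[OF g])
    fix c d :: real assume "c < d"
    \<comment> \<open>The interval is cut down to {a..b}, and the bumps retreat by 1/(j+1) on each
      side: their closed supports then lie in the interior, as \<open>test_function\<close> demands.
      If the intersection is empty, the bumps are zero.\<close>
    define c' d' where "c' = max a c" and "d' = min b d"
    define u v where "u j = c' + 1 / real (Suc j)" and "v j = d' - 1 / real (Suc j)" for j
    have uv: "u \<longlonglongrightarrow> c' + 0" "v \<longlonglongrightarrow> d' - 0"
      unfolding u_def[abs_def] v_def[abs_def] by (intro tendsto_intros LIMSEQ_Suc[OF lim_1_over_n])+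
    have uv': "c' < u j" "v j < d'" for j by (auto simp: u_def v_def)
    let ?\<eta> = "\<lambda>j. bump (1 / real (Suc j)) (u j) (v j)"
    have tst: "test_function {a..b} (?\<eta> j)" for j
      using uv'[of j] by (intro test_function_bump) (auto simp: c'_def d'_def)
    have "(\<lambda>j. LINT x|lborel. g x * ?\<eta> j x) \<longlonglongrightarrow> (LINT x|lborel. g x * indicator {c'<..<d'} x)"
    proof (rule integral_dominated_convergence[where w = "\<lambda>x. norm (g x)"])
      have "?\<eta> j \<in> borel_measurable borel" for j
        using continuous_on_Ck[OF Ck_bump, of "1 / real (Suc j)" UNIV 0]
        by (intro borel_measurable_continuous_onI) auto
      then show "(\<lambda>x. g x * ?\<eta> j x) \<in> borel_measurable lborel" for j
        using borel_measurable_integrable[OF g] by measurable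
      show "AE x in lborel. (\<lambda>j. g x * ?\<eta> j x) \<longlonglongrightarrow> g x * indicator {c'<..<d'} x"
        using uv uv' by (intro AE_I2 tendsto_mult_left bump_tendsto_indicator) (auto intro: less_imp_le)
      show "AE x in lborel. norm (g x * ?\<eta> j x) \<le> norm (g x)" for j
        using bump_range[of "1 / real (Suc j)" "u j" "v j"]
        by (intro AE_I2) (auto simp: abs_mult intro!: mult_left_le)
      show "(\<lambda>x. g x * indicator {c'<..<d'} x) \<in> borel_measurable lborel"
        using borel_measurable_integrable[OF g] by measurable
    qed (use g in auto)
    moreover have "(LINT x|lborel. g x * ?\<eta> j x) = 0" for j
      using zero[OF tst[of j]] by (simp add: g_def set_lebesgue_integral_def mult.assoc)
    ultimately have "(LINT x|lborel. g x * indicator {c'<..<d'} x) = 0"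
      by (simp add: LIMSEQ_const_iff)
    moreover have "AE x in lborel. g x * indicator {c'<..<d'} x = indicator {c<..<d} x *\<^sub>R g x"
      using AE_lborel_singleton[of a] AE_lborel_singleton[of b]
      by eventually_elim (auto simp: g_def c'_def d'_def indicator_def)
    then have "(LINT x|lborel. g x * indicator {c'<..<d'} x) = (LINT x:{c<..<d}|lborel. g x)"
      using borel_measurable_integrable[OF g] unfolding set_lebesgue_integral_def
      by (intro integral_cong_AE) measurable
    ultimately show "(LINT x:{c<..<d}|lborel. g x) = 0" by simp
  qed
  then show ?thesis
    by eventually_elim (auto simp: g_def)
qed

lemma test_function_mono: "test_function A \<phi> \<Longrightarrow> interior A \<subseteq> interior B \<Longrightarrow> test_function B \<phi>"
  unfolding test_function_def by blast

text \<open>On a set of finite measure the inequality |f| \<le> 1 + f^2 turns square integrability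
  into integrability.\<close>

lemma set_integrable_of_square:
  assumes "square_integrable_on D f" "A \<subseteq> D" "A \<in> sets borel" "emeasure lborel A < \<infinity>"
  shows "set_integrable lborel A f"
proof -
  have 1: "set_integrable lborel D (\<lambda>x. (f x)\<^sup>2)" and 2: "set_borel_measurable lborel D f"
    using assms(1) by (auto simp: square_integrable_on_def)
  have m: "(\<lambda>x. indicator A x *\<^sub>R f x) \<in> borel_measurable lborel"
  proof -
    have "(\<lambda>x. indicator A x *\<^sub>R (indicator D x *\<^sub>R f x)) \<in> borel_measurable lborel"
      using 2 assms(3) unfolding set_borel_measurable_def by measurable
    moreover have "(\<lambda>x. indicator A x *\<^sub>R (indicator D x *\<^sub>R f x)) = (\<lambda>x. indicator A x *\<^sub>R f x)"
      using assms(2) by (auto simp: indicator_def fun_eq_iff)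
    ultimately show ?thesis by simp
  qed
  have "integrable lborel (\<lambda>x. indicator A x + indicator D x *\<^sub>R (f x)\<^sup>2)"
    using 1 assms(3,4) unfolding set_integrable_def
    by (intro Bochner_Integration.integrable_add) (auto simp: less_top)
  then show ?thesis
    unfolding set_integrable_def
  proof (rule Bochner_Integration.integrable_bound[OF _ m], intro AE_I2)
    fix x
    have "\<bar>f x\<bar> \<le> 1 + (f x)\<^sup>2"
      using sum_power2_ge_zero[of "\<bar>f x\<bar> - 1" 0] by (cases "\<bar>f x\<bar> \<le> 1") (auto simp: power2_eq_square abs_if algebra_simps mult_le_cancel_left1 intro: add_increasing)
    then show "norm (indicator A x *\<^sub>R f x) \<le> norm (indicator A x + indicator D x *\<^sub>R (f x)\<^sup>2)"
      using assms(2) by (auto simp: indicator_def)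
  qed
qed

text \<open>Test functions on a bounded interval are test functions on the line, and countably many
  such intervals exhaust the line.\<close>

lemma fundamental_lemma_UNIV:
  fixes h :: "real \<Rightarrow> real"
  assumes h: "\<And>a b. set_integrable lborel {a..b} h"
    and zero: "\<And>\<phi>. test_function UNIV \<phi> \<Longrightarrow> (LINT x|lborel. h x * \<phi> x) = 0"
  shows "AE x in lborel. h x = 0"
proof -
  have "AE x in lborel. x \<in> {- real n..real n} \<longrightarrow> h x = 0" for n
  proof (rule fundamental_lemma_interval[OF h])
    fix \<phi> assume \<phi>: "test_function {- real n..real n} \<phi>"
    have "(LINT x:{- real n..real n}|lborel. h x * \<phi> x) = (LINT x|lborel. h x * \<phi> x)"
      unfolding set_lebesgue_integral_def
      using test_functionD(2)[OF \<phi>] by (intro Bochner_Integration.integral_cong) (auto simp: indicator_def)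
    also have "\<dots> = 0" using \<phi> by (intro zero test_function_mono[OF \<phi>]) auto
    finally show "(LINT x:{- real n..real n}|lborel. h x * \<phi> x) = 0" .
  qed
  then have "AE x in lborel. \<forall>n. x \<in> {- real n..real n} \<longrightarrow> h x = 0"
    by (subst AE_all_countable) blast
  then show ?thesis
  proof eventually_elim
    fix x :: real assume *: "\<forall>n. x \<in> {- real n..real n} \<longrightarrow> h x = 0"
    obtain N where "\<bar>x\<bar> < real N" using reals_Archimedean2 by blast
    then show "h x = 0" using *[rule_format, of N] by (auto simp: abs_less_iff)
  qed
qed

lemma set_integrable_mult_continuous:
  fixes w f :: "real \<Rightarrow> real"
  assumes w: "set_integrable lborel {p..q} w" and f: "continuous_on {p..q} f"
  shows "set_integrable lborel {p..q} (\<lambda>x. w x * f x)"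
proof -
  have "bounded (f ` {p..q})"
    by (intro compact_imp_bounded compact_continuous_image f) auto
  then obtain B where B: "\<And>x. x \<in> {p..q} \<Longrightarrow> \<bar>f x\<bar> \<le> B"
    unfolding bounded_iff by (metis imageI real_norm_def)
  let ?w = "\<lambda>x. indicator {p..q} x *\<^sub>R w x"
  have i: "integrable lborel ?w" using w by (simp add: set_integrable_def)
  then have [measurable]: "?w \<in> borel_measurable borel" by auto
  have [measurable]: "(\<lambda>x. indicator {p..q} x *\<^sub>R f x) \<in> borel_measurable borel"
    by (rule borel_measurable_continuous_on_indicator[OF _ f]) simp
  show ?thesis
    unfolding set_integrable_def
  proof (rule Bochner_Integration.integrable_bound[of _ "\<lambda>x. B * norm (?w x)"])
    show "integrable lborel (\<lambda>x. B * norm (?w x))" by (intro integrable_mult_right integrable_norm i)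
    have "(\<lambda>x. ?w x * (indicator {p..q} x *\<^sub>R f x)) \<in> borel_measurable lborel" by measurable
    also have "(\<lambda>x. ?w x * (indicator {p..q} x *\<^sub>R f x)) = (\<lambda>x. indicator {p..q} x *\<^sub>R (w x * f x))"
      by (auto simp: indicator_def fun_eq_iff)
    finally show "(\<lambda>x. indicator {p..q} x *\<^sub>R (w x * f x)) \<in> borel_measurable lborel" .
    show "AE x in lborel. norm (indicator {p..q} x *\<^sub>R (w x * f x)) \<le> norm (B * norm (?w x))"
    proof (rule AE_I2)
      fix x
      have "\<bar>w x\<bar> * \<bar>f x\<bar> \<le> \<bar>w x\<bar> * \<bar>B\<bar>" if "x \<in> {p..q}"
        using B[OF that] by (intro mult_left_mono) auto
      then show "norm (indicator {p..q} x *\<^sub>R (w x * f x)) \<le> norm (B * norm (?w x))"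
        by (cases "x \<in> {p..q}") (auto simp: abs_mult mult.commute)
    qed
  qed
qed

lemma integrable_if_zero_outside:
  fixes k :: "real \<Rightarrow> real"
  assumes "set_integrable lborel {p..q} k" "\<And>x. x \<notin> {p..q} \<Longrightarrow> k x = 0"
  shows "integrable lborel k"
proof -
  have "(\<lambda>x. indicator {p..q} x *\<^sub>R k x) = k"
    using assms(2) by (auto simp: indicator_def fun_eq_iff)
  with assms(1) show ?thesis by (simp add: set_integrable_def)
qed

text \<open>The difference of two weak derivatives annihilates every test function. This allows the
  value chosen by \<open>weak_deriv\<close> to be replaced by an explicit one.\<close>

lemma weak_deriv_unique_interval:
  assumes "square_integrable_on {a..b} g1" "square_integrable_on {a..b} g2"
    "is_weak_deriv k {a..b} f g1" "is_weak_deriv k {a..b} f g2"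
  shows "AE x in lborel. x \<in> {a..b} \<longrightarrow> g1 x = g2 x"
proof -
  have i: "set_integrable lborel {a..b} g1" "set_integrable lborel {a..b} g2"
    using assms by (auto intro!: set_integrable_of_square[of "{a..b}"] simp: emeasure_lborel_Icc_eq)
  have b: "set_integrable lborel {a..b} (\<lambda>x. g x * \<phi> x)"
    if "set_integrable lborel {a..b} g" "test_function {a..b} \<phi>" for g \<phi>
    using continuous_on_Ck[OF test_functionD(1)[OF that(2)], of "{a..b}" 0]
    by (intro set_integrable_mult_continuous that) simp
  have "AE x in lborel. x \<in> {a..b} \<longrightarrow> g1 x - g2 x = 0"
  proof (rule fundamental_lemma_interval)
    show "set_integrable lborel {a..b} (\<lambda>x. g1 x - g2 x)" using i by auto
    fix \<phi> assume \<phi>: "test_function {a..b} \<phi>"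
    have "(-1) ^ k * (LINT x:{a..b}|lborel. g1 x * \<phi> x) = (-1) ^ k * (LINT x:{a..b}|lborel. g2 x * \<phi> x)"
      using assms(3,4)[unfolded is_weak_deriv_def, THEN conjunct2, THEN conjunct2, rule_format, OF \<phi>] by simp
    then show "(LINT x:{a..b}|lborel. (g1 x - g2 x) * \<phi> x) = 0"
      using b[OF i(1) \<phi>] b[OF i(2) \<phi>] by (simp add: left_diff_distrib)
  qed
  then show ?thesis by eventually_elim auto
qed

section \<open>Iterated primitives with compact support\<close>

text \<open>Vanishing off {a..b} is demanded pointwise, not almost everywhere, so that members of a
  chain have definite boundary values.\<close>

definition supp_sq :: "real \<Rightarrow> real \<Rightarrow> (real \<Rightarrow> real) \<Rightarrow> bool" where
  "supp_sq a b h \<longleftrightarrow> h \<in> borel_measurable borel \<and> integrable lborel (\<lambda>x. (h x)\<^sup>2) \<and> (\<forall>x. x \<notin> {a..b} \<longrightarrow> h x = 0)"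

definition prim :: "(real \<Rightarrow> real) \<Rightarrow> real \<Rightarrow> real" where
  "prim h x = (LINT t:{..x}|lborel. h t)"

lemma supp_sqD:
  assumes "supp_sq a b h"
  shows "h \<in> borel_measurable borel" "integrable lborel (\<lambda>x. (h x)\<^sup>2)" "x \<notin> {a..b} \<Longrightarrow> h x = 0"
  using assms by (auto simp: supp_sq_def)

lemma supp_sq_continuousI:
  assumes "continuous_on UNIV f" "\<And>x. x \<notin> {a..b} \<Longrightarrow> f x = 0"
  shows "supp_sq a b f"
proof -
  have "integrable lborel (\<lambda>x. indicator {a..b} x *\<^sub>R (f x)\<^sup>2)"
    by (intro borel_integrable_compact continuous_intros continuous_on_subset[OF assms(1)]) auto
  also have "(\<lambda>x. indicator {a..b} x *\<^sub>R (f x)\<^sup>2) = (\<lambda>x. (f x)\<^sup>2)"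
    using assms(2) by (auto simp: indicator_def fun_eq_iff)
  finally show ?thesis
    using assms by (auto simp: supp_sq_def intro: borel_measurable_continuous_onI)
qed

lemma abs_le_1_plus_square: "\<bar>x\<bar> \<le> 1 + x\<^sup>2" for x :: real
proof -
  have "0 \<le> (\<bar>x\<bar> - 1)\<^sup>2 + \<bar>x\<bar>" by simp
  then have "0 \<le> x\<^sup>2 + 1 - \<bar>x\<bar>" by (simp add: power2_diff)
  then show ?thesis by simp
qed

lemma supp_sq_integrable:
  assumes "supp_sq a b h"
  shows "integrable lborel h"
proof -
  have "integrable lborel (\<lambda>x. indicator {a..b} x + (h x)\<^sup>2)"
    using supp_sqD(2)[OF assms] by (intro Bochner_Integration.integrable_add) (auto simp: emeasure_lborel_Icc_eq)
  then show ?thesis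
    by (rule Bochner_Integration.integrable_bound)
       (use supp_sqD[OF assms] abs_le_1_plus_square[of "h _"] in \<open>auto simp: indicator_def intro!: AE_I2\<close>)
qed

lemma supp_sq_mult_integrable:
  assumes h: "supp_sq a b h" and f: "continuous_on {a..b} f"
  shows "integrable lborel (\<lambda>x. h x * f x)"
proof (rule integrable_if_zero_outside)
  have "set_integrable lborel {a..b} h"
    using integrable_mult_indicator[OF _ supp_sq_integrable[OF h], of "{a..b}"] by (simp add: set_integrable_def)
  then show "set_integrable lborel {a..b} (\<lambda>x. h x * f x)"
    by (rule set_integrable_mult_continuous[OF _ f])
qed (use supp_sqD(3)[OF h] in auto)

lemma prim_eq_0: "supp_sq a b h \<Longrightarrow> x < a \<Longrightarrow> prim h x = 0"
  unfolding prim_def set_lebesgue_integral_def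
  by (intro integral_eq_zero_AE AE_I2) (auto simp: indicator_def supp_sq_def)

lemma prim_eq_total: "supp_sq a b h \<Longrightarrow> b \<le> x \<Longrightarrow> prim h x = integral\<^sup>L lborel h"
  unfolding prim_def set_lebesgue_integral_def
  by (intro Bochner_Integration.integral_cong) (auto simp: indicator_def supp_sq_def)

lemma prim_diff:
  assumes "integrable lborel h" "x \<le> y"
  shows "prim h y - prim h x = (LINT t:{x<..y}|lborel. h t)"
proof -
  have si: "set_integrable lborel A h" if "A \<in> sets borel" for A
    using assms that unfolding set_integrable_def by (intro integrable_mult_indicator) auto
  have "{..y} = {..x} \<union> {x<..y}" using assms(2) by auto
  then have "prim h y = (LINT t:{..x} \<union> {x<..y}|lborel. h t)" by (simp add: prim_def)
  also have "\<dots> = prim h x + (LINT t:{x<..y}|lborel. h t)"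
    unfolding prim_def by (rule set_integral_Un) (auto intro: si)
  finally show ?thesis by simp
qed

text \<open>The quadratic form s^2 F + 2 s t I + t^2 G is the integral of a square, hence
  nonnegative; the inequality is its value at a suitable (s, t).\<close>

lemma integral_Cauchy_Schwarz:
  fixes f g :: "'a \<Rightarrow> real"
  assumes "integrable M (\<lambda>x. (f x)\<^sup>2)" "integrable M (\<lambda>x. (g x)\<^sup>2)" "integrable M (\<lambda>x. f x * g x)"
  shows "(integral\<^sup>L M (\<lambda>x. f x * g x))\<^sup>2 \<le> integral\<^sup>L M (\<lambda>x. (f x)\<^sup>2) * integral\<^sup>L M (\<lambda>x. (g x)\<^sup>2)"
proof -
  let ?F = "integral\<^sup>L M (\<lambda>x. (f x)\<^sup>2)" and ?G = "integral\<^sup>L M (\<lambda>x. (g x)\<^sup>2)" and ?I = "integral\<^sup>L M (\<lambda>x. f x * g x)"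
  have q: "0 \<le> s\<^sup>2 * ?F + 2 * s * t * ?I + t\<^sup>2 * ?G" for s t
  proof -
    have "0 \<le> integral\<^sup>L M (\<lambda>x. (s * f x + t * g x)\<^sup>2)" by simp
    also have "(\<lambda>x. (s * f x + t * g x)\<^sup>2) = (\<lambda>x. s\<^sup>2 * (f x)\<^sup>2 + 2 * s * t * (f x * g x) + t\<^sup>2 * (g x)\<^sup>2)"
      by (simp add: power2_eq_square algebra_simps)
    finally show ?thesis using assms by simp
  qed
  have F: "0 \<le> ?F" and G: "0 \<le> ?G" by simp_all
  show ?thesis
  proof (cases "?G = 0")
    case False
    with G have "?G > 0" by linarith
    have "0 \<le> ?G\<^sup>2 * ?F + 2 * ?G * (- ?I) * ?I + (- ?I)\<^sup>2 * ?G" by (rule q)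
    also have "\<dots> = ?G * (?F * ?G - ?I\<^sup>2)" by (simp add: power2_eq_square algebra_simps)
    finally show ?thesis using \<open>?G > 0\<close> by (simp add: zero_le_mult_iff)
  next
    case True
    \<comment> \<open>With G = 0 the choice s = I, t = -(F + 1) gives -(F + 2) I^2, which forces I =
      0.\<close>
    have "0 \<le> ?I\<^sup>2 * ?F + 2 * ?I * (- (?F + 1)) * ?I + (- (?F + 1))\<^sup>2 * ?G" by (rule q)
    moreover have "?I\<^sup>2 * ?F + 2 * ?I * (- (?F + 1)) * ?I = - ((?F + 2) * ?I\<^sup>2)"
      by (simp add: power2_eq_square algebra_simps)
    ultimately have "(?F + 2) * ?I\<^sup>2 \<le> 0" using True by simp
    moreover have "?F + 2 > 0" using F by linarith
    ultimately have "?I\<^sup>2 \<le> 0" by (simp only: mult_le_0_iff) auto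
    then have "?I = 0" by simp
    with True show ?thesis by simp
  qed
qed

text \<open>Cauchy-Schwarz against the indicator of the interval between the points. The Hoelder
  exponent 1/2 later supplies continuity of primitives, equicontinuity and pointwise limits.\<close>

lemma prim_holder:
  assumes h: "supp_sq a b h"
  shows "\<bar>prim h y - prim h x\<bar> \<le> sqrt \<bar>y - x\<bar> * sqrt (LINT t|lborel. (h t)\<^sup>2)"
proof -
  have *: "\<bar>prim h y - prim h x\<bar> \<le> sqrt (y - x) * sqrt (LINT t|lborel. (h t)\<^sup>2)" if "x \<le> y" for x y
  proof -
    let ?i = "indicat_real {x<..y}"
    have i: "integrable lborel (\<lambda>t. ?i t * h t)"
      using integrable_mult_indicator[OF _ supp_sq_integrable[OF h], of "{x<..y}"] by simp
    have i2: "integrable lborel ?i" by (auto simp: that)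
    have sq: "(\<lambda>t. (?i t)\<^sup>2) = ?i" by (auto simp: indicator_def)
    have "(prim h y - prim h x)\<^sup>2 = (LINT t|lborel. ?i t * h t)\<^sup>2"
      using prim_diff[OF supp_sq_integrable[OF h] that] by (simp add: set_lebesgue_integral_def)
    also have "\<dots> \<le> (LINT t|lborel. (?i t)\<^sup>2) * (LINT t|lborel. (h t)\<^sup>2)"
      using i i2 supp_sqD(2)[OF h] by (intro integral_Cauchy_Schwarz) (auto simp: sq)
    also have "\<dots> = (y - x) * (LINT t|lborel. (h t)\<^sup>2)"
      using that by (simp add: sq)
    finally show ?thesis
      by (metis real_sqrt_abs real_sqrt_le_mono real_sqrt_mult)
  qed
  show ?thesis using *[of x y] *[of y x] by (cases "x \<le> y") (auto simp: abs_minus_commute)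
qed

lemma continuous_prim:
  assumes h: "supp_sq a b h"
  shows "continuous_on S (prim h)"
proof (intro continuous_at_imp_continuous_on ballI)
  fix x
  have "((\<lambda>y. sqrt \<bar>y - x\<bar> * sqrt (LINT t|lborel. (h t)\<^sup>2)) \<longlongrightarrow> sqrt \<bar>x - x\<bar> * sqrt (LINT t|lborel. (h t)\<^sup>2)) (at x)"
    by (intro tendsto_intros)
  then have "((\<lambda>y. sqrt \<bar>y - x\<bar> * sqrt (LINT t|lborel. (h t)\<^sup>2)) \<longlongrightarrow> 0) (at x)" by simp
  then have "((\<lambda>y. prim h y - prim h x) \<longlongrightarrow> 0) (at x)"
    by (rule Lim_null_comparison[rotated]) (simp add: prim_holder[OF h])
  then show "isCont (prim h) x"
    unfolding isCont_def by (rule LIM_zero_cancel)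
qed

text \<open>Fubini on the triangle t \<le> x: the inner integral of \<phi>' from t to B is \<phi>(B)
  - \<phi>(t). No term arises at A, because the primitive is zero to the left of the
  support.\<close>

lemma prim_by_parts:
  assumes h: "supp_sq a b h" and AB: "A \<le> a" "b \<le> B"
    and \<phi>: "\<And>x. (\<phi> has_real_derivative \<phi>' x) (at x)" and c: "continuous_on UNIV \<phi>'"
  shows "(LINT x:{A..B}|lborel. prim h x * \<phi>' x) = \<phi> B * integral\<^sup>L lborel h - (LINT x|lborel. h x * \<phi> x)"
proof -
  have [measurable]: "h \<in> borel_measurable borel" by (rule supp_sqD[OF h])
  have [measurable]: "\<phi>' \<in> borel_measurable borel" using c by (rule borel_measurable_continuous_onI)
  let ?F = "\<lambda>x t. indicator {A..B} x * (if t \<le> x then h t else 0) * \<phi>' x"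
  have bd: "bounded (\<phi>' ` {A..B})"
    by (intro compact_imp_bounded compact_continuous_image continuous_on_subset[OF c]) auto
  then obtain C where C: "\<And>x. x \<in> {A..B} \<Longrightarrow> \<bar>\<phi>' x\<bar> \<le> C"
    unfolding bounded_iff by (metis imageI real_norm_def)
  have int: "integrable (lborel \<Otimes>\<^sub>M lborel) (case_prod ?F)"
  proof -
    have 1: "integrable lborel (\<lambda>x. C * indicat_real {A..B} x)"
      by (intro integrable_mult_right) (auto simp: emeasure_lborel_Icc_eq)
    have "integrable (lborel \<Otimes>\<^sub>M lborel) (\<lambda>(x, t). (C * indicat_real {A..B} x) * h t)"
    proof (rule lborel_pair.Fubini_integrable)
      show "(\<lambda>(x, t). (C * indicat_real {A..B} x) * h t) \<in> borel_measurable (lborel \<Otimes>\<^sub>M lborel)" by measurable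
      show "integrable lborel (\<lambda>x. LINT y|lborel. norm (case (x, y) of (x, t) \<Rightarrow> C * indicat_real {A..B} x * h t))"
        using integrable_norm[OF 1] by (simp add: abs_mult)
      show "AE x in lborel. integrable lborel (\<lambda>y. case (x, y) of (x, t) \<Rightarrow> C * indicat_real {A..B} x * h t)"
        using supp_sq_integrable[OF h] by auto
    qed
    then show ?thesis
    proof (rule Bochner_Integration.integrable_bound)
      show "case_prod ?F \<in> borel_measurable (lborel \<Otimes>\<^sub>M lborel)" by measurable
      show "AE z in lborel \<Otimes>\<^sub>M lborel. norm (case_prod ?F z) \<le> norm (case z of (x, t) \<Rightarrow> C * indicat_real {A..B} x * h t)"
      proof (rule AE_I2, clarify)
        fix x t
        have "\<bar>h t\<bar> * \<bar>\<phi>' x\<bar> \<le> \<bar>h t\<bar> * \<bar>C\<bar>" if "x \<in> {A..B}"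
          using C[OF that] by (intro mult_left_mono) auto
        then show "norm (?F x t) \<le> norm (C * indicat_real {A..B} x * h t)"
          by (auto simp: indicator_def abs_mult mult.commute)
      qed
    qed
  qed
  have "(LINT x:{A..B}|lborel. prim h x * \<phi>' x) = (LINT x|lborel. LINT t|lborel. ?F x t)"
  proof -
    have "prim h x = (LINT t|lborel. (if t \<le> x then h t else 0))" for x
      unfolding prim_def set_lebesgue_integral_def
      by (intro Bochner_Integration.integral_cong) (auto simp: indicator_def)
    then show ?thesis by (simp add: set_lebesgue_integral_def mult.assoc)
  qed
  also have "\<dots> = (LINT t|lborel. LINT x|lborel. ?F x t)"
    using lborel_pair.Fubini_integral[OF int] by simp
  also have "\<dots> = (LINT t|lborel. \<phi> B * h t - h t * \<phi> t)"
  proof (rule Bochner_Integration.integral_cong[OF refl])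
    fix t
    show "(LINT x|lborel. ?F x t) = \<phi> B * h t - h t * \<phi> t"
    proof (cases "t \<in> {a..b}")
      case True
      have "(LINT x|lborel. ?F x t) = (LINT x|lborel. h t * (\<phi>' x * indicator {t..B} x))"
        using True AB by (intro Bochner_Integration.integral_cong) (auto simp: indicator_def)
      also have "\<dots> = h t * (\<phi> B - \<phi> t)"
        using True AB \<phi> c by (subst integral_mult_right_zero, subst integral_FTC_Icc_real[where F = \<phi>])
          (auto simp: continuous_on_eq_continuous_at)
      finally show ?thesis by (simp add: algebra_simps)
    next
      case False
      then have "(\<lambda>x. ?F x t) = (\<lambda>x. 0)" using supp_sqD(3)[OF h, of t] by auto
      with False show ?thesis using supp_sqD(3)[OF h, of t] by simp
    qed
  qed
  also have "\<dots> = \<phi> B * integral\<^sup>L lborel h - (LINT x|lborel. h x * \<phi> x)"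
  proof -
    have "continuous_on {a..b} \<phi>" using \<phi> by (meson DERIV_isCont continuous_at_imp_continuous_on)
    then show ?thesis
      using supp_sq_integrable[OF h] supp_sq_mult_integrable[OF h] by (subst Bochner_Integration.integral_diff) auto
  qed
  finally show ?thesis .
qed

text \<open>
  In a chain, \<open>G k\<close> is the \<open>k\<close>-th weak derivative of \<open>G 0\<close>; the vanishing of all members outside \<open>{a..b}\<close>
  encodes the boundary conditions at both ends.
\<close>

definition chain :: "nat \<Rightarrow> real \<Rightarrow> real \<Rightarrow> (nat \<Rightarrow> real \<Rightarrow> real) \<Rightarrow> bool" where
  "chain \<beta> a b G \<longleftrightarrow> (\<forall>k\<le>\<beta>. supp_sq a b (G k)) \<and> (\<forall>k<\<beta>. G k = prim (G (Suc k)))"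

text \<open>Each integration by parts leaves a boundary term proportional to the total integral of
  the next member. That integral is the value of the current member beyond \<open>b\<close>, which
  is zero: the boundary conditions sit in the chain and not in \<phi>.\<close>

lemma chain_weak_deriv_integral:
  assumes "chain \<beta> a b G" "k \<le> \<beta>" "\<And>j. Ck j \<phi>"
  shows "(LINT x|lborel. G 0 x * (deriv ^^ k) \<phi> x) = (-1) ^ k * (LINT x|lborel. G k x * \<phi> x)"
  using assms(2,3)
proof (induction k arbitrary: \<phi>)
  case (Suc k)
  let ?h = "G (Suc k)"
  have h: "supp_sq a b ?h"
    using Suc.prems assms(1) by (simp add: chain_def)
  have Gk: "supp_sq a b (G k)" "G k = prim ?h"
    using Suc.prems assms(1) unfolding chain_def by (meson Suc_leD, meson Suc_le_lessD)
  have D: "(\<phi> has_real_derivative deriv \<phi> x) (at x)" for x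
    using DERIV_funpow_Ck[OF Suc.prems(2), of 0 x] by simp
  have "integral\<^sup>L lborel ?h = prim ?h (b + 1)" using prim_eq_total[OF h, of "b + 1"] by simp
  also have "\<dots> = 0" using supp_sqD(3)[OF Gk(1), of "b + 1"] Gk(2) by simp
  finally have tot: "integral\<^sup>L lborel ?h = 0" .
  have "(LINT x|lborel. G 0 x * (deriv ^^ Suc k) \<phi> x) = (LINT x|lborel. G 0 x * (deriv ^^ k) (deriv \<phi>) x)"
    by (simp only: funpow_Suc_right comp_apply)
  also have "\<dots> = (-1) ^ k * (LINT x|lborel. G k x * deriv \<phi> x)"
    using deriv_funpow_Ck[OF Suc.prems(2), of _ 1] Suc.prems(1) by (intro Suc.IH) auto
  also have "(LINT x|lborel. G k x * deriv \<phi> x) = (LINT x:{a..b}|lborel. prim ?h x * deriv \<phi> x)"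
    unfolding set_lebesgue_integral_def Gk(2)[symmetric]
    using supp_sqD(3)[OF Gk(1)] by (intro Bochner_Integration.integral_cong) (auto simp: indicator_def)
  also have "\<dots> = - (LINT x|lborel. ?h x * \<phi> x)"
    using continuous_on_Ck[OF Suc.prems(2), of UNIV 1] tot
    by (subst prim_by_parts[OF h order_refl order_refl D]) auto
  finally show ?case by simp
qed simp

lemma chain_is_weak_deriv:
  assumes G: "chain \<beta> a b G" and k: "k \<le> \<beta>" and D: "{a..b} \<subseteq> D"
  shows "is_weak_deriv k D (G 0) (G k)"
proof -
  have s: "supp_sq a b (G k)" "supp_sq a b (G 0)" using G k by (auto simp: chain_def)
  have loc: "locally_integrable_on D h" if "supp_sq a b h" for h
    unfolding locally_integrable_on_def set_integrable_def
    by (intro allI impI integrable_mult_indicator supp_sq_integrable[OF that])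
       (auto intro: borel_compact)
  have res: "(LINT x:D|lborel. h x * g x) = (LINT x|lborel. h x * g x)" if "supp_sq a b h" for h g
    unfolding set_lebesgue_integral_def
    using supp_sqD(3)[OF that] subsetD[OF D]
    by (intro Bochner_Integration.integral_cong[OF refl]) (metis (no_types, opaque_lifting) indicator_simps mult_zero_left scaleR_one scaleR_zero_left)
  show ?thesis
    unfolding is_weak_deriv_def
    using loc[OF s(1)] loc[OF s(2)] res[OF s(1)] res[OF s(2)] chain_weak_deriv_integral[OF G k] test_functionD(1)
    by simp
qed

lemma supp_sq_square_integrable_on:
  assumes "supp_sq a b h" "D \<in> sets borel"
  shows "square_integrable_on D h"
  using supp_sqD(1,2)[OF assms(1)] assms(2)
    integrable_mult_indicator[OF _ supp_sqD(2)[OF assms(1)], of D]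
  unfolding square_integrable_on_def set_borel_measurable_def set_integrable_def by auto

lemma L2_norm_on_supp_sq:
  assumes "supp_sq a b h" "{a..b} \<subseteq> D"
  shows "(L2_norm_on D h)\<^sup>2 = (LINT x|lborel. (h x)\<^sup>2)"
proof -
  have "(LINT x:D|lborel. (h x)\<^sup>2) = (LINT x|lborel. (h x)\<^sup>2)"
    unfolding set_lebesgue_integral_def
    using supp_sqD(3)[OF assms(1)] subsetD[OF assms(2)]
    by (intro Bochner_Integration.integral_cong[OF refl]) (metis (no_types, opaque_lifting) indicator_simps power_zero_numeral scaleR_one scaleR_zero_left)
  then show ?thesis by (simp add: L2_norm_on_def)
qed

lemma chain_in_sobolev_space:
  assumes "chain \<beta> a b G" "{a..b} \<subseteq> D" "D \<in> sets borel"
  shows "G 0 \<in> sobolev_space \<beta> D"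
  using chain_is_weak_deriv[OF assms(1) _ assms(2)] supp_sq_square_integrable_on[OF _ assms(3)] assms(1)
  unfolding sobolev_space_def chain_def by blast

text \<open>The chosen \<open>weak_deriv\<close> agrees almost everywhere with the last member of
  the chain, which makes the norm computable.\<close>

lemma chain_sobolev_norm:
  assumes G: "chain \<beta> a b G" and ab: "{a..b} \<subseteq> {p..q}"
  shows "(sobolev_norm \<beta> {p..q} (G 0))\<^sup>2 = (LINT x|lborel. (G 0 x)\<^sup>2) + (LINT x|lborel. (G \<beta> x)\<^sup>2)"
proof -
  have s: "supp_sq a b (G \<beta>)" "supp_sq a b (G 0)" using G by (auto simp: chain_def)
  have sq: "square_integrable_on {p..q} (G \<beta>)" by (rule supp_sq_square_integrable_on[OF s(1)]) simp
  have wd: "is_weak_deriv \<beta> {p..q} (G 0) (G \<beta>)" by (rule chain_is_weak_deriv[OF G order_refl ab])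
  define w where "w = weak_deriv \<beta> {p..q} (G 0)"
  have w: "square_integrable_on {p..q} w \<and> is_weak_deriv \<beta> {p..q} (G 0) w"
    unfolding w_def weak_deriv_def 
    by (rule someI[of "\<lambda>g. square_integrable_on {p..q} g \<and> is_weak_deriv \<beta> {p..q} (G 0) g", OF conjI[OF sq wd]])
  then have AE: "AE x in lborel. x \<in> {p..q} \<longrightarrow> w x = G \<beta> x"
    by (intro weak_deriv_unique_interval[OF _ sq _ wd]) auto
  have "(LINT x:{p..q}|lborel. (w x)\<^sup>2) = (LINT x:{p..q}|lborel. (G \<beta> x)\<^sup>2)"
    unfolding set_lebesgue_integral_def
  proof (intro integral_cong_AE)
    show "(\<lambda>x. indicator {p..q} x *\<^sub>R (w x)\<^sup>2) \<in> borel_measurable lborel"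
      using w unfolding square_integrable_on_def set_integrable_def by auto
    show "(\<lambda>x. indicator {p..q} x *\<^sub>R (G \<beta> x)\<^sup>2) \<in> borel_measurable lborel"
      using sq unfolding square_integrable_on_def set_integrable_def by auto
    show "AE x in lborel. indicator {p..q} x *\<^sub>R (w x)\<^sup>2 = indicator {p..q} x *\<^sub>R (G \<beta> x)\<^sup>2"
      using AE by eventually_elim (auto simp: indicator_def)
  qed
  then have "(L2_norm_on {p..q} w)\<^sup>2 = (L2_norm_on {p..q} (G \<beta>))\<^sup>2"
    by (simp add: L2_norm_on_def)
  then show ?thesis
    using L2_norm_on_supp_sq[OF s(1) ab] L2_norm_on_supp_sq[OF s(2) ab]
    by (simp add: sobolev_norm_def w_def[symmetric])
qed

section \<open>Compactly supported Sobolev functions are chains\<close>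

text \<open>Near \<open>x\<close> the primitive from minus infinity is a primitive from a fixed
  point left of both \<open>x\<close> and the support, and the fundamental theorem of calculus on a
  compact interval applies.\<close>

lemma prim_has_derivative:
  assumes c: "continuous_on UNIV \<psi>" and z: "\<And>x. x \<notin> {a..b} \<Longrightarrow> \<psi> x = 0"
  shows "(prim \<psi> has_real_derivative \<psi> x) (at x)"
proof -
  define A B where "A = min a x - 1" and "B = max b x + 1"
  have int: "integrable lborel \<psi>"
  proof -
    have "integrable lborel (\<lambda>x. indicator {a..b} x *\<^sub>R \<psi> x)"
      by (intro borel_integrable_compact) (auto intro: continuous_on_subset[OF c])
    also have "(\<lambda>x. indicator {a..b} x *\<^sub>R \<psi> x) = \<psi>"
      using z by (auto simp: indicator_def fun_eq_iff)
    finally show ?thesis .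
  qed
  have eq: "prim \<psi> y = integral {A..y} \<psi>" if "y \<in> {A<..<B}" for y
  proof -
    have "\<psi> t = 0" if "\<not> A \<le> t" for t
      using that by (intro z) (auto simp: A_def)
    then have "prim \<psi> y = (LINT t:{A..y}|lborel. \<psi> t)"
      unfolding prim_def set_lebesgue_integral_def
      by (intro Bochner_Integration.integral_cong) (auto simp: indicator_def)
    also have "\<dots> = integral {A..y} \<psi>"
      by (intro set_borel_integral_eq_integral borel_integrable_atLeastAtMost')
         (auto intro: continuous_on_subset[OF c])
    finally show ?thesis .
  qed
  have "((\<lambda>y. integral {A..y} \<psi>) has_real_derivative \<psi> x) (at x within {A..B})"
    by (intro integral_has_real_derivative continuous_on_subset[OF c]) (auto simp: A_def B_def)
  moreover have "at x within {A..B} = at x"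
    by (intro at_within_interior) (auto simp: A_def B_def)
  ultimately have *: "((\<lambda>y. integral {A..y} \<psi>) has_real_derivative \<psi> x) (at x)" by simp
  have "\<forall>\<^sub>F y in nhds x. y \<in> {A<..<B}"
    by (intro eventually_nhds_in_open) (auto simp: A_def B_def)
  then have "\<forall>\<^sub>F y in nhds x. integral {A..y} \<psi> = prim \<psi> y"
    by eventually_elim (simp add: eq)
  with * show ?thesis by (simp only: DERIV_cong_ev[OF refl _ refl])
qed

text \<open>
  The test functions are the primitives of \<open>\<psi>(x + L) - \<psi>(x)\<close>: they have compact support without any
  condition on \<open>\<psi>\<close>, and for large \<open>L\<close> the shifted copy lies where \<open>g\<close> and \<open>prim h\<close> both vanish.
\<close>

lemma weak_deriv_prim_step:
  assumes h: "supp_sq a b h" and g: "\<And>p q. set_integrable lborel {p..q} g"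
    and g0: "AE x in lborel. x \<notin> {a..b} \<longrightarrow> g x = 0"
    and weak: "\<And>\<phi>. test_function UNIV \<phi> \<Longrightarrow> (LINT x|lborel. g x * deriv \<phi> x) = - (LINT x|lborel. h x * \<phi> x)"
  shows "AE x in lborel. g x = prim h x" and "supp_sq a b (prim h)"
proof -
  define u where "u x = g x - prim h x" for x
  have [measurable]: "prim h \<in> borel_measurable borel"
    using continuous_prim[OF h, of UNIV] by (rule borel_measurable_continuous_onI)
  have pint: "set_integrable lborel {p..q} (prim h)" for p q
    by (intro borel_integrable_atLeastAtMost' continuous_prim[OF h])
  have u: "set_integrable lborel {p..q} u" for p q
    unfolding u_def using g pint by (rule set_integral_diff)
  have mult: "integrable lborel (\<lambda>x. w x * f x)"
    if "set_integrable lborel {p..q} w" "continuous_on UNIV f" "\<And>x. x \<notin> {p..q} \<Longrightarrow> f x = 0"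
    for w f :: "real \<Rightarrow> real" and p q
    using that continuous_on_subset[OF that(2)]
    by (intro integrable_if_zero_outside[of p q] set_integrable_mult_continuous) auto
  have uderiv: "(LINT x|lborel. u x * deriv \<phi> x) = 0" if \<phi>: "test_function UNIV \<phi>" for \<phi>
  proof -
    obtain p0 q0 where pq0: "\<And>x. x \<notin> {p0..q0} \<Longrightarrow> \<phi> x = 0"
      using test_functionD(3)[OF \<phi>] by auto
    \<comment> \<open>The interval covers the supports of both functions, as integration by parts
      requires; the extra 1 puts \<open>q\<close> strictly beyond the support of \<phi> and kills
      the boundary term.\<close>
    define p q where "p = min p0 a" and "q = max q0 b + 1"
    have pq: "x \<notin> {p..q} \<Longrightarrow> \<phi> x = 0" for x by (rule pq0) (auto simp: p_def q_def)
    have Ck: "Ck k \<phi>" for k by (rule test_functionD[OF \<phi>])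
    have D: "(\<phi> has_real_derivative deriv \<phi> x) (at x)" for x
      using DERIV_funpow_Ck[OF Ck, of 0 x] by simp
    have c: "continuous_on UNIV (deriv \<phi>)" using continuous_on_Ck[OF Ck, of UNIV 1] by simp
    have d0: "x \<notin> {p..q} \<Longrightarrow> deriv \<phi> x = 0" for x
      using deriv_funpow_test_0[of p q \<phi> x 1] pq by simp
    have "(LINT x|lborel. prim h x * deriv \<phi> x) = (LINT x:{p..q}|lborel. prim h x * deriv \<phi> x)"
      unfolding set_lebesgue_integral_def
      using d0 by (intro Bochner_Integration.integral_cong) (auto simp: indicator_def)
    also have "\<dots> = \<phi> q * integral\<^sup>L lborel h - (LINT x|lborel. h x * \<phi> x)"
      by (rule prim_by_parts[OF h _ _ D c]) (auto simp: p_def q_def)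
    also have "\<phi> q = 0" 
    proof (rule pq0)
      have "q > q0" by (simp add: q_def)
      then show "q \<notin> {p0..q0}" by simp
    qed
    finally have pd: "(LINT x|lborel. prim h x * deriv \<phi> x) = - (LINT x|lborel. h x * \<phi> x)" by simp
    have i: "integrable lborel (\<lambda>x. g x * deriv \<phi> x)" "integrable lborel (\<lambda>x. prim h x * deriv \<phi> x)"
      by (rule mult[OF g c d0], assumption, rule mult[OF pint c d0], assumption)
    have "(LINT x|lborel. u x * deriv \<phi> x) = (LINT x|lborel. g x * deriv \<phi> x - prim h x * deriv \<phi> x)"
      by (simp only: u_def left_diff_distrib)
    also have "\<dots> = 0"
      unfolding Bochner_Integration.integral_diff[OF i] pd weak[OF \<phi>] by (rule diff_self)
    finally show ?thesis .
  qed
  have "AE x in lborel. u x = 0"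
  proof (rule fundamental_lemma_UNIV[OF u])
    fix \<psi> assume \<psi>: "test_function UNIV \<psi>"
    obtain p q where "p < q" and pq: "\<And>x. x \<notin> {p..q} \<Longrightarrow> \<psi> x = 0"
      using test_functionD(3)[OF \<psi>] by blast
    have Ck: "Ck k \<psi>" for k by (rule test_functionD[OF \<psi>])
    have c: "continuous_on UNIV \<psi>" using continuous_on_Ck[OF Ck, of UNIV 0] by simp
    \<comment> \<open>The shifted copy of \<psi> is supported in {p - L..q - L}, and this choice
      places all of it to the left of \<open>a\<close>.\<close>
    define L where "L = \<bar>q - a\<bar> + 1"
    have L: "L > 0" "q - L < a" by (auto simp: L_def)
    define \<phi> where "\<phi> x = prim \<psi> (1 * x + L) - prim \<psi> x" for x
    have D: "(\<phi> has_real_derivative \<psi> (1 * x + L) - \<psi> x) (at x)" for x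
    proof -
      have "((\<lambda>x. 1 * x + L) has_real_derivative 1) (at x)" by (auto intro!: derivative_eq_intros)
      from DERIV_diff[OF DERIV_chain2[OF prim_has_derivative[OF c pq] this] prim_has_derivative[OF c pq]]
      show ?thesis by (simp add: \<phi>_def[abs_def])
    qed
    then have deriv: "deriv \<phi> x = \<psi> (1 * x + L) - \<psi> x" for x by (rule DERIV_imp_deriv)
    have "Ck k (\<lambda>x. \<psi> (1 * x + L) + (-1) * \<psi> x)" for k
      by (rule Ck_add[OF Ck_affine[OF Ck, of _ 1 L] Ck_mult[OF Ck_const Ck]])
    then have "Ck (Suc k) \<phi>" for k using D by (intro Ck_SucI[where f' = "\<lambda>x. \<psi> (1 * x + L) - \<psi> x"]) simp_all
    then have Ck\<phi>: "Ck k \<phi>" for k by (rule Ck_Suc_imp)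
    have sq\<psi>: "supp_sq p q \<psi>" by (rule supp_sq_continuousI[OF c pq])
    have "\<phi> x = 0" if "x \<notin> {p - L..q}" for x
      using that L prim_eq_0[OF sq\<psi>] prim_eq_total[OF sq\<psi>] by (cases "x < p - L") (auto simp: \<phi>_def)
    then have "test_function UNIV \<phi>"
      by (intro test_functionI[of \<phi> "p - L" q] Ck\<phi>) auto
    from uderiv[OF this] have "(LINT x|lborel. u x * \<psi> (x + L) - u x * \<psi> x) = 0"
      by (simp add: deriv right_diff_distrib)
    moreover have "integrable lborel (\<lambda>x. u x * \<psi> x)" by (rule mult[OF u c pq])
    moreover have "integrable lborel (\<lambda>x. u x * \<psi> (x + L))"
    proof (rule mult[OF u, of _ "p - L" "q - L"])
      show "continuous_on UNIV (\<lambda>x. \<psi> (x + L))"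
        by (rule continuous_on_compose2[OF c]) (auto intro!: continuous_intros)
      show "\<psi> (x + L) = 0" if "x \<notin> {p - L..q - L}" for x
        using that by (intro pq) auto
    qed
    moreover have "(LINT x|lborel. u x * \<psi> (x + L)) = 0"
    proof (rule integral_eq_zero_AE)
      show "AE x in lborel. u x * \<psi> (x + L) = 0"
        using g0
      proof eventually_elim
        case (elim x)
        then show ?case
          using prim_eq_0[OF h, of x] pq[of "x + L"] L by (cases "x < a") (auto simp: u_def)
      qed
    qed
    ultimately show "(LINT x|lborel. u x * \<psi> x) = 0" by simp
  qed
  then show eq: "AE x in lborel. g x = prim h x"
    by eventually_elim (simp add: u_def)
  \<comment> \<open>Beyond \<open>b\<close> the primitive is constant. It equals \<open>g\<close>
    almost everywhere, which is zero there, so on an interval of positive length the constant must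
    be 0. This is the origin of the boundary condition on the right.\<close>
  have zero: "prim h x = 0" if "x \<notin> {a..b}" for x
  proof (rule ccontr)
    assume nz: "prim h x \<noteq> 0"
    with prim_eq_0[OF h, of x] that have "x > b" by force
    then have "prim h y \<noteq> 0" if "y \<ge> b" for y
      using prim_eq_total[OF h that] prim_eq_total[OF h, of x] nz by simp
    moreover have "AE y in lborel. y \<notin> {a..b} \<longrightarrow> prim h y = 0"
      using eq g0 by eventually_elim simp
    ultimately have "AE y in lborel. y \<notin> {b<..<b + 1}"
      by (auto elim!: eventually_mono)
    then have "emeasure lborel {b<..<b + 1} = 0"
      by (subst (asm) AE_iff_measurable[of "{b<..<b + 1}"]) auto
    then show False by simp
  qed
  show "supp_sq a b (prim h)" by (rule supp_sq_continuousI[OF continuous_prim[OF h] zero])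
qed

text \<open>A test function supported beside {a..b} sees only the region where \<open>K\<close> is
  zero, so it annihilates \<open>g\<close>, and the fundamental lemma applies on either
  side.\<close>

lemma weak_deriv_UNIV_support:
  assumes K: "AE x in lborel. x \<notin> {a..b} \<longrightarrow> K x = 0"
    and g: "square_integrable_on UNIV g" and wd: "is_weak_deriv k UNIV K g"
  shows "AE x in lborel. x \<notin> {a..b} \<longrightarrow> g x = 0"
proof -
  have gi: "set_integrable lborel {p..q} g" for p q
    using g by (intro set_integrable_of_square) (auto simp: emeasure_lborel_Icc_eq)
  \<comment> \<open>Only the open interval has to avoid {a..b}; the closed intervals used below may
    therefore touch it at an endpoint.\<close>
  have *: "AE x in lborel. x \<in> {p..q} \<longrightarrow> g x = 0" if "{p<..<q} \<inter> {a..b} = {}" for p q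
  proof (rule fundamental_lemma_interval[OF gi])
    fix \<phi> assume \<phi>: "test_function {p..q} \<phi>"
    have "AE x in lborel. K x * (deriv ^^ k) \<phi> x = 0"
      using K AE_lborel_singleton[of p] AE_lborel_singleton[of q]
    proof eventually_elim
      case (elim x)
      then show ?case
        using deriv_funpow_test_0[of p q \<phi> x k] test_functionD(2)[OF \<phi>] that
        by (cases "x \<in> {p<..<q}") auto
    qed
    then have "(LINT x:UNIV|lborel. K x * (deriv ^^ k) \<phi> x) = 0"
      unfolding set_lebesgue_integral_def by (intro integral_eq_zero_AE) auto
    moreover have "test_function UNIV \<phi>" by (rule test_function_mono[OF \<phi>]) simp
    ultimately have "(LINT x:UNIV|lborel. g x * \<phi> x) = 0"
      using wd[unfolded is_weak_deriv_def, THEN conjunct2, THEN conjunct2, rule_format, of \<phi>] by simp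
    moreover have "(LINT x:{p..q}|lborel. g x * \<phi> x) = (LINT x:UNIV|lborel. g x * \<phi> x)"
      unfolding set_lebesgue_integral_def
      using test_functionD(2)[OF \<phi>] by (intro Bochner_Integration.integral_cong) (auto simp: indicator_def)
    ultimately show "(LINT x:{p..q}|lborel. g x * \<phi> x) = 0" by simp
  qed
  have "AE x in lborel. \<forall>n::nat. (x \<in> {b..b + real n} \<longrightarrow> g x = 0) \<and> (x \<in> {a - real n..a} \<longrightarrow> g x = 0)"
    unfolding AE_all_countable AE_conj_iff by (intro allI conjI *) auto
  then show ?thesis
  proof eventually_elim
    case (elim x)
    obtain n where n: "\<bar>x\<bar> + \<bar>a\<bar> + \<bar>b\<bar> < real n" using reals_Archimedean2 by blast
    show ?case using elim[rule_format, of n] n by (auto simp: abs_if split: if_splits)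
  qed
qed

text \<open>Starting from the top weak derivative and integrating downwards,
  \<open>weak_deriv_prim_step\<close> shows at each order that the weak derivative is the primitive
  of the one above. This fixes exact representatives of all orders.\<close>

lemma sobolev_space_UNIV_chain:
  assumes K: "K \<in> sobolev_space \<beta> UNIV" and supp: "AE x in lborel. x \<notin> {a..b} \<longrightarrow> K x = 0"
  obtains G where "chain \<beta> a b G" "AE x in lborel. G 0 x = K x" "AE x in lborel. G \<beta> x = weak_deriv \<beta> UNIV K x"
proof -
  have ex: "\<exists>g. square_integrable_on UNIV g \<and> is_weak_deriv k UNIV K g" if "k \<le> \<beta>" for k
    using K that by (auto simp: sobolev_space_def)
  define g where "g k = weak_deriv k UNIV K" for k
  have gspec: "square_integrable_on UNIV (g k) \<and> is_weak_deriv k UNIV K (g k)" if "k \<le> \<beta>" for k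
    unfolding g_def weak_deriv_def using ex[OF that] by (rule someI_ex)
  have gi: "set_integrable lborel {p..q} (g k)" if "k \<le> \<beta>" for p q k
    using gspec[OF that] by (intro set_integrable_of_square) (auto simp: emeasure_lborel_Icc_eq)
  have g0: "AE x in lborel. x \<notin> {a..b} \<longrightarrow> g k x = 0" if "k \<le> \<beta>" for k
    using gspec[OF that] by (intro weak_deriv_UNIV_support[OF supp]) auto
  have wk: "(LINT x|lborel. K x * (deriv ^^ k) \<phi> x) = (-1) ^ k * (LINT x|lborel. g k x * \<phi> x)"
    if "k \<le> \<beta>" "test_function UNIV \<phi>" for k \<phi>
    using gspec[OF that(1)] that(2) by (simp add: is_weak_deriv_def set_lebesgue_integral_def)
  \<comment> \<open>The top derivative vanishes off {a..b} only almost everywhere; the cut makes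
    this exact.\<close>
  define h where "h x = indicator {a..b} x * g \<beta> x" for x
  define G where "G k = (prim ^^ (\<beta> - k)) h" for k
  have hsq: "supp_sq a b h"
  proof -
    have [measurable]: "g \<beta> \<in> borel_measurable borel" and i: "integrable lborel (\<lambda>x. (g \<beta> x)\<^sup>2)"
      using gspec[of \<beta>] by (auto simp: square_integrable_on_def set_borel_measurable_def set_integrable_def)
    have "integrable lborel (\<lambda>x. indicator {a..b} x *\<^sub>R (g \<beta> x)\<^sup>2)"
      using i by (intro integrable_mult_indicator) auto
    also have "(\<lambda>x. indicator {a..b} x *\<^sub>R (g \<beta> x)\<^sup>2) = (\<lambda>x. (h x)\<^sup>2)"
      by (auto simp: h_def indicator_def fun_eq_iff)
    finally have "integrable lborel (\<lambda>x. (h x)\<^sup>2)" .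
    moreover have "h \<in> borel_measurable borel" unfolding h_def[abs_def] by measurable
    ultimately show ?thesis by (simp add: supp_sq_def h_def)
  qed
  have main: "supp_sq a b (G (\<beta> - j)) \<and> (AE x in lborel. g (\<beta> - j) x = G (\<beta> - j) x)" if "j \<le> \<beta>" for j
    using that
  proof (induction j)
    case 0
    have "AE x in lborel. g \<beta> x = h x"
      using g0[OF order_refl] by eventually_elim (auto simp: h_def indicator_def)
    then show ?case using hsq by (simp add: G_def)
  next
    case (Suc j)
    define k where "k = \<beta> - Suc j"
    have k: "\<beta> - j = Suc k" "k < \<beta>" "Suc k \<le> \<beta>" using Suc.prems by (auto simp: k_def)
    have Gk: "G k = prim (G (Suc k))"
      using k by (simp add: G_def Suc_diff_Suc[symmetric])
    have IH: "supp_sq a b (G (Suc k))" "AE x in lborel. g (Suc k) x = G (Suc k) x"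
      using Suc k by auto
    have weak: "(LINT x|lborel. g k x * deriv \<phi> x) = - (LINT x|lborel. G (Suc k) x * \<phi> x)"
      if \<phi>: "test_function UNIV \<phi>" for \<phi>
    proof -
      have Ck: "Ck j \<phi>" for j by (rule test_functionD[OF \<phi>])
      obtain p q where pq: "\<And>x. x \<notin> {p..q} \<Longrightarrow> \<phi> x = 0" using test_functionD(3)[OF \<phi>] by blast
      have t: "test_function UNIV (deriv \<phi>)"
        using deriv_funpow_Ck[OF Ck, of _ 1] deriv_funpow_test_0[of p q \<phi> _ 1] pq
        by (intro test_functionI[of _ p q]) auto
      have "(-1) ^ k * (LINT x|lborel. g k x * deriv \<phi> x) = (LINT x|lborel. K x * (deriv ^^ k) (deriv \<phi>) x)"
        using wk[OF _ t, of k] k by simp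
      also have "\<dots> = (LINT x|lborel. K x * (deriv ^^ Suc k) \<phi> x)"
        by (simp only: funpow_Suc_right comp_apply)
      also have "\<dots> = (-1) ^ Suc k * (LINT x|lborel. g (Suc k) x * \<phi> x)"
        using wk[OF _ \<phi>] k by blast
      also have "(LINT x|lborel. g (Suc k) x * \<phi> x) = (LINT x|lborel. G (Suc k) x * \<phi> x)"
      proof (rule integral_cong_AE)
        have [measurable]: "g (Suc k) \<in> borel_measurable borel"
          using gspec[OF k(3)] by (auto simp: square_integrable_on_def set_borel_measurable_def)
        have [measurable]: "G (Suc k) \<in> borel_measurable borel" using IH(1) by (rule supp_sqD)
        have [measurable]: "\<phi> \<in> borel_measurable borel"
          using continuous_on_Ck[OF Ck, of UNIV 0] by (auto intro: borel_measurable_continuous_onI)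
        show "(\<lambda>x. g (Suc k) x * \<phi> x) \<in> borel_measurable lborel" by measurable
        show "(\<lambda>x. G (Suc k) x * \<phi> x) \<in> borel_measurable lborel" by measurable
        show "AE x in lborel. g (Suc k) x * \<phi> x = G (Suc k) x * \<phi> x"
          using IH(2) by eventually_elim simp
      qed
      finally have "(-1) ^ k * (LINT x|lborel. g k x * deriv \<phi> x) = (-1) ^ k * - (LINT x|lborel. G (Suc k) x * \<phi> x)"
        by simp
      then show ?thesis by (subst (asm) mult_left_cancel) auto
    qed
    have kk: "k \<le> \<beta>" using k by simp
    show ?case
      using weak_deriv_prim_step[OF IH(1) gi[OF kk] g0[OF kk] weak] unfolding k_def[symmetric] Gk by blast
  qed
  have "chain \<beta> a b G"
    unfolding chain_def
  proof (intro conjI allI impI)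
    fix k assume "k \<le> \<beta>"
    then show "supp_sq a b (G k)" using main[of "\<beta> - k"] by simp
  next
    fix k assume "k < \<beta>"
    then show "G k = prim (G (Suc k))" by (simp add: G_def Suc_diff_Suc[symmetric])
  qed
  moreover have "AE x in lborel. G \<beta> x = weak_deriv \<beta> UNIV K x"
    using main[of 0] by (simp add: g_def eq_commute)
  \<comment> \<open>Order zero needs an argument too: the weak derivative of order 0 is also only a
    choice, and testing shows that it agrees with \<open>K\<close>.\<close>
  moreover have "AE x in lborel. G 0 x = K x"
  proof -
    have Ki: "set_integrable lborel {p..q} K" for p q
      using K by (intro set_integrable_of_square[of UNIV]) (auto simp: sobolev_space_def emeasure_lborel_Icc_eq)
    have "AE x in lborel. K x - g 0 x = 0"
    proof (rule fundamental_lemma_UNIV)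
      show "set_integrable lborel {p..q} (\<lambda>x. K x - g 0 x)" for p q using Ki gi[of 0] by auto
      fix \<phi> assume \<phi>: "test_function UNIV \<phi>"
      have c: "continuous_on UNIV \<phi>" using continuous_on_Ck[OF test_functionD(1)[OF \<phi>], of UNIV 0] by simp
      obtain p q where pq: "\<And>x. x \<notin> {p..q} \<Longrightarrow> \<phi> x = 0" using test_functionD(3)[OF \<phi>] by blast
      have *: "integrable lborel (\<lambda>x. f x * \<phi> x)" if "square_integrable_on UNIV f" for f
        using that c pq
        by (intro integrable_if_zero_outside[of p q] set_integrable_mult_continuous set_integrable_of_square)
          (auto simp: emeasure_lborel_Icc_eq intro: continuous_on_subset)
      have "(LINT x|lborel. K x * \<phi> x) = (LINT x|lborel. g 0 x * \<phi> x)"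
        using wk[OF _ \<phi>, of 0] by simp
      then show "(LINT x|lborel. (K x - g 0 x) * \<phi> x) = 0"
        using *[of K] *[of "g 0"] gspec[of 0] K by (simp add: left_diff_distrib sobolev_space_def)
    qed
    with main[of \<beta>] have "AE x in lborel. K x - g 0 x = 0" "AE x in lborel. g 0 x = G 0 x" by auto
    then show ?thesis by eventually_elim simp
  qed
  ultimately show thesis by - (rule that, assumption+)
qed

section \<open>Existence of an extremal kernel\<close>

lemma supp_sq_lincomb:
  assumes "supp_sq a b f" "supp_sq a b g"
  shows "supp_sq a b (\<lambda>x. s * f x + t * g x)"
proof -
  have [measurable]: "f \<in> borel_measurable borel" "g \<in> borel_measurable borel"
    using assms by (auto intro: supp_sqD)
  have "integrable lborel (\<lambda>x. 2 * s\<^sup>2 * (f x)\<^sup>2 + 2 * t\<^sup>2 * (g x)\<^sup>2)"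
    using supp_sqD(2)[OF assms(1)] supp_sqD(2)[OF assms(2)] by auto
  then have "integrable lborel (\<lambda>x. (s * f x + t * g x)\<^sup>2)"
  proof (rule Bochner_Integration.integrable_bound)
    show "AE x in lborel. norm ((s * f x + t * g x)\<^sup>2) \<le> norm (2 * s\<^sup>2 * (f x)\<^sup>2 + 2 * t\<^sup>2 * (g x)\<^sup>2)"
    proof (rule AE_I2)
      fix x
      have "(s * f x + t * g x)\<^sup>2 + (s * f x - t * g x)\<^sup>2 = 2 * s\<^sup>2 * (f x)\<^sup>2 + 2 * t\<^sup>2 * (g x)\<^sup>2"
        by (simp add: power2_eq_square algebra_simps)
      then have "(s * f x + t * g x)\<^sup>2 \<le> 2 * s\<^sup>2 * (f x)\<^sup>2 + 2 * t\<^sup>2 * (g x)\<^sup>2"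
        by (smt (verit) zero_le_power2)
      then show "norm ((s * f x + t * g x)\<^sup>2) \<le> norm (2 * s\<^sup>2 * (f x)\<^sup>2 + 2 * t\<^sup>2 * (g x)\<^sup>2)"
        by simp
    qed
  qed auto
  then show ?thesis
    using assms by (auto simp: supp_sq_def)
qed

lemma prim_lincomb:
  assumes "integrable lborel f" "integrable lborel g"
  shows "prim (\<lambda>x. s * f x + t * g x) x = s * prim f x + t * prim g x"
proof -
  have "set_integrable lborel {..x} f" "set_integrable lborel {..x} g"
    unfolding set_integrable_def by (rule integrable_mult_indicator[OF _ assms(1)], simp, rule integrable_mult_indicator[OF _ assms(2)], simp)
  then show ?thesis by (simp add: prim_def)
qed

lemma chain_lincomb:
  assumes G: "chain \<beta> a b G" and H: "chain \<beta> a b H"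
  shows "chain \<beta> a b (\<lambda>k x. s * G k x + t * H k x)"
  unfolding chain_def
proof (intro conjI allI impI)
  show "supp_sq a b (\<lambda>x. s * G k x + t * H k x)" if "k \<le> \<beta>" for k
    using assms that by (intro supp_sq_lincomb) (auto simp: chain_def)
  show "(\<lambda>x. s * G k x + t * H k x) = prim (\<lambda>x. s * G (Suc k) x + t * H (Suc k) x)" if "k < \<beta>" for k
  proof
    fix x
    have "supp_sq a b (G (Suc k))" "supp_sq a b (H (Suc k))" "G k = prim (G (Suc k))" "H k = prim (H (Suc k))"
      using assms that by (auto simp: chain_def)
    then show "s * G k x + t * H k x = prim (\<lambda>x. s * G (Suc k) x + t * H (Suc k) x) x"
      by (simp add: prim_lincomb supp_sq_integrable)
  qed
qed

section \<open>Poincare inequalities for compactly supported primitives\<close>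

lemma supp_sq_integral_bound:
  assumes h: "supp_sq a b h" and ab: "a \<le> b" and B: "\<And>x. x \<in> {a..b} \<Longrightarrow> (h x)\<^sup>2 \<le> B"
  shows "(LINT x|lborel. (h x)\<^sup>2) \<le> (b - a) * B"
proof -
  have "(LINT x|lborel. (h x)\<^sup>2) \<le> (LINT x|lborel. B * indicator {a..b} x)"
  proof (rule integral_mono[OF supp_sqD(2)[OF h]])
    show "integrable lborel (\<lambda>x. B * indicat_real {a..b} x)"
      by (intro integrable_mult_right) (auto simp: emeasure_lborel_Icc_eq)
    show "(h x)\<^sup>2 \<le> B * indicator {a..b} x" for x
      using B[of x] supp_sqD(3)[OF h, of x] by (cases "x \<in> {a..b}") simp_all
  qed
  also have "\<dots> = (b - a) * B" using ab by simp
  finally show ?thesis .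
qed

text \<open>The Hoelder bound is taken from the base point a - 1, where the primitive is zero; its
  distance to points of {a..b} is at most b - a + 1, whence the constant.\<close>

lemma prim_square_bound:
  assumes h: "supp_sq a b h" and x: "x \<in> {a..b}"
  shows "(prim h x)\<^sup>2 \<le> (b - a + 1) * (LINT t|lborel. (h t)\<^sup>2)"
proof -
  have "\<bar>prim h x - prim h (a - 1)\<bar> \<le> sqrt \<bar>x - (a - 1)\<bar> * sqrt (LINT t|lborel. (h t)\<^sup>2)"
    by (rule prim_holder[OF h])
  then have "\<bar>prim h x\<bar> \<le> sqrt (\<bar>x - (a - 1)\<bar> * (LINT t|lborel. (h t)\<^sup>2))"
    using prim_eq_0[OF h, of "a - 1"] by (simp add: real_sqrt_mult)
  then have "\<bar>prim h x\<bar>\<^sup>2 \<le> (sqrt (\<bar>x - (a - 1)\<bar> * (LINT t|lborel. (h t)\<^sup>2)))\<^sup>2"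
    by (intro power_mono) auto
  then have "(prim h x)\<^sup>2 \<le> \<bar>x - (a - 1)\<bar> * (LINT t|lborel. (h t)\<^sup>2)" by simp
  also have "\<dots> \<le> (b - a + 1) * (LINT t|lborel. (h t)\<^sup>2)"
    using x by (intro mult_right_mono) auto
  finally show ?thesis .
qed

lemma prim_L2_bound:
  assumes h: "supp_sq a b h" and p: "supp_sq a b (prim h)" and ab: "a \<le> b"
  shows "(LINT t|lborel. (prim h t)\<^sup>2) \<le> (b - a + 1)\<^sup>2 * (LINT t|lborel. (h t)\<^sup>2)"
proof -
  have "(LINT t|lborel. (prim h t)\<^sup>2) \<le> (b - a) * ((b - a + 1) * (LINT t|lborel. (h t)\<^sup>2))"
    by (rule supp_sq_integral_bound[OF p ab prim_square_bound[OF h]])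
  also have "\<dots> \<le> (b - a + 1) * ((b - a + 1) * (LINT t|lborel. (h t)\<^sup>2))"
    using ab by (intro mult_right_mono mult_nonneg_nonneg) auto
  finally show ?thesis by (simp add: power2_eq_square mult.assoc)
qed

text \<open>A Poincare inequality applied \<open>j\<close> times. A bound on the top derivative
  thereby controls the first one, and with it the modulus of continuity of a minimising
  sequence.\<close>

lemma chain_L2_bound:
  assumes G: "chain \<beta> a b G" and ab: "a \<le> b" and "j \<le> \<beta>"
  shows "(LINT t|lborel. (G (\<beta> - j) t)\<^sup>2) \<le> ((b - a + 1)\<^sup>2) ^ j * (LINT t|lborel. (G \<beta> t)\<^sup>2)"
  using assms(3)
proof (induction j)
  case (Suc j)
  define k where "k = \<beta> - Suc j"
  have k: "\<beta> - j = Suc k" "k < \<beta>" using Suc.prems by (auto simp: k_def)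
  have Gk: "supp_sq a b (G (Suc k))" "supp_sq a b (prim (G (Suc k)))" "G k = prim (G (Suc k))"
    using G k unfolding chain_def by (meson Suc_leI, metis less_imp_le, blast)
  have "(LINT t|lborel. (G k t)\<^sup>2) \<le> (b - a + 1)\<^sup>2 * (LINT t|lborel. (G (Suc k) t)\<^sup>2)"
    unfolding Gk(3) by (rule prim_L2_bound[OF Gk(1,2) ab])
  also have "\<dots> \<le> (b - a + 1)\<^sup>2 * (((b - a + 1)\<^sup>2) ^ j * (LINT t|lborel. (G \<beta> t)\<^sup>2))"
    using Suc k by (intro mult_left_mono) auto
  finally show ?case by (simp add: k_def mult.assoc)
qed simp

text \<open>The Riesz-Fischer argument: a rapidly Cauchy subsequence converges almost everywhere
  because its increments are summable in L1, and Fatou's lemma gives convergence in L2. The common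
  bounded support is what bounds L1 norms by L2 norms.\<close>

lemma L2_complete_supp_sq:
  assumes u: "\<And>j. supp_sq a b (u j)" and ab: "a \<le> b"
    and Cauchy: "\<And>e. e > 0 \<Longrightarrow> \<exists>N. \<forall>i\<ge>N. \<forall>j\<ge>N. (LINT x|lborel. (u i x - u j x)\<^sup>2) < e"
  obtains v where "supp_sq a b v" "(\<lambda>j. LINT x|lborel. (u j x - v x)\<^sup>2) \<longlonglongrightarrow> 0"
proof -
  have d: "supp_sq a b (\<lambda>x. u i x - u j x)" for i j
    using supp_sq_lincomb[OF u u, of 1 i "-1" j] by simp
  have [measurable]: "u i \<in> borel_measurable borel" for i by (rule supp_sqD[OF u])
  have "\<exists>N. \<forall>i\<ge>N. \<forall>j\<ge>N. (LINT x|lborel. (u i x - u j x)\<^sup>2) < (1/4) ^ n" for n :: nat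
    by (intro Cauchy) simp
  then obtain N where N: "\<And>n i j. i \<ge> N n \<Longrightarrow> j \<ge> N n \<Longrightarrow> (LINT x|lborel. (u i x - u j x)\<^sup>2) < (1/4) ^ n"
    by metis
  \<comment> \<open>Adding up the thresholds places both \<open>r n\<close> and
    \<open>r (Suc n)\<close> beyond \<open>N n\<close>, so the n-th increment has squared norm below
    (1/4)^n; the summand \<open>n\<close> makes \<open>r\<close> unbounded.\<close>
  define r where "r n = n + (\<Sum>k\<le>n. N k)" for n
  have rN: "r n \<ge> N n" and rn: "r n \<ge> n" for n
    unfolding r_def by (auto simp: lessThan_Suc_atMost[symmetric])
  have rS: "r (Suc n) \<ge> N n" for n using member_le_sum[of n "{..Suc n}" N] by (simp add: r_def)
  let ?d = "\<lambda>n x. \<bar>u (r (Suc n)) x - u (r n) x\<bar>"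
  have L1: "(\<integral>\<^sup>+x. ennreal (?d n x) \<partial>lborel) \<le> ennreal (sqrt (b - a) * (1/2) ^ n)" for n
  proof -
    let ?w = "\<lambda>x. u (r (Suc n)) x - u (r n) x"
    have i: "integrable lborel (\<lambda>x. \<bar>?w x\<bar>)" using supp_sq_integrable[OF d] by auto
    have sq: "(\<lambda>t. (indicat_real {a..b} t)\<^sup>2) = indicator {a..b}" by (auto simp: indicator_def)
    have ieq: "(\<lambda>x. indicat_real {a..b} x * \<bar>?w x\<bar>) = (\<lambda>x. \<bar>?w x\<bar>)"
      using supp_sqD(3)[OF d] by (auto simp: indicator_def fun_eq_iff)
    have "(LINT x|lborel. indicat_real {a..b} x * \<bar>?w x\<bar>)\<^sup>2 \<le>
        (LINT x|lborel. (indicat_real {a..b} x)\<^sup>2) * (LINT x|lborel. \<bar>?w x\<bar>\<^sup>2)"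
      using i supp_sqD(2)[OF d] ieq
      by (intro integral_Cauchy_Schwarz) (auto simp: sq emeasure_lborel_Icc_eq)
    also have "\<dots> \<le> (b - a) * (1/4) ^ n"
      using N[OF rS rN, of n] ab by (intro mult_mono) (auto simp: sq intro!: less_imp_le)
    finally have "(LINT x|lborel. \<bar>?w x\<bar>)\<^sup>2 \<le> (sqrt (b - a) * (1/2) ^ n)\<^sup>2"
      using ab by (simp only: ieq power_mult_distrib real_sqrt_pow2 flip: power_mult)
        (simp add: power_mult mult.commute[of _ 2] power_divide)
    then have "(LINT x|lborel. \<bar>?w x\<bar>) \<le> sqrt (b - a) * (1/2) ^ n"
      by (rule power2_le_imp_le) (use ab in auto)
    then show ?thesis
      using nn_integral_eq_integral[OF i] by (auto intro!: ennreal_leI)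
  qed
  have "(\<integral>\<^sup>+x. (\<Sum>n. ennreal (?d n x)) \<partial>lborel) = (\<Sum>n. \<integral>\<^sup>+x. ennreal (?d n x) \<partial>lborel)"
    by (rule nn_integral_suminf) measurable
  also have "\<dots> \<le> (\<Sum>n. ennreal (sqrt (b - a) * (1/2) ^ n))"
    by (intro suminf_le L1) auto
  also have "\<dots> = ennreal (\<Sum>n. sqrt (b - a) * (1/2) ^ n)"
    using ab by (intro suminf_ennreal2) (auto intro!: summable_mult)
  also have "\<dots> < \<infinity>" by simp
  finally have "AE x in lborel. (\<Sum>n. ennreal (?d n x)) \<noteq> \<infinity>"
    by (intro nn_integral_PInf_AE) auto
  then have conv: "AE x in lborel. convergent (\<lambda>n. u (r n) x)"
  proof eventually_elim
    case (elim x)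
    then have "summable (\<lambda>n. ?d n x)"
      by (intro summable_suminf_not_top) auto
    then have "summable (\<lambda>n. u (r (Suc n)) x - u (r n) x)"
      by (rule summable_rabs_cancel)
    then have "convergent (\<lambda>n. \<Sum>i<n. u (r (Suc i)) x - u (r i) x)"
      by (simp add: summable_iff_convergent)
    then have "convergent (\<lambda>n. u (r n) x - u (r 0) x)"
      unfolding sum_lessThan_telescope[of "\<lambda>i. u (r i) x"] .
    from convergent_add[OF this convergent_const[of "u (r 0) x"]] show ?case
      by (simp only: diff_add_cancel)
  qed
  define v where "v x = lim (\<lambda>n. u (r n) x)" for x
  have [measurable]: "v \<in> borel_measurable borel" unfolding v_def[abs_def] by measurable
  have v0: "v x = 0" if "x \<notin> {a..b}" for x
    using supp_sqD(3)[OF u that] by (simp add: v_def)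
  have lim: "AE x in lborel. (\<lambda>n. u (r n) x) \<longlonglongrightarrow> v x"
    using conv by eventually_elim (simp add: v_def convergent_LIMSEQ_iff)
  have fatou: "(\<integral>\<^sup>+x. ennreal ((u i x - v x)\<^sup>2) \<partial>lborel) \<le> ennreal e"
    if i: "\<And>j. j \<ge> M \<Longrightarrow> (LINT x|lborel. (u i x - u j x)\<^sup>2) < e" for i M e
  proof -
    have "(\<integral>\<^sup>+x. ennreal ((u i x - v x)\<^sup>2) \<partial>lborel) = (\<integral>\<^sup>+x. liminf (\<lambda>n. ennreal ((u i x - u (r n) x)\<^sup>2)) \<partial>lborel)"
    proof (intro nn_integral_cong_AE)
      show "AE x in lborel. ennreal ((u i x - v x)\<^sup>2) = liminf (\<lambda>n. ennreal ((u i x - u (r n) x)\<^sup>2))"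
        using lim
      proof eventually_elim
        case (elim x)
        then have "(\<lambda>n. ennreal ((u i x - u (r n) x)\<^sup>2)) \<longlonglongrightarrow> ennreal ((u i x - v x)\<^sup>2)"
          by (intro tendsto_ennrealI tendsto_intros)
        then show ?case by (intro lim_imp_Liminf[symmetric]) auto
      qed
    qed
    also have "\<dots> \<le> liminf (\<lambda>n. \<integral>\<^sup>+x. ennreal ((u i x - u (r n) x)\<^sup>2) \<partial>lborel)"
      by (rule nn_integral_liminf) measurable
    also have "\<dots> \<le> liminf (\<lambda>n. ennreal e)"
    proof (rule Liminf_mono, rule eventually_sequentiallyI[of M])
      fix n assume "M \<le> n"
      then have "r n \<ge> M" using rn[of n] by simp
      then have "(LINT x|lborel. (u i x - u (r n) x)\<^sup>2) \<le> e" using i by (auto intro: less_imp_le)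
      then show "(\<integral>\<^sup>+x. ennreal ((u i x - u (r n) x)\<^sup>2) \<partial>lborel) \<le> ennreal e"
        using nn_integral_eq_integral[OF supp_sqD(2)[OF d, of i "r n"]] by (auto intro!: ennreal_leI)
    qed
    also have "\<dots> = ennreal e" by (simp add: Liminf_const)
    finally show ?thesis .
  qed
  have isq: "integrable lborel (\<lambda>x. (u i x - v x)\<^sup>2)"
    if "\<And>j. j \<ge> M \<Longrightarrow> (LINT x|lborel. (u i x - u j x)\<^sup>2) < e" for i M e
  proof (rule integrableI_bounded)
    show "(\<integral>\<^sup>+x. ennreal (norm ((u i x - v x)\<^sup>2)) \<partial>lborel) < \<infinity>"
      using fatou[of M i e, OF that] by (simp add: le_less_trans[OF _ ennreal_less_top])
  qed simp
  have vsq: "supp_sq a b v"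
  proof -
    have w: "supp_sq a b (\<lambda>x. u (N 0) x - v x)"
      using isq[of "N 0" "N 0" 1] N[of 0 "N 0"] supp_sqD(3)[OF u] v0 by (auto simp: supp_sq_def)
    show ?thesis using supp_sq_lincomb[OF u w, of 1 "N 0" "-1"] by simp
  qed
  have "(\<lambda>j. LINT x|lborel. (u j x - v x)\<^sup>2) \<longlonglongrightarrow> 0"
  proof (rule LIMSEQ_I)
    fix e :: real assume e: "e > 0"
    then obtain M where M: "\<forall>i\<ge>M. \<forall>j\<ge>M. (LINT x|lborel. (u i x - u j x)\<^sup>2) < e / 2"
      using Cauchy[of "e / 2"] by auto
    show "\<exists>no. \<forall>n\<ge>no. norm ((LINT x|lborel. (u n x - v x)\<^sup>2) - 0) < e"
    proof (intro exI[of _ M] allI impI)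
      fix n assume n: "n \<ge> M"
      have "ennreal (LINT x|lborel. (u n x - v x)\<^sup>2) \<le> ennreal (e / 2)"
        using fatou[of M n "e / 2"] isq[of M n "e / 2"] M n nn_integral_eq_integral[of lborel "\<lambda>x. (u n x - v x)\<^sup>2"] by auto
      then have "(LINT x|lborel. (u n x - v x)\<^sup>2) \<le> e / 2" using e by (simp add: ennreal_le_iff)
      then show "norm ((LINT x|lborel. (u n x - v x)\<^sup>2) - 0) < e" using e by simp
    qed
  qed
  with vsq show thesis by (rule that)
qed

text \<open>In the expansion of u = v + (u - v) the cross term is controlled by Cauchy-Schwarz. This
  carries both the constraint and the minimised quantity to the limit.\<close>

lemma L2_tendsto_norm:
  assumes u: "\<And>j. supp_sq a b (u j)" and v: "supp_sq a b v"
    and lim: "(\<lambda>j. LINT x|lborel. (u j x - v x)\<^sup>2) \<longlonglongrightarrow> 0"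
  shows "(\<lambda>j. LINT x|lborel. (u j x)\<^sup>2) \<longlonglongrightarrow> (LINT x|lborel. (v x)\<^sup>2)"
proof -
  have d: "supp_sq a b (\<lambda>x. u j x - v x)" for j
    using supp_sq_lincomb[OF u v, of 1 j "-1"] by simp
  have m: "integrable lborel (\<lambda>x. v x * (u j x - v x))" for j
  proof -
    have [measurable]: "u j \<in> borel_measurable borel" "v \<in> borel_measurable borel" using u v by (auto intro: supp_sqD)
    have "\<bar>p * q\<bar> \<le> p\<^sup>2 + q\<^sup>2" for p q :: real
      using sum_squares_bound[of p q] sum_squares_bound[of p "- q"] by (simp add: abs_if) 
    then show ?thesis
      by (intro Bochner_Integration.integrable_bound[OF Bochner_Integration.integrable_add[OF supp_sqD(2)[OF v] supp_sqD(2)[OF d]]]) auto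
  qed
  have m0: "(\<lambda>j. LINT x|lborel. v x * (u j x - v x)) \<longlonglongrightarrow> 0"
  proof (rule Lim_null_comparison)
    have "(\<lambda>j. sqrt ((LINT x|lborel. (v x)\<^sup>2) * (LINT x|lborel. (u j x - v x)\<^sup>2))) \<longlonglongrightarrow> sqrt ((LINT x|lborel. (v x)\<^sup>2) * 0)"
      by (intro tendsto_intros lim)
    then show "(\<lambda>j. sqrt ((LINT x|lborel. (v x)\<^sup>2) * (LINT x|lborel. (u j x - v x)\<^sup>2))) \<longlonglongrightarrow> 0" by simp
    show "\<forall>\<^sub>F j in sequentially. norm (LINT x|lborel. v x * (u j x - v x)) \<le> sqrt ((LINT x|lborel. (v x)\<^sup>2) * (LINT x|lborel. (u j x - v x)\<^sup>2))"
    proof (intro always_eventually allI)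
      fix j
      have "(LINT x|lborel. v x * (u j x - v x))\<^sup>2 \<le> (LINT x|lborel. (v x)\<^sup>2) * (LINT x|lborel. (u j x - v x)\<^sup>2)"
        by (rule integral_Cauchy_Schwarz[OF supp_sqD(2)[OF v] supp_sqD(2)[OF d] m])
      then show "norm (LINT x|lborel. v x * (u j x - v x)) \<le> sqrt ((LINT x|lborel. (v x)\<^sup>2) * (LINT x|lborel. (u j x - v x)\<^sup>2))"
        by (metis real_norm_def real_sqrt_abs real_sqrt_le_mono)
    qed
  qed
  have eq: "(LINT x|lborel. (u j x)\<^sup>2) = (LINT x|lborel. (u j x - v x)\<^sup>2) + 2 * (LINT x|lborel. v x * (u j x - v x)) + (LINT x|lborel. (v x)\<^sup>2)" for j
  proof -
    have "(\<lambda>x. (u j x)\<^sup>2) = (\<lambda>x. (u j x - v x)\<^sup>2 + 2 * (v x * (u j x - v x)) + (v x)\<^sup>2)"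
      by (simp add: power2_eq_square algebra_simps)
    then show ?thesis using m supp_sqD(2)[OF d] supp_sqD(2)[OF v] by simp
  qed
  have "(\<lambda>j. (LINT x|lborel. (u j x - v x)\<^sup>2) + 2 * (LINT x|lborel. v x * (u j x - v x)) + (LINT x|lborel. (v x)\<^sup>2))
     \<longlonglongrightarrow> 0 + 2 * 0 + (LINT x|lborel. (v x)\<^sup>2)"
    by (intro tendsto_intros lim m0)
  then show ?thesis by (simp add: eq)
qed

text \<open>The Poincare inequality passes convergence of the top members down the chain. The
  delicate point is that the primitives of the limit still vanish to the right of
  \<open>b\<close>.\<close>

lemma chain_limit:
  assumes G: "\<And>j. chain \<beta> a b (G j)" and ab: "a \<le> b" and v: "supp_sq a b v"
    and lim: "(\<lambda>j. LINT x|lborel. (G j \<beta> x - v x)\<^sup>2) \<longlonglongrightarrow> 0"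
  obtains H where "chain \<beta> a b H" "H \<beta> = v" "\<And>k. k \<le> \<beta> \<Longrightarrow> (\<lambda>j. LINT x|lborel. (G j k x - H k x)\<^sup>2) \<longlonglongrightarrow> 0"
proof -
  define H where "H k = (prim ^^ (\<beta> - k)) v" for k
  have main: "supp_sq a b (H (\<beta> - j)) \<and> (\<lambda>i. LINT x|lborel. (G i (\<beta> - j) x - H (\<beta> - j) x)\<^sup>2) \<longlonglongrightarrow> 0" if "j \<le> \<beta>" for j
    using that
  proof (induction j)
    case 0
    then show ?case using v lim by (simp add: H_def)
  next
    case (Suc j)
    define k where "k = \<beta> - Suc j"
    have k: "\<beta> - j = Suc k" "k < \<beta>" "Suc k \<le> \<beta>" using Suc.prems by (auto simp: k_def)
    have Hk: "H k = prim (H (Suc k))"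
      using k by (simp add: H_def Suc_diff_Suc[symmetric])
    have IH: "supp_sq a b (H (Suc k))" "(\<lambda>i. LINT x|lborel. (G i (Suc k) x - H (Suc k) x)\<^sup>2) \<longlonglongrightarrow> 0"
      using Suc k by auto
    have Gi: "supp_sq a b (G i (Suc k))" "supp_sq a b (G i k)" "G i k = prim (G i (Suc k))" for i
      using G[of i] k unfolding chain_def by (blast, meson less_imp_le, blast)
    have d: "supp_sq a b (\<lambda>x. G i (Suc k) x - H (Suc k) x)" for i
      using supp_sq_lincomb[OF Gi(1) IH(1), of 1 i "-1"] by simp
    have pd: "prim (\<lambda>x. G i (Suc k) x - H (Suc k) x) = (\<lambda>x. G i k x - H k x)" for i
    proof
      show "prim (\<lambda>x. G i (Suc k) x - H (Suc k) x) x = G i k x - H k x" for x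
      using prim_lincomb[OF supp_sq_integrable[OF Gi(1)] supp_sq_integrable[OF IH(1)], of 1 i "-1" x]
      by (simp add: Hk Gi(3))
    qed
    have zero: "H k x = 0" if x: "x \<notin> {a..b}" for x
    proof (cases "x < a")
      case True
      then show ?thesis using prim_eq_0[OF IH(1)] by (simp add: Hk)
    next
      case False
      have "(\<lambda>i. sqrt \<bar>x - (a - 1)\<bar> * sqrt (LINT t|lborel. (G i (Suc k) t - H (Suc k) t)\<^sup>2)) \<longlonglongrightarrow> sqrt \<bar>x - (a - 1)\<bar> * sqrt 0"
        by (intro tendsto_intros IH)
      then have l: "(\<lambda>i. sqrt \<bar>x - (a - 1)\<bar> * sqrt (LINT t|lborel. (G i (Suc k) t - H (Suc k) t)\<^sup>2)) \<longlonglongrightarrow> 0" by simp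
      \<comment> \<open>The approximating members are zero at \<open>x\<close>, so
        \<open>H k x\<close> is, up to sign, the value of a primitive whose Hoelder bound tends to
        0.\<close>
      have B: "norm (H k x) \<le> sqrt \<bar>x - (a - 1)\<bar> * sqrt (LINT t|lborel. (G i (Suc k) t - H (Suc k) t)\<^sup>2)" for i
      proof -
        have "prim (\<lambda>x. G i (Suc k) x - H (Suc k) x) (a - 1) = 0"
          by (rule prim_eq_0[OF d]) simp
        with prim_holder[OF d[of i], where y = x and x = "a - 1"]
        have "\<bar>prim (\<lambda>x. G i (Suc k) x - H (Suc k) x) x\<bar> \<le> sqrt \<bar>x - (a - 1)\<bar> * sqrt (LINT t|lborel. (G i (Suc k) t - H (Suc k) t)\<^sup>2)"
          by (simp only: diff_0_right)
        then show ?thesis unfolding pd supp_sqD(3)[OF Gi(2) x] by (simp only: diff_0 norm_minus_cancel real_norm_def[symmetric])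
      qed
      have "norm (H k x) \<le> 0"
        by (rule LIMSEQ_le_const[OF l]) (use B in blast)
      then show ?thesis by simp
    qed
    have Hsq: "supp_sq a b (H k)"
      using zero continuous_prim[OF IH(1)] by (intro supp_sq_continuousI) (simp_all add: Hk)
    have "(\<lambda>i. LINT x|lborel. (G i k x - H k x)\<^sup>2) \<longlonglongrightarrow> 0"
    proof (rule tendsto_sandwich[of "\<lambda>_. 0"])
      have "(\<lambda>i. (b - a + 1)\<^sup>2 * (LINT t|lborel. (G i (Suc k) t - H (Suc k) t)\<^sup>2)) \<longlonglongrightarrow> (b - a + 1)\<^sup>2 * 0"
        by (intro tendsto_intros IH)
      then show "(\<lambda>i. (b - a + 1)\<^sup>2 * (LINT t|lborel. (G i (Suc k) t - H (Suc k) t)\<^sup>2)) \<longlonglongrightarrow> 0" by simp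
      have "(LINT x|lborel. (G i k x - H k x)\<^sup>2) \<le> (b - a + 1)\<^sup>2 * (LINT t|lborel. (G i (Suc k) t - H (Suc k) t)\<^sup>2)" for i
      proof -
        have "supp_sq a b (prim (\<lambda>x. G i (Suc k) x - H (Suc k) x))"
          unfolding pd using supp_sq_lincomb[OF Gi(2) Hsq, of 1 i "-1"] by simp
        from prim_L2_bound[OF d this ab] show ?thesis by (simp add: pd)
      qed
      then show "\<forall>\<^sub>F i in sequentially. (LINT x|lborel. (G i k x - H k x)\<^sup>2) \<le> (b - a + 1)\<^sup>2 * (LINT t|lborel. (G i (Suc k) t - H (Suc k) t)\<^sup>2)"
        by simp
    qed (auto intro: tendsto_const)
    with Hsq show ?case by (simp add: k_def)
  qed
  have "chain \<beta> a b H"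
    unfolding chain_def
  proof (intro conjI allI impI)
    fix k assume "k \<le> \<beta>"
    then show "supp_sq a b (H k)" using main[of "\<beta> - k"] by simp
  next
    fix k assume "k < \<beta>"
    then show "H k = prim (H (Suc k))" by (simp add: H_def Suc_diff_Suc[symmetric])
  qed
  moreover have "H \<beta> = v" by (simp add: H_def)
  moreover have "(\<lambda>j. LINT x|lborel. (G j k x - H k x)\<^sup>2) \<longlonglongrightarrow> 0" if "k \<le> \<beta>" for k
    using main[of "\<beta> - k"] that by simp
  ultimately show thesis by (rule that)
qed

section \<open>Minimising the top derivative on the unit sphere\<close>

lemma supp_sq_parallelogram:
  assumes f: "supp_sq a b f" and g: "supp_sq a b g"
  shows "(LINT x|lborel. (f x - g x)\<^sup>2) + (LINT x|lborel. (f x + g x)\<^sup>2)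
    = 2 * (LINT x|lborel. (f x)\<^sup>2) + 2 * (LINT x|lborel. (g x)\<^sup>2)"
proof -
  have i: "integrable lborel (\<lambda>x. (f x - g x)\<^sup>2)" "integrable lborel (\<lambda>x. (f x + g x)\<^sup>2)"
    using supp_sqD(2)[OF supp_sq_lincomb[OF f g, of 1 "-1"]] supp_sqD(2)[OF supp_sq_lincomb[OF f g, of 1 1]] by simp_all
  have "(LINT x|lborel. (f x - g x)\<^sup>2) + (LINT x|lborel. (f x + g x)\<^sup>2) = (LINT x|lborel. (f x - g x)\<^sup>2 + (f x + g x)\<^sup>2)"
    by (rule Bochner_Integration.integral_add[symmetric, OF i])
  also have "(\<lambda>x. (f x - g x)\<^sup>2 + (f x + g x)\<^sup>2) = (\<lambda>x. 2 * (f x)\<^sup>2 + 2 * (g x)\<^sup>2)"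
    by (simp add: power2_eq_square algebra_simps)
  also have "(LINT x|lborel. 2 * (f x)\<^sup>2 + 2 * (g x)\<^sup>2) = 2 * (LINT x|lborel. (f x)\<^sup>2) + 2 * (LINT x|lborel. (g x)\<^sup>2)"
    using supp_sqD(2)[OF f] supp_sqD(2)[OF g] by simp
  finally show ?thesis .
qed

text \<open>With the L2 norm fixed at 1, minimising the Sobolev norm means minimising the norm of
  the last member alone.\<close>

lemma chain_minimizer:
  assumes \<beta>: "\<beta> > 0" and ab: "a \<le> b"
    and ex: "\<exists>G. chain \<beta> a b G \<and> (LINT x|lborel. (G 0 x)\<^sup>2) = 1"
  obtains G where "chain \<beta> a b G" "(LINT x|lborel. (G 0 x)\<^sup>2) = 1"
    "\<And>H. chain \<beta> a b H \<Longrightarrow> (LINT x|lborel. (H 0 x)\<^sup>2) = 1 \<Longrightarrow> (LINT x|lborel. (G \<beta> x)\<^sup>2) \<le> (LINT x|lborel. (H \<beta> x)\<^sup>2)"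
proof -
  define Q where "Q f = (LINT x|lborel. (f x)\<^sup>2)" for f :: "real \<Rightarrow> real"
  have Q0: "Q f \<ge> 0" for f by (simp add: Q_def)
  define S where "S = {Q (G \<beta>) | G. chain \<beta> a b G \<and> Q (G 0) = 1}"
  define lam where "lam = Inf S"
  have S: "S \<noteq> {}" "bdd_below S"
    using ex Q0 by (auto simp: S_def Q_def[symmetric] intro!: bdd_belowI[of _ 0])
  have lam0: "lam \<ge> 0" unfolding lam_def using S Q0 by (intro cInf_greatest) (auto simp: S_def)
  have lam1: "lam \<le> Q (H \<beta>)" if "chain \<beta> a b H" "Q (H 0) = 1" for H
    unfolding lam_def using S(2) that by (intro cInf_lower) (auto simp: S_def)
  \<comment> \<open>By homogeneity the infimum \<open>lam\<close> on the unit sphere becomes an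
    inequality between quadratic forms, valid in particular for sums of members of the minimising
    sequence.\<close>
  have scale: "lam * Q (H 0) \<le> Q (H \<beta>)" if H: "chain \<beta> a b H" for H
  proof (cases "Q (H 0) = 0")
    case False
    then have pos: "Q (H 0) > 0" using Q0[of "H 0"] by simp
    define s where "s = 1 / sqrt (Q (H 0))"
    have s2: "s\<^sup>2 = 1 / Q (H 0)" using pos by (simp add: s_def power_divide)
    have Qs: "Q (\<lambda>x. s * f x + 0 * f x) = s\<^sup>2 * Q f" for f
      by (simp add: Q_def power_mult_distrib)
    have "lam \<le> s\<^sup>2 * Q (H \<beta>)"
      using lam1[OF chain_lincomb[OF H H, of s 0]] pos by (simp only: Qs) (simp add: s2)
    then show ?thesis using pos by (simp add: s2 field_simps)
  qed (use Q0 in simp)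
  have "\<exists>G. chain \<beta> a b G \<and> Q (G 0) = 1 \<and> Q (G \<beta>) < lam + 1 / real (Suc j)" for j
  proof -
    have "Inf S < lam + 1 / real (Suc j)" by (simp add: lam_def)
    then obtain q where "q \<in> S" "q < lam + 1 / real (Suc j)"
      using cInf_lessD[OF S(1)] by blast
    then show ?thesis by (auto simp: S_def)
  qed
  then obtain G where G: "\<And>j. chain \<beta> a b (G j)" and G0: "\<And>j. Q (G j 0) = 1"
    and Gl: "\<And>j. Q (G j \<beta>) < lam + 1 / real (Suc j)" by metis
  \<comment> \<open>A bound for the norm of the first derivative: \<beta> - 1 Poincare steps
    separate it from the top one, whose squared norm is at most lam + 1 along the sequence.\<close>
  define M where "M = sqrt (((b - a + 1)\<^sup>2) ^ (\<beta> - 1) * (lam + 1))"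
  have M0: "M \<ge> 0" using lam0 by (simp add: M_def)
  have G1: "supp_sq a b (G j (Suc 0))" "G j 0 = prim (G j (Suc 0))" "supp_sq a b (G j 0)" "supp_sq a b (G j \<beta>)" for j
    using G[of j] \<beta> unfolding chain_def by (auto simp: Suc_le_eq)
  have G1M: "Q (G j (Suc 0)) \<le> M\<^sup>2" for j
  proof -
    have "Q (G j (\<beta> - (\<beta> - 1))) \<le> ((b - a + 1)\<^sup>2) ^ (\<beta> - 1) * Q (G j \<beta>)"
      unfolding Q_def by (rule chain_L2_bound[OF G ab]) simp
    also have "\<dots> \<le> ((b - a + 1)\<^sup>2) ^ (\<beta> - 1) * (lam + 1)"
    proof (rule mult_left_mono)
      have "1 / real (Suc j) \<le> 1" by simp
      then show "Q (G j \<beta>) \<le> lam + 1" using Gl[of j] by linarith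
    qed simp
    also have "\<dots> = M\<^sup>2" using lam0 by (simp add: M_def)
    finally show ?thesis using \<beta> by simp
  qed
  have sqM: "sqrt (Q (G j (Suc 0))) \<le> M" for j
    using real_sqrt_le_mono[OF G1M[of j]] M0 by simp
  have holder: "\<bar>G j 0 x - G j 0 y\<bar> \<le> sqrt \<bar>x - y\<bar> * M" for j x y
  proof -
    have "\<bar>G j 0 x - G j 0 y\<bar> \<le> sqrt \<bar>x - y\<bar> * sqrt (Q (G j (Suc 0)))"
      unfolding Q_def G1(2) by (rule prim_holder[OF G1(1)])
    also have "\<dots> \<le> sqrt \<bar>x - y\<bar> * M" by (rule mult_left_mono[OF sqM]) simp
    finally show ?thesis .
  qed
  have "compact {a..b}" by simp
  then have "\<exists>g r. strict_mono (r :: nat \<Rightarrow> nat) \<and>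
      (\<forall>e>0. \<exists>N. \<forall>n x. n \<ge> N \<and> x \<in> {a..b} \<longrightarrow> norm (G (r n) 0 x - g x) < e)"
  proof (rule Arzela_Ascoli[where \<F> = "\<lambda>j. G j 0" and M = "sqrt (b - a + 1) * M"])
    fix n x assume x: "x \<in> {a..b}"
    have "\<bar>G n 0 x - G n 0 (a - 1)\<bar> \<le> sqrt \<bar>x - (a - 1)\<bar> * M" by (rule holder)
    also have "\<dots> \<le> sqrt (b - a + 1) * M" using x M0 by (intro mult_right_mono) auto
    finally show "norm (G n 0 x) \<le> sqrt (b - a + 1) * M"
      using supp_sqD(3)[OF G1(3), of "a - 1" n] by simp
  next
    fix x e :: real assume "x \<in> {a..b}" "0 < e"
    show "\<exists>d>0. \<forall>n y. y \<in> {a..b} \<and> norm (x - y) < d \<longrightarrow> norm (G n 0 x - G n 0 y) < e"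
    proof (intro exI[of _ "(e / (M + 1))\<^sup>2"] conjI allI impI)
      show "0 < (e / (M + 1))\<^sup>2" using \<open>0 < e\<close> M0 by (intro zero_less_power divide_pos_pos) auto
      fix n y assume "y \<in> {a..b} \<and> norm (x - y) < (e / (M + 1))\<^sup>2"
      then have "sqrt \<bar>x - y\<bar> < sqrt ((e / (M + 1))\<^sup>2)" by (intro real_sqrt_less_mono) simp
      also have "\<dots> = e / (M + 1)" using \<open>0 < e\<close> M0 by simp
      finally have "sqrt \<bar>x - y\<bar> * (M + 1) < e" using M0 by (simp add: pos_less_divide_eq)
      moreover have "sqrt \<bar>x - y\<bar> * M \<le> sqrt \<bar>x - y\<bar> * (M + 1)" by (rule mult_left_mono) simp_all
      ultimately show "norm (G n 0 x - G n 0 y) < e" 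
        unfolding real_norm_def using holder[of n x y] by linarith
    qed
  next
    fix g and r :: "nat \<Rightarrow> nat"
    assume "strict_mono r"
      "\<And>e. 0 < e \<Longrightarrow> \<exists>N. \<forall>n x. n \<ge> N \<and> x \<in> {a..b} \<longrightarrow> norm (G (r n) 0 x - g x) < e"
    then show "\<exists>g r. strict_mono (r :: nat \<Rightarrow> nat) \<and>
        (\<forall>e>0. \<exists>N. \<forall>n x. n \<ge> N \<and> x \<in> {a..b} \<longrightarrow> norm (G (r n) 0 x - g x) < e)"
      by (intro exI[of _ g] exI[of _ r] conjI allI impI) assumption+
  qed
  then obtain g r where gr: "strict_mono (r :: nat \<Rightarrow> nat) \<and>
      (\<forall>e>0. \<exists>N. \<forall>n x. n \<ge> N \<and> x \<in> {a..b} \<longrightarrow> norm (G (r n) 0 x - g x) < e)"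
    by (elim exE)
  note r = gr[THEN conjunct1] and unif = gr[THEN conjunct2, rule_format]
  define H where "H j = G (r j)" for j
  have H: "chain \<beta> a b (H j)" "supp_sq a b (H j 0)" "supp_sq a b (H j \<beta>)" "Q (H j 0) = 1" for j
    unfolding H_def by (rule G, rule G1(3), rule G1(4), rule G0)
  have Hl: "Q (H j \<beta>) < lam + 1 / real (Suc j)" for j
  proof -
    have "1 / real (Suc (r j)) \<le> 1 / real (Suc j)"
      using seq_suble[OF r, of j] by (intro divide_left_mono) auto
    then show ?thesis using Gl[of "r j"] by (simp add: H_def)
  qed
  have E0: "\<exists>N. \<forall>i\<ge>N. \<forall>j\<ge>N. Q (\<lambda>x. H i 0 x - H j 0 x) \<le> e" if e: "e > 0" for e
  proof -
    \<comment> \<open>A uniform distance 2 d gives a squared L2 distance of at most (b - a) e / (b -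
      a + 1) \<le> e; the added 1 covers a = b.\<close>
    define d where "d = sqrt (e / (b - a + 1)) / 2"
    have d: "d > 0" using e ab by (simp add: d_def)
    obtain N where N: "\<And>n x. n \<ge> N \<Longrightarrow> x \<in> {a..b} \<Longrightarrow> norm (H n 0 x - g x) < d"
      using unif[OF d] by (auto simp: H_def)
    show ?thesis
    proof (intro exI[of _ N] allI impI)
      fix i j assume ij: "i \<ge> N" "j \<ge> N"
      have "Q (\<lambda>x. H i 0 x - H j 0 x) \<le> (b - a) * (e / (b - a + 1))"
        unfolding Q_def
      proof (rule supp_sq_integral_bound[OF _ ab])
        show "supp_sq a b (\<lambda>x. H i 0 x - H j 0 x)"
          using supp_sq_lincomb[OF H(2) H(2), of 1 i "-1" j] by simp
        fix x assume x: "x \<in> {a..b}"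
        have "\<bar>H i 0 x - H j 0 x\<bar> \<le> 2 * d" using N[OF ij(1) x] N[OF ij(2) x] by (simp add: abs_if split: if_splits)
        then have "\<bar>H i 0 x - H j 0 x\<bar>\<^sup>2 \<le> (2 * d)\<^sup>2" by (intro power_mono) auto
        also have "(2 * d)\<^sup>2 = e / (b - a + 1)" using e ab by (simp add: d_def)
        finally show "(H i 0 x - H j 0 x)\<^sup>2 \<le> e / (b - a + 1)" by simp
      qed
      also have "\<dots> \<le> e" using e ab by (simp add: field_simps)
      finally show "Q (\<lambda>x. H i 0 x - H j 0 x) \<le> e" .
    qed
  qed
  text \<open>Since the quadratic form dominates \<open>lam\<close> times the squared norm, the parallelogram law
    turns the convergence of the functions themselves into that of their top derivatives.\<close>
  have key: "Q (\<lambda>x. H i \<beta> x - H j \<beta> x) \<le> 2 * (1 / real (Suc i)) + 2 * (1 / real (Suc j)) + lam * Q (\<lambda>x. H i 0 x - H j 0 x)" for i j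
  proof -
    have "Q (\<lambda>x. H i \<beta> x - H j \<beta> x) + Q (\<lambda>x. H i \<beta> x + H j \<beta> x) = 2 * Q (H i \<beta>) + 2 * Q (H j \<beta>)"
      unfolding Q_def by (rule supp_sq_parallelogram[OF H(3) H(3)])
    moreover have "Q (\<lambda>x. H i 0 x - H j 0 x) + Q (\<lambda>x. H i 0 x + H j 0 x) = 2 * Q (H i 0) + 2 * Q (H j 0)"
      unfolding Q_def by (rule supp_sq_parallelogram[OF H(2) H(2)])
    then have "Q (\<lambda>x. H i 0 x + H j 0 x) = 4 - Q (\<lambda>x. H i 0 x - H j 0 x)"
      using H(4) by simp
    moreover have "lam * Q (\<lambda>x. H i 0 x + H j 0 x) \<le> Q (\<lambda>x. H i \<beta> x + H j \<beta> x)"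
      using scale[OF chain_lincomb[OF H(1) H(1), of 1 i 1 j]] by simp
    moreover have "A \<le> 2 * p + 2 * q + lam * z"
      if "A + B = 2 * x + 2 * y" "C = 4 - z" "lam * C \<le> B" "x < lam + p" "y < lam + q" for A B C x y z p q :: real
    proof -
      have "lam * C = 4 * lam - lam * z" unfolding that(2) by (simp only: right_diff_distrib mult.commute)
      with that show ?thesis by linarith
    qed
    ultimately show ?thesis using Hl by blast
  qed
  have "\<exists>N. \<forall>i\<ge>N. \<forall>j\<ge>N. (LINT x|lborel. (H i \<beta> x - H j \<beta> x)\<^sup>2) < e" if e: "e > 0" for e
  proof -
    \<comment> \<open>Three contributions of at most e/4 each: indices beyond 8/e handle the two
      excesses over the infimum, and e / (4 (lam + 1)) handles the functions themselves, with lam +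
      1 because lam may be 0.\<close>
    obtain N1 where N1: "\<And>i j. i \<ge> N1 \<Longrightarrow> j \<ge> N1 \<Longrightarrow> Q (\<lambda>x. H i 0 x - H j 0 x) \<le> e / (4 * (lam + 1))"
      using E0[of "e / (4 * (lam + 1))"] e lam0 by auto
    obtain N2 where N2: "8 / e < real N2" using reals_Archimedean2 by blast
    show ?thesis
    proof (intro exI[of _ "max N1 N2"] allI impI)
      fix i j assume ij: "i \<ge> max N1 N2" "j \<ge> max N1 N2"
      have *: "2 * (1 / real (Suc k)) < e / 4" if "k \<ge> N2" for k
      proof -
        have "8 / e < real (Suc k)" using N2 that by linarith
        then show ?thesis using e by (simp add: field_simps del: of_nat_Suc)
      qed
      have "lam * Q (\<lambda>x. H i 0 x - H j 0 x) \<le> lam * (e / (4 * (lam + 1)))"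
        using N1[of i j] ij lam0 by (intro mult_left_mono) auto
      also have "\<dots> \<le> e / 4" using lam0 e by (simp add: field_simps)
      finally have "Q (\<lambda>x. H i \<beta> x - H j \<beta> x) < e"
        using key[of i j] *[of i] *[of j] ij e by linarith
      then show "(LINT x|lborel. (H i \<beta> x - H j \<beta> x)\<^sup>2) < e" by (simp add: Q_def)
    qed
  qed
  from L2_complete_supp_sq[OF H(3) ab this] obtain v
    where v: "supp_sq a b v" "(\<lambda>j. LINT x|lborel. (H j \<beta> x - v x)\<^sup>2) \<longlonglongrightarrow> 0" by blast
  from chain_limit[OF H(1) ab v] obtain F where F: "chain \<beta> a b F" "F \<beta> = v"
    and Flim: "\<And>k. k \<le> \<beta> \<Longrightarrow> (\<lambda>j. LINT x|lborel. (H j k x - F k x)\<^sup>2) \<longlonglongrightarrow> 0" by blast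
  have Fs: "supp_sq a b (F 0)" "supp_sq a b (F \<beta>)" using F(1) by (auto simp: chain_def)
  have "(\<lambda>j. Q (H j 0)) \<longlonglongrightarrow> Q (F 0)"
    unfolding Q_def by (rule L2_tendsto_norm[OF H(2) Fs(1) Flim]) simp
  then have F0: "Q (F 0) = 1" by (simp add: H(4) LIMSEQ_const_iff)
  have l1: "(\<lambda>j. Q (H j \<beta>)) \<longlonglongrightarrow> Q (F \<beta>)"
    unfolding Q_def by (rule L2_tendsto_norm[OF H(3) Fs(2) Flim]) simp
  have l2: "(\<lambda>j. lam + 1 / real (Suc j)) \<longlonglongrightarrow> lam + 0"
    by (intro tendsto_intros LIMSEQ_Suc[OF lim_1_over_n])
  have "Q (F \<beta>) \<le> lam"
    using LIMSEQ_le[OF l1 l2] Hl by (auto intro: less_imp_le)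
  then have "Q (F \<beta>) \<le> Q (K \<beta>)" if "chain \<beta> a b K" "Q (K 0) = 1" for K
    using lam1[OF that] by simp
  with F(1) F0 show thesis using that unfolding Q_def by blast
qed

text \<open>A smooth bump and its ordinary derivatives form a chain, and rescaling normalises it.
  This makes the minimisation problem feasible at every order.\<close>

lemma bump_chain:
  assumes ab: "a < b"
  obtains G where "chain \<beta> a b G" "(LINT x|lborel. (G 0 x)\<^sup>2) = 1"
proof -
  define \<phi> where "\<phi> = bump 1 a b"
  have Ck: "Ck k \<phi>" for k unfolding \<phi>_def by (rule Ck_bump) simp
  have z: "\<phi> x = 0" if "x \<notin> {a..b}" for x using that by (auto simp: \<phi>_def bump_eq_0_iff)
  define D where "D k = (deriv ^^ k) \<phi>" for k
  have Dz: "D k x = 0" if "x \<notin> {a..b}" for k x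
    unfolding D_def by (rule deriv_funpow_test_0[OF z that])
  have Dc: "continuous_on S (D k)" for S k
    unfolding D_def by (rule continuous_on_Ck[OF Ck])
  have sq: "supp_sq a b (D k)" for k by (rule supp_sq_continuousI[OF Dc Dz])
  have "D k = prim (D (Suc k))" for k
  proof
    fix x
    have DD: "(D k has_real_derivative D (Suc k) y) (at y)" for y
      unfolding D_def by (rule DERIV_funpow_Ck[OF Ck])
    define A where "A = min a x - 1"
    have "prim (D (Suc k)) x = (LINT y|lborel. D (Suc k) y * indicator {A..x} y)"
      unfolding prim_def set_lebesgue_integral_def
    proof (intro Bochner_Integration.integral_cong refl)
      fix y
      show "indicator {..x} y *\<^sub>R D (Suc k) y = D (Suc k) y * indicator {A..x} y"
      proof (cases "A \<le> y")
        case False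
        then have "D (Suc k) y = 0" by (intro Dz) (auto simp: A_def)
        then show ?thesis by simp
      qed (auto simp: indicator_def)
    qed
    also have "\<dots> = D k x - D k A"
      using DD Dc[of UNIV "Suc k"] by (intro integral_FTC_Icc_real) (auto simp: A_def continuous_on_eq_continuous_at)
    also have "D k A = 0"
    proof (rule Dz)
      have "A < a" by (simp add: A_def)
      then show "A \<notin> {a..b}" by simp
    qed
    finally show "D k x = prim (D (Suc k)) x" by simp
  qed
  with sq have ch: "chain \<beta> a b D" unfolding chain_def by blast
  define E where "E = (LINT x|lborel. (D 0 x)\<^sup>2)"
  have "E \<noteq> 0"
  proof
    assume "E = 0"
    then have "AE x in lborel. (D 0 x)\<^sup>2 = 0"
      using integral_nonneg_eq_0_iff_AE[OF supp_sqD(2)[OF sq[of 0]]] by (simp add: E_def)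
    then have "AE x in lborel. x \<notin> {a<..<b}"
      by eventually_elim (simp add: D_def \<phi>_def bump_eq_0_iff)
    then have "emeasure lborel {a<..<b} = 0"
      by (subst (asm) AE_iff_measurable[of "{a<..<b}"]) auto
    then show False using ab by simp
  qed
  moreover have "E \<ge> 0" unfolding E_def by simp
  ultimately have E: "E > 0" by linarith
  define s where "s = 1 / sqrt E"
  have "(LINT x|lborel. (s * D 0 x + 0 * D 0 x)\<^sup>2) = s\<^sup>2 * E"
    by (simp add: E_def power_mult_distrib)
  also have "\<dots> = 1" using E by (simp add: s_def power_divide)
  finally show thesis by (rule that[OF chain_lincomb[OF ch ch]])
qed

text \<open>Every admissible kernel is almost everywhere a chain with the same norms, so the minimum
  over chains is a lower bound of the set whose infimum is \<open>Gamma_const\<close>. It is this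
  direction that turns the radius of \<open>Theta_ball\<close> into a bound by
  \<open>R\<close>.\<close>

lemma Gamma_const_attained:
  assumes \<beta>: "\<beta> > 0"
  obtains G where "chain \<beta> (-1/2) (1/2) G" "(LINT x|lborel. (G 0 x)\<^sup>2) = 1"
    "sqrt (1 + (LINT x|lborel. (G \<beta> x)\<^sup>2)) \<le> Gamma_const \<beta>"
proof -
  have "\<exists>G. chain \<beta> (-1/2) (1/2) G \<and> (LINT x|lborel. (G 0 x)\<^sup>2) = 1"
  proof (rule bump_chain)
    show "- 1 / 2 < (1 / 2 :: real)" by simp
    fix G assume "chain \<beta> (-1/2) (1/2) G" "(LINT x|lborel. (G 0 x)\<^sup>2) = 1"
    then show "\<exists>G. chain \<beta> (-1/2) (1/2) G \<and> (LINT x|lborel. (G 0 x)\<^sup>2) = 1" by blast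
  qed
  from chain_minimizer[OF \<beta> _ this] obtain G where G: "chain \<beta> (-1/2) (1/2) G" "(LINT x|lborel. (G 0 x)\<^sup>2) = 1"
    and min: "\<And>H. chain \<beta> (-1/2) (1/2) H \<Longrightarrow> (LINT x|lborel. (H 0 x)\<^sup>2) = 1 \<Longrightarrow> (LINT x|lborel. (G \<beta> x)\<^sup>2) \<le> (LINT x|lborel. (H \<beta> x)\<^sup>2)"
    by auto
  have "sqrt (1 + (LINT x|lborel. (G \<beta> x)\<^sup>2)) \<le> Gamma_const \<beta>"
    unfolding Gamma_const_def
  proof (rule cInf_greatest)
    \<comment> \<open>A greatest lower bound needs a nonempty set; the minimiser itself is a
      member.\<close>
    have s: "supp_sq (-1/2) (1/2) (G 0)" using G(1) by (auto simp: chain_def)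
    have "(L2_norm_on UNIV (G 0))\<^sup>2 = 1" using L2_norm_on_supp_sq[OF s, of UNIV] G(2) by simp
    moreover have "L2_norm_on UNIV (G 0) \<ge> 0" by (simp add: L2_norm_on_def set_lebesgue_integral_def)
    ultimately have "L2_norm_on UNIV (G 0) = 1" by (simp add: power2_eq_1_iff)
    moreover have "G 0 \<in> sobolev_space \<beta> UNIV" by (rule chain_in_sobolev_space[OF G(1)]) auto
    moreover have "AE x in lborel. x \<notin> {-1/2..1/2} \<longrightarrow> G 0 x = 0" using supp_sqD(3)[OF s] by simp
    ultimately show "{sobolev_norm \<beta> UNIV K | K. K \<in> sobolev_space \<beta> UNIV \<and> L2_norm_on UNIV K = 1 \<and>
        (AE x in lborel. x \<notin> {-1/2..1/2} \<longrightarrow> K x = 0)} \<noteq> {}" by blast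
  next
    fix y assume "y \<in> {sobolev_norm \<beta> UNIV K | K. K \<in> sobolev_space \<beta> UNIV \<and> L2_norm_on UNIV K = 1 \<and>
        (AE x in lborel. x \<notin> {-1/2..1/2} \<longrightarrow> K x = 0)}"
    then obtain K where K: "y = sobolev_norm \<beta> UNIV K" "K \<in> sobolev_space \<beta> UNIV" "L2_norm_on UNIV K = 1"
      "AE x in lborel. x \<notin> {-1/2..1/2} \<longrightarrow> K x = 0" by blast
    from sobolev_space_UNIV_chain[OF K(2,4)] obtain H where H: "chain \<beta> (-1/2) (1/2) H"
      "AE x in lborel. H 0 x = K x" "AE x in lborel. H \<beta> x = weak_deriv \<beta> UNIV K x" by blast
    have s: "supp_sq (-1/2) (1/2) (H 0)" "supp_sq (-1/2) (1/2) (H \<beta>)" using H(1) by (auto simp: chain_def)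
    have [measurable]: "H 0 \<in> borel_measurable borel" "H \<beta> \<in> borel_measurable borel"
      using s by (auto intro: supp_sqD)
    have [measurable]: "K \<in> borel_measurable borel"
      using K(2) by (auto simp: sobolev_space_def square_integrable_on_def set_borel_measurable_def)
    have "\<exists>g. square_integrable_on UNIV g \<and> is_weak_deriv \<beta> UNIV K g"
      using K(2) by (auto simp: sobolev_space_def)
    then have "square_integrable_on UNIV (weak_deriv \<beta> UNIV K)"
      unfolding weak_deriv_def by (rule someI_ex[THEN conjunct1])
    then have [measurable]: "weak_deriv \<beta> UNIV K \<in> borel_measurable borel"
      by (auto simp: square_integrable_on_def set_borel_measurable_def)
    have L2: "(L2_norm_on UNIV f)\<^sup>2 = (LINT x|lborel. (h x)\<^sup>2)"
      if "AE x in lborel. h x = f x" and [measurable]: "f \<in> borel_measurable borel" "h \<in> borel_measurable borel" for f h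
    proof -
      have "(LINT x|lborel. (f x)\<^sup>2) = (LINT x|lborel. (h x)\<^sup>2)"
        using that(1) by (intro integral_cong_AE) (auto elim!: eventually_mono)
      then show ?thesis by (simp add: L2_norm_on_def set_lebesgue_integral_def)
    qed
    have e1: "(LINT x|lborel. (H 0 x)\<^sup>2) = 1" using L2[OF H(2)] K(3) by simp
    have "y = sqrt (1 + (LINT x|lborel. (H \<beta> x)\<^sup>2))"
      using L2[OF H(3)] K(1,3) by (simp add: sobolev_norm_def)
    then show "sqrt (1 + (LINT x|lborel. (G \<beta> x)\<^sup>2)) \<le> y"
      using min[OF H(1) e1] by simp
  qed
  with G show thesis by (rule that)
qed

section \<open>Characteristic functions of several variables\<close>

text \<open>The value at 0 is the total mass, so both measures can be divided by it and compared as
  probability measures; mass zero is treated apart.\<close>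

lemma finite_measure_eq_by_char:
  fixes M1 M2 :: "real measure"
  assumes f: "finite_measure M1" "finite_measure M2" and s: "sets M1 = sets borel" "sets M2 = sets borel"
    and ch: "\<And>t. char M1 t = char M2 t"
  shows "M1 = M2"
proof -
  interpret M1: finite_measure M1 by fact
  interpret M2: finite_measure M2 by fact
  have sp: "space M1 = UNIV" "space M2 = UNIV" using s[THEN sets_eq_imp_space_eq] by simp_all
  have "complex_of_real (measure M1 UNIV) = complex_of_real (measure M2 UNIV)"
    using ch[of 0] sp by (simp add: char_def)
  then have tot: "measure M1 UNIV = measure M2 UNIV" by (simp only: of_real_eq_iff)
  define c where "c = measure M1 UNIV"
  have em: "emeasure M1 UNIV = ennreal c" "emeasure M2 UNIV = ennreal c"
    by (simp_all add: c_def tot M1.emeasure_eq_measure M2.emeasure_eq_measure)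
  show ?thesis
  proof (cases "c = 0")
    case True
    have "emeasure M1 A = 0" "emeasure M2 A = 0" for A
      using emeasure_mono[of A UNIV M1] emeasure_mono[of A UNIV M2] em True s sp
      by (metis ennreal_0 emeasure_notin_sets le_zero_eq sets.top subset_UNIV)+
    then show ?thesis by (intro measure_eqI) (simp_all add: s)
  next
    case False
    then have c: "c > 0" using measure_nonneg[of M1 UNIV] by (simp add: c_def less_le)
    define D where "D M = density M (\<lambda>_. ennreal (1 / c))" for M :: "real measure"
    have rd: "real_distribution (D M)" if "sets M = sets borel" "emeasure M UNIV = ennreal c" for M
    proof -
      have "space M = UNIV" using that(1)[THEN sets_eq_imp_space_eq] by simp
      then have "emeasure (D M) (space (D M)) = 1"
        using that c by (simp add: D_def emeasure_density nn_integral_cmult ennreal_mult[symmetric])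
      then have "prob_space (D M)" by (rule prob_spaceI)
      then show ?thesis
        using that \<open>space M = UNIV\<close> by (simp add: real_distribution_def real_distribution_axioms_def D_def)
    qed
    have chD: "char (D M) t = complex_of_real (1 / c) * char M t" if "sets M = sets borel" for M t
    proof -
      have "(\<lambda>x. iexp (t * x)) \<in> borel_measurable M" using that by (simp cong: measurable_cong_sets)
      then have "char (D M) t = (LINT x|M. (1 / c) *\<^sub>R iexp (t * x))"
        unfolding char_def D_def using c by (subst integral_density) auto
      then show ?thesis by (simp add: char_def scaleR_conv_of_real)
    qed
    have "char (D M1) = char (D M2)" using ch by (auto simp: chD s fun_eq_iff)
    with Levy_uniqueness[OF rd rd] s em have DD: "D M1 = D M2" by blast
    have undo: "density (D M) (\<lambda>_. ennreal c) = M" for M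
      using c by (simp add: D_def density_density_eq ennreal_mult[symmetric] density_1)
    have "M1 = density (D M1) (\<lambda>_. ennreal c)" by (rule undo[symmetric])
    also have "\<dots> = M2" unfolding DD by (rule undo)
    finally show ?thesis .
  qed
qed

text \<open>Multiplying a characteristic function by a nonnegative weight such as \<open>1 + cos\<close> keeps it the
  characteristic function of a finite measure; this reduces the uniqueness in several variables to
  the one-dimensional theorem.\<close>

lemma weighted_law_eq:
  fixes Z1 :: "'a \<Rightarrow> real" and Z2 :: "'b \<Rightarrow> real" and w1 :: "'a \<Rightarrow> real" and w2 :: "'b \<Rightarrow> real"
  assumes Z[measurable]: "Z1 \<in> borel_measurable M1" "Z2 \<in> borel_measurable M2"
    and w: "integrable M1 w1" "integrable M2 w2" and w0: "\<And>x. w1 x \<ge> 0" "\<And>x. w2 x \<ge> 0"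
    and ch: "\<And>t. (LINT x|M1. complex_of_real (w1 x) * iexp (t * Z1 x)) = (LINT x|M2. complex_of_real (w2 x) * iexp (t * Z2 x))"
    and A: "A \<in> sets borel"
  shows "(LINT x|M1. w1 x * indicator A (Z1 x)) = (LINT x|M2. w2 x * indicator A (Z2 x))"
proof -
  define N1 where "N1 = distr (density M1 (\<lambda>x. ennreal (w1 x))) borel Z1"
  define N2 where "N2 = distr (density M2 (\<lambda>x. ennreal (w2 x))) borel Z2"
  have [measurable]: "w1 \<in> borel_measurable M1" "w2 \<in> borel_measurable M2" using w by auto
  have "emeasure (density M1 (\<lambda>x. ennreal (w1 x))) (space M1) < \<infinity>" "emeasure (density M2 (\<lambda>x. ennreal (w2 x))) (space M2) < \<infinity>"
    using w w0 by (simp_all add: emeasure_density nn_integral_eq_integral cong: nn_integral_cong)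
  then have "finite_measure (density M1 (\<lambda>x. ennreal (w1 x)))" "finite_measure (density M2 (\<lambda>x. ennreal (w2 x)))"
    by (auto intro!: finite_measureI)
  then have f: "finite_measure N1" "finite_measure N2"
    unfolding N1_def N2_def by (auto intro!: finite_measure.finite_measure_distr)
  have c: "char N1 t = (LINT x|M1. complex_of_real (w1 x) * iexp (t * Z1 x))"
    "char N2 t = (LINT x|M2. complex_of_real (w2 x) * iexp (t * Z2 x))" for t
    unfolding char_def N1_def N2_def using w0
    by (simp_all add: integral_distr integral_density scaleR_conv_of_real)
  have "N1 = N2" using c ch by (intro finite_measure_eq_by_char f) (auto simp: N1_def N2_def)
  have [measurable]: "A \<in> sets borel" by fact
  have "(LINT x|M1. w1 x * indicator A (Z1 x)) = integral\<^sup>L N1 (indicat_real A)"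
    unfolding N1_def using w0
    by (subst integral_distr, measurable, subst integral_density) auto
  also have "\<dots> = integral\<^sup>L N2 (indicat_real A)" unfolding \<open>N1 = N2\<close> ..
  also have "\<dots> = (LINT x|M2. w2 x * indicator A (Z2 x))"
    unfolding N2_def using w0
    by (subst integral_distr, measurable, subst integral_density) auto
  finally show ?thesis .
qed

text \<open>One coordinate moves from the exponential into an indicator. The complex factor exp(i s)
  is not a weight, but cos(s + c) is the difference of the nonnegative weights 1 + cos(s + c) and 1,
  and two values of c recover exp(i s).\<close>

lemma indicator_law_step:
  fixes Z1 p1 s1 :: "'a \<Rightarrow> real" and Z2 p2 s2 :: "'b \<Rightarrow> real"
  assumes P: "prob_space M1" "prob_space M2"
    and m1 [measurable]: "Z1 \<in> borel_measurable M1" "p1 \<in> borel_measurable M1" "s1 \<in> borel_measurable M1"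
    and m2 [measurable]: "Z2 \<in> borel_measurable M2" "p2 \<in> borel_measurable M2" "s2 \<in> borel_measurable M2"
    and p1: "\<And>x. 0 \<le> p1 x" "\<And>x. p1 x \<le> 1" and p2: "\<And>x. 0 \<le> p2 x" "\<And>x. p2 x \<le> 1"
    and ch: "\<And>t r. (LINT x|M1. complex_of_real (p1 x) * iexp (t * Z1 x + r * s1 x))
          = (LINT x|M2. complex_of_real (p2 x) * iexp (t * Z2 x + r * s2 x))"
    and A [measurable]: "A \<in> sets borel"
  shows "(LINT x|M1. complex_of_real (p1 x * indicator A (Z1 x)) * iexp (s1 x))
    = (LINT x|M2. complex_of_real (p2 x * indicator A (Z2 x)) * iexp (s2 x))"
proof -
  interpret M1: prob_space M1 by fact
  interpret M2: prob_space M2 by fact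
  have int1: "integrable M1 (\<lambda>x. complex_of_real (p1 x) * iexp (f x))" if [measurable]: "f \<in> borel_measurable M1" for f
    using p1 by (intro M1.integrable_const_bound[where B = 1]) (auto simp: norm_mult)
  have int2: "integrable M2 (\<lambda>x. complex_of_real (p2 x) * iexp (f x))" if [measurable]: "f \<in> borel_measurable M2" for f
    using p2 by (intro M2.integrable_const_bound[where B = 1]) (auto simp: norm_mult)
  \<comment> \<open>Euler's formula writes the weighted exponential as a combination of the
    exponentials for r = 0, 1, -1, to which the hypothesis applies.\<close>
  have cosexp: "complex_of_real (p * (1 + cos (s + c))) * iexp z
      = complex_of_real p * iexp (z + 0 * s) + (iexp c / 2) * (complex_of_real p * iexp (z + 1 * s))
        + (iexp (- c) / 2) * (complex_of_real p * iexp (z + (-1) * s))" for p s c z :: real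
  proof -
    have cs: "complex_of_real (cos y) = (iexp y + iexp (- y)) / 2" for y :: real
      by (simp add: cos_of_real[symmetric] cos_exp_eq)
    have m: "iexp a * iexp b = iexp (a + b)" for a b :: real by (simp add: exp_add[symmetric] algebra_simps)
    have "complex_of_real (p * (1 + cos (s + c))) * iexp z
      = complex_of_real p * iexp z + complex_of_real p * ((iexp (s + c) * iexp z) / 2) + complex_of_real p * ((iexp (- (s + c)) * iexp z) / 2)"
      by (simp only: of_real_mult of_real_add of_real_1 cs) (simp add: algebra_simps add_divide_distrib)
    also have "iexp (s + c) * iexp z = iexp c * iexp (z + 1 * s)" unfolding m by (simp add: algebra_simps)
    also have "iexp (- (s + c)) * iexp z = iexp (- c) * iexp (z + (-1) * s)" unfolding m by (simp add: algebra_simps)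
    finally show ?thesis by (simp add: mult.left_commute)
  qed
  have i3: "integrable M (\<lambda>x. f x + c * g x + d * h x)"
      "(LINT x|M. f x + c * g x + d * h x) = (LINT x|M. f x) + c * (LINT x|M. g x) + d * (LINT x|M. h x)"
    if "integrable M f" "integrable M g" "integrable M h" for M and f g h :: "'c \<Rightarrow> complex" and c d
    using that by simp_all
  have c1: "0 \<le> 1 + cos y" "1 + cos y \<le> 2" for y :: real
    using cos_ge_minus_one[of y] cos_le_one[of y] by linarith+
  have main: "(LINT x|M1. (p1 x * (1 + cos (s1 x + c))) * indicator A (Z1 x))
      = (LINT x|M2. (p2 x * (1 + cos (s2 x + c))) * indicator A (Z2 x))" for c
  proof (rule weighted_law_eq)
    have "p1 x * (1 + cos (s1 x + c)) \<le> 1 * 2" for x using p1 c1 by (intro mult_mono) auto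
    then show "integrable M1 (\<lambda>x. p1 x * (1 + cos (s1 x + c)))"
      using p1 c1 by (intro M1.integrable_const_bound[where B = 2] AE_I2) (auto simp: abs_mult)
    have "p2 x * (1 + cos (s2 x + c)) \<le> 1 * 2" for x using p2 c1 by (intro mult_mono) auto
    then show "integrable M2 (\<lambda>x. p2 x * (1 + cos (s2 x + c)))"
      using p2 c1 by (intro M2.integrable_const_bound[where B = 2] AE_I2) (auto simp: abs_mult)
    show "0 \<le> p1 x * (1 + cos (s1 x + c))" for x using p1 c1 by (intro mult_nonneg_nonneg)
    show "0 \<le> p2 x * (1 + cos (s2 x + c))" for x using p2 c1 by (intro mult_nonneg_nonneg)
    show "(LINT x|M1. complex_of_real (p1 x * (1 + cos (s1 x + c))) * iexp (t * Z1 x))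
      = (LINT x|M2. complex_of_real (p2 x * (1 + cos (s2 x + c))) * iexp (t * Z2 x))" for t
    proof -
      have "(LINT x|M1. complex_of_real (p1 x * (1 + cos (s1 x + c))) * iexp (t * Z1 x))
        = (LINT x|M1. complex_of_real (p1 x) * iexp (t * Z1 x + 0 * s1 x))
          + iexp c / 2 * (LINT x|M1. complex_of_real (p1 x) * iexp (t * Z1 x + 1 * s1 x))
          + iexp (- c) / 2 * (LINT x|M1. complex_of_real (p1 x) * iexp (t * Z1 x + (-1) * s1 x))"
        unfolding cosexp by (intro i3(2) int1) measurable
      also have "\<dots> = (LINT x|M2. complex_of_real (p2 x) * iexp (t * Z2 x + 0 * s2 x))
          + iexp c / 2 * (LINT x|M2. complex_of_real (p2 x) * iexp (t * Z2 x + 1 * s2 x))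
          + iexp (- c) / 2 * (LINT x|M2. complex_of_real (p2 x) * iexp (t * Z2 x + (-1) * s2 x))"
        unfolding ch ..
      also have "\<dots> = (LINT x|M2. complex_of_real (p2 x * (1 + cos (s2 x + c))) * iexp (t * Z2 x))"
        unfolding cosexp by (intro i3(2)[symmetric] int2) measurable
      finally show ?thesis .
    qed
  qed (use A in auto)
  have main0: "(LINT x|M1. p1 x * indicator A (Z1 x)) = (LINT x|M2. p2 x * indicator A (Z2 x))"
  proof (rule weighted_law_eq)
    show "integrable M1 p1" using p1 by (intro M1.integrable_const_bound[where B = 1]) auto
    show "integrable M2 p2" using p2 by (intro M2.integrable_const_bound[where B = 1]) auto
    show "(LINT x|M1. complex_of_real (p1 x) * iexp (t * Z1 x)) = (LINT x|M2. complex_of_real (p2 x) * iexp (t * Z2 x))" for t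
      using ch[of t 0] by simp
  qed (use p1 p2 A in auto)
  have b: "\<bar>p * indicator A z\<bar> \<le> 1" "\<bar>p * indicator A z * cos y\<bar> \<le> 1" if "0 \<le> p" "p \<le> 1" for p z y :: real
    using that by (auto simp: abs_mult indicator_def intro!: mult_le_one)
  have ci1: "integrable M1 (\<lambda>x. p1 x * indicator A (Z1 x) * cos (s1 x + c))" "integrable M1 (\<lambda>x. p1 x * indicator A (Z1 x))" for c
    using p1 b by (auto intro!: M1.integrable_const_bound[where B = 1])
  have ci2: "integrable M2 (\<lambda>x. p2 x * indicator A (Z2 x) * cos (s2 x + c))" "integrable M2 (\<lambda>x. p2 x * indicator A (Z2 x))" for c
    using p2 b by (auto intro!: M2.integrable_const_bound[where B = 1])
  have cosc: "(LINT x|M1. p1 x * indicator A (Z1 x) * cos (s1 x + c)) = (LINT x|M2. p2 x * indicator A (Z2 x) * cos (s2 x + c))" for c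
  proof -
    have e: "(p * (1 + y)) * i = p * i + p * i * y" for p y i :: real by (simp add: algebra_simps)
    show ?thesis using main[of c] main0 unfolding e using ci1 ci2 by simp
  qed
  \<comment> \<open>The shift by -pi/2 turns the cosine into the sine, that is, into the imaginary
    part.\<close>
  have e: "complex_of_real p * iexp s = complex_of_real (p * cos (s + 0)) + \<i> * complex_of_real (p * cos (s + (- pi / 2)))" for p s :: real
  proof -
    have "cos (s + (- pi / 2)) = sin s" by (simp add: cos_diff)
    then show ?thesis by (simp add: exp_Euler cos_of_real sin_of_real algebra_simps)
  qed
  have i2: "(LINT x|M. complex_of_real (f x) + \<i> * complex_of_real (g x)) = complex_of_real (LINT x|M. f x) + \<i> * complex_of_real (LINT x|M. g x)"
    if "integrable M f" "integrable M g" for M and f g :: "'c \<Rightarrow> real"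
    using that by simp
  show ?thesis
    unfolding e by (simp only: i2[OF ci1(1) ci1(1)] i2[OF ci2(1) ci2(1)] cosc)
qed

text \<open>Coordinates are converted one at a time: those in \<open>I\<close> already appear as
  indicators, the others stay in the exponential. With \<open>I\<close> empty this is the
  hypothesis, with I = J the claim.\<close>

lemma joint_law_eq_by_char:
  fixes Z1 :: "'i \<Rightarrow> 'a \<Rightarrow> real" and Z2 :: "'i \<Rightarrow> 'b \<Rightarrow> real"
  assumes P: "prob_space M1" "prob_space M2" and J: "finite J"
    and Z1: "\<And>i. i \<in> J \<Longrightarrow> Z1 i \<in> borel_measurable M1" and Z2: "\<And>i. i \<in> J \<Longrightarrow> Z2 i \<in> borel_measurable M2"
    and ch: "\<And>u. (LINT x|M1. iexp (\<Sum>i\<in>J. u i * Z1 i x)) = (LINT x|M2. iexp (\<Sum>i\<in>J. u i * Z2 i x))"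
    and A: "\<And>i. i \<in> J \<Longrightarrow> A i \<in> sets borel"
  shows "(LINT x|M1. (\<Prod>i\<in>J. indicat_real (A i) (Z1 i x))) = (LINT x|M2. (\<Prod>i\<in>J. indicat_real (A i) (Z2 i x)))"
proof -
  have "(LINT x|M1. complex_of_real (\<Prod>i\<in>I. indicat_real (A i) (Z1 i x)) * iexp (\<Sum>i\<in>J - I. u i * Z1 i x))
      = (LINT x|M2. complex_of_real (\<Prod>i\<in>I. indicat_real (A i) (Z2 i x)) * iexp (\<Sum>i\<in>J - I. u i * Z2 i x))"
    if "I \<subseteq> J" for I u
  proof -
    have "finite I" using J that by (rule finite_subset[rotated])
    then show ?thesis using that
    proof (induction I arbitrary: u)
      case empty
      then show ?case using ch by simp
    next
      case (insert k I)
      have k: "k \<in> J" "k \<notin> I" "I \<subseteq> J" "finite I" using insert by auto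
      have JI: "J - I = insert k (J - insert k I)" using k by auto
      \<comment> \<open>The coefficients are chosen so that coordinate \<open>k\<close> has its own
        frequency \<open>t\<close> and the remaining ones a common factor \<open>r\<close>, the two
        free parameters of \<open>indicator_law_step\<close>.\<close>
      have splt: "(\<Sum>i\<in>J - I. ((\<lambda>i. r * u i)(k := t)) i * z i) = t * z k + r * (\<Sum>i\<in>J - insert k I. u i * z i)"
        for r t and z :: "'i \<Rightarrow> real"
        unfolding JI using J by (subst sum.insert) (auto simp: sum_distrib_left mult.assoc intro!: sum.cong)
      have prd: "(\<Prod>i\<in>insert k I. indicat_real (A i) (z i)) = (\<Prod>i\<in>I. indicat_real (A i) (z i)) * indicat_real (A k) (z k)" for z
        using k by (simp add: mult.commute)
      have p01: "0 \<le> (\<Prod>i\<in>I. indicat_real (A i) (z i))" "(\<Prod>i\<in>I. indicat_real (A i) (z i)) \<le> 1" for z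
        by (auto intro!: prod_nonneg prod_le_1 simp: indicator_def)
      show ?case
        unfolding prd
      proof (rule indicator_law_step[OF P])
        show "Z1 k \<in> borel_measurable M1" "Z2 k \<in> borel_measurable M2" "A k \<in> sets borel"
          using k Z1 Z2 A by auto
        show "(\<lambda>x. \<Prod>i\<in>I. indicat_real (A i) (Z1 i x)) \<in> borel_measurable M1"
          using k Z1 A by (intro borel_measurable_prod measurable_compose[OF _ borel_measurable_indicator]) auto
        show "(\<lambda>x. \<Prod>i\<in>I. indicat_real (A i) (Z2 i x)) \<in> borel_measurable M2"
          using k Z2 A by (intro borel_measurable_prod measurable_compose[OF _ borel_measurable_indicator]) auto
        show "(\<lambda>x. \<Sum>i\<in>J - insert k I. u i * Z1 i x) \<in> borel_measurable M1"
          using Z1 by (intro borel_measurable_sum borel_measurable_times) auto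
        show "(\<lambda>x. \<Sum>i\<in>J - insert k I. u i * Z2 i x) \<in> borel_measurable M2"
          using Z2 by (intro borel_measurable_sum borel_measurable_times) auto
        show "(LINT x|M1. complex_of_real (\<Prod>i\<in>I. indicat_real (A i) (Z1 i x)) * iexp (t * Z1 k x + r * (\<Sum>i\<in>J - insert k I. u i * Z1 i x)))
          = (LINT x|M2. complex_of_real (\<Prod>i\<in>I. indicat_real (A i) (Z2 i x)) * iexp (t * Z2 k x + r * (\<Sum>i\<in>J - insert k I. u i * Z2 i x)))" for t r
          using insert.IH[OF k(3), of "(\<lambda>i. r * u i)(k := t)"] unfolding splt .
      qed (rule p01)+
    qed
  qed
  from this[of J] have "complex_of_real (LINT x|M1. (\<Prod>i\<in>J. indicat_real (A i) (Z1 i x))) = complex_of_real (LINT x|M2. (\<Prod>i\<in>J. indicat_real (A i) (Z2 i x)))"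
    by (simp del: of_real_prod)
  then show ?thesis by (simp only: of_real_eq_iff)
qed

section \<open>Linear functionals of Brownian motion\<close>

text \<open>Independent increments of variance 1/N make the characteristic function a product. Its
  exponent is the discrete Ito isometry, a Riemann sum for the integral of a squared
  integrand.\<close>

lemma brownian_grid_char:
  assumes BM: "standard_brownian_motion M W" and N: "N > 0"
  shows "(LINT \<omega>|M. iexp (\<Sum>i<N. d i * (W (real (Suc i) / real N) \<omega> - W (real i / real N) \<omega>)))
    = complex_of_real (exp (- (\<Sum>i<N. (d i)\<^sup>2 / real N) / 2))"
proof -
  interpret prob_space M using BM by (simp add: standard_brownian_motion_def)
  let ?D = "\<lambda>i \<omega>. W (real (Suc i) / real N) \<omega> - W (real i / real N) \<omega>"
  let ?X = "\<lambda>i \<omega>. d i * ?D i \<omega>"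
  have ind: "indep_vars (\<lambda>_. borel) (\<lambda>i \<omega>. W (t (Suc i)) \<omega> - W (t i) \<omega>) {..<k}"
    if "(\<forall>i\<le>k. t i \<in> {0..1}) \<and> (\<forall>i<k. t i < t (Suc i))" for k :: nat and t :: "nat \<Rightarrow> real"
    using BM that by (simp add: standard_brownian_motion_def)
  have "indep_vars (\<lambda>_. borel) ?D {..<N}"
    using ind[of N "\<lambda>i. real i / real N"] N by (simp add: divide_strict_right_mono)
  then have ind': "indep_vars (\<lambda>_. borel) ?X {..<N}"
    by (rule indep_vars_compose2[where Y = "\<lambda>i x. d i * x"]) simp
  have "char (distr M borel (?X i)) 1 = complex_of_real (exp (- ((d i)\<^sup>2 / real N) / 2))" if "i < N" for i
  proof -
    let ?\<sigma> = "sqrt (1 / real N)"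
    have diff: "real (Suc i) / real N - real i / real N = 1 / real N"
      by (simp add: diff_divide_distrib[symmetric])
    have "0 \<le> real i / real N \<and> real i / real N < real (Suc i) / real N \<and> real (Suc i) / real N \<le> 1"
      using that N by (simp add: divide_strict_right_mono)
    then have "distributed M lborel (?D i) (\<lambda>x. ennreal (normal_density 0 (sqrt (real (Suc i) / real N - real i / real N)) x))"
      using BM unfolding standard_brownian_motion_def by blast
    then have dist: "distributed M lborel (?D i) (\<lambda>x. ennreal (normal_density 0 ?\<sigma> x))" by (simp only: diff)
    then have "distributed M lborel (\<lambda>\<omega>. (?D i \<omega> - 0) / ?\<sigma>) (\<lambda>x. ennreal (std_normal_density x))"
      using normal_standard_normal_convert[of ?\<sigma> "?D i" 0] N by simp
    then have std: "distr M lborel (\<lambda>\<omega>. ?D i \<omega> / ?\<sigma>) = std_normal_distribution"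
      by (simp add: distributed_def)
    have Dm: "?D i \<in> borel_measurable M"
      using dist by (simp add: distributed_def)
    then have Xm: "?X i \<in> borel_measurable M" by (intro borel_measurable_times borel_measurable_const)
    have Ym: "(\<lambda>\<omega>. ?D i \<omega> / ?\<sigma>) \<in> measurable M lborel"
      unfolding measurable_lborel1 by (intro borel_measurable_divide Dm borel_measurable_const)
    have "char (distr M borel (?X i)) 1 = (LINT \<omega>|M. iexp (d i * ?D i \<omega>))"
      unfolding char_def by (subst integral_distr[OF Xm]) auto
    also have "\<dots> = (LINT \<omega>|M. iexp ((d i * ?\<sigma>) * (?D i \<omega> / ?\<sigma>)))"
      using N by (intro Bochner_Integration.integral_cong) auto
    also have "\<dots> = char (distr M lborel (\<lambda>\<omega>. ?D i \<omega> / ?\<sigma>)) (d i * ?\<sigma>)"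
      unfolding char_def by (subst integral_distr[OF Ym]) auto
    also have "\<dots> = complex_of_real (exp (- ((d i * ?\<sigma>)\<^sup>2) / 2))"
      unfolding std char_std_normal_distribution ..
    also have "(d i * ?\<sigma>)\<^sup>2 = (d i)\<^sup>2 / real N" by (simp add: power_mult_distrib)
    finally show ?thesis .
  qed
  then have "char (distr M borel (\<lambda>\<omega>. \<Sum>i<N. ?X i \<omega>)) 1 = (\<Prod>i<N. complex_of_real (exp (- ((d i)\<^sup>2 / real N) / 2)))"
    by (subst char_distr_sum[OF ind']) (rule prod.cong, auto)
  also have "\<dots> = complex_of_real (exp (\<Sum>i<N. - ((d i)\<^sup>2 / real N) / 2))"
    by (simp add: exp_sum)
  also have "(\<Sum>i<N. - ((d i)\<^sup>2 / real N) / 2) = - (\<Sum>i<N. (d i)\<^sup>2 / real N) / 2"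
    by (simp add: sum_negf flip: sum_divide_distrib)
  finally have *: "char (distr M borel (\<lambda>\<omega>. \<Sum>i<N. ?X i \<omega>)) 1 = complex_of_real (exp (- (\<Sum>i<N. (d i)\<^sup>2 / real N) / 2))" .
  have "(\<lambda>\<omega>. \<Sum>i<N. ?X i \<omega>) \<in> borel_measurable M"
    using ind' unfolding indep_vars_def by (intro borel_measurable_sum) auto
  then have "char (distr M borel (\<lambda>\<omega>. \<Sum>i<N. ?X i \<omega>)) 1 = (LINT \<omega>|M. iexp (\<Sum>i<N. ?X i \<omega>))"
    unfolding char_def by (subst integral_distr) auto
  with * show ?thesis by simp
qed

section \<open>Riemann sums on uniform grids\<close>

definition cell :: "nat \<Rightarrow> real \<Rightarrow> nat" where
  "cell N x = nat (\<lceil>real N * x\<rceil> - 1)"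

text \<open>Cells are open on the left and closed on the right, hence the ceiling minus one; every
  point of (0,1] then belongs to exactly one of them.\<close>

lemma cell_props:
  assumes N: "N > 0" and x: "0 < x" "x \<le> 1"
  shows "cell N x < N" "real (cell N x) / real N < x" "x \<le> real (Suc (cell N x)) / real N"
    "(real i / real N < x \<and> x \<le> real (Suc i) / real N) \<longleftrightarrow> i = cell N x"
proof -
  have pos: "0 < real N * x" using N x by simp
  then have c1: "\<lceil>real N * x\<rceil> \<ge> 1" by simp
  then have c: "real (cell N x) = real_of_int \<lceil>real N * x\<rceil> - 1" by (simp add: cell_def)
  have lo: "real (cell N x) < real N * x" unfolding c by linarith
  have hi: "real N * x \<le> real (cell N x) + 1" unfolding c by linarith
  have "real N * x \<le> real N" using x by (simp add: mult_left_le)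
  with lo show "cell N x < N" by simp
  show "real (cell N x) / real N < x" using lo N by (simp add: field_simps)
  show "x \<le> real (Suc (cell N x)) / real N" using hi N by (simp add: field_simps)
  show "(real i / real N < x \<and> x \<le> real (Suc i) / real N) \<longleftrightarrow> i = cell N x"
  proof
    assume "real i / real N < x \<and> x \<le> real (Suc i) / real N"
    then have "real i < real N * x" "real N * x \<le> real i + 1" using N by (simp_all add: field_simps)
    with lo hi have "real i < real (cell N x) + 1" "real (cell N x) < real i + 1" by linarith+
    then show "i = cell N x" by linarith
  next
    assume "i = cell N x"
    with \<open>real (cell N x) / real N < x\<close> \<open>x \<le> real (Suc (cell N x)) / real N\<close>
    show "real i / real N < x \<and> x \<le> real (Suc i) / real N" by simp
  qed
qed

lemma cell_tendsto:
  assumes x: "0 < x" "x \<le> 1"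
  shows "(\<lambda>N. real (cell (Suc N) x) / real (Suc N)) \<longlonglongrightarrow> x"
    and "(\<lambda>N. real (Suc (cell (Suc N) x)) / real (Suc N)) \<longlonglongrightarrow> x"
proof -
  have l: "(\<lambda>N. x - 1 / real (Suc N)) \<longlonglongrightarrow> x - 0" and u: "(\<lambda>N. x + 1 / real (Suc N)) \<longlonglongrightarrow> x + 0"
    by (intro tendsto_intros LIMSEQ_Suc[OF lim_1_over_n])+
  have split: "real (Suc c) / real (Suc N) = real c / real (Suc N) + 1 / real (Suc N)" for c N
    by (simp add: add_divide_distrib)
  have b: "real (cell (Suc N) x) / real (Suc N) < x" "x \<le> real (cell (Suc N) x) / real (Suc N) + 1 / real (Suc N)" for N
    using cell_props(2,3)[of "Suc N" x] x split by simp_all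
  show "(\<lambda>N. real (cell (Suc N) x) / real (Suc N)) \<longlonglongrightarrow> x"
  proof (rule tendsto_sandwich[OF _ _ _ tendsto_const])
    show "(\<lambda>N. x - 1 / real (Suc N)) \<longlonglongrightarrow> x" using l by simp
    show "\<forall>\<^sub>F N in sequentially. x - 1 / real (Suc N) \<le> real (cell (Suc N) x) / real (Suc N)"
      by (intro always_eventually allI) (use b(2) in \<open>simp add: diff_le_eq\<close>)
    show "\<forall>\<^sub>F N in sequentially. real (cell (Suc N) x) / real (Suc N) \<le> x"
      by (intro always_eventually allI less_imp_le b)
  qed
  show "(\<lambda>N. real (Suc (cell (Suc N) x)) / real (Suc N)) \<longlonglongrightarrow> x"
  proof (rule tendsto_sandwich[OF _ _ tendsto_const])
    show "(\<lambda>N. x + 1 / real (Suc N)) \<longlonglongrightarrow> x" using u by simp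
    show "\<forall>\<^sub>F N in sequentially. x \<le> real (Suc (cell (Suc N) x)) / real (Suc N)"
      unfolding split by (intro always_eventually allI b)
    show "\<forall>\<^sub>F N in sequentially. real (Suc (cell (Suc N) x)) / real (Suc N) \<le> x + 1 / real (Suc N)"
      unfolding split by (intro always_eventually allI add_right_mono less_imp_le b)
  qed
qed

lemma step_sum_eq:
  assumes "N > 0"
  shows "(\<Sum>i<N. g i * indicat_real {real i / real N<..real (Suc i) / real N} x)
    = (if 0 < x \<and> x \<le> 1 then g (cell N x) else 0)"
proof (cases "0 < x \<and> x \<le> 1")
  case True
  then have "indicat_real {real i / real N<..real (Suc i) / real N} x = (if i = cell N x then 1 else 0)" for i
    using cell_props(4)[OF assms, of x i] by (auto simp: indicator_def)
  then have "(\<Sum>i<N. g i * indicat_real {real i / real N<..real (Suc i) / real N} x) = (\<Sum>i<N. if i = cell N x then g i else 0)"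
    by (intro sum.cong) auto
  also have "\<dots> = g (cell N x)" using cell_props(1)[OF assms, of x] True by (subst sum.delta) auto
  finally show ?thesis using True by simp
next
  case False
  have "indicat_real {real i / real N<..real (Suc i) / real N} x = 0" if "i < N" for i
  proof -
    have "0 \<le> real i / real N" "real (Suc i) / real N \<le> 1" using that assms by simp_all
    then have "\<not> (real i / real N < x \<and> x \<le> real (Suc i) / real N)" using False by linarith
    then show ?thesis by (simp add: indicator_def)
  qed
  with False show ?thesis by auto
qed

text \<open>Convergence along the tags is asked for at almost every point, which covers right
  endpoints for a continuous path as well as left endpoints for an integrand with jumps. Boundedness
  of \<open>g\<close> gives dominated convergence.\<close>

lemma Riemann_sum_tendsto:
  fixes h g :: "real \<Rightarrow> real"
  assumes h: "integrable lborel h" and B: "\<And>x. x \<in> {0..1} \<Longrightarrow> \<bar>g x\<bar> \<le> B"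
    and p: "\<And>N x. 0 < x \<Longrightarrow> x \<le> 1 \<Longrightarrow> p N (cell (Suc N) x) \<in> {0..1}"
    and lim: "AE x in lborel. 0 < x \<and> x \<le> 1 \<longrightarrow> (\<lambda>N. g (p N (cell (Suc N) x))) \<longlonglongrightarrow> g x"
    and gm: "(\<lambda>x. indicator {0<..1} x * g x) \<in> borel_measurable borel"
  shows "(\<lambda>N. \<Sum>i<Suc N. g (p N i) * (LINT x:{real i / real (Suc N)<..real (Suc i) / real (Suc N)}|lborel. h x))
     \<longlonglongrightarrow> (LINT x:{0<..1}|lborel. g x * h x)"
proof -
  let ?I = "\<lambda>N i. {real i / real (Suc N)<..real (Suc i) / real (Suc N)}"
  have [measurable]: "h \<in> borel_measurable borel" using h by auto
  have ih: "integrable lborel (\<lambda>x. indicat_real (?I N i) x * h x)" for N i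
    using integrable_mult_indicator[OF _ h, of "?I N i"] by simp
  have eq: "(\<Sum>i<Suc N. g (p N i) * (LINT x:?I N i|lborel. h x))
    = (LINT x|lborel. (\<Sum>i<Suc N. g (p N i) * indicat_real (?I N i) x) * h x)" for N
  proof -
    have "(LINT x|lborel. (\<Sum>i<Suc N. g (p N i) * indicat_real (?I N i) x) * h x)
      = (LINT x|lborel. (\<Sum>i<Suc N. g (p N i) * (indicat_real (?I N i) x * h x)))"
      by (simp only: sum_distrib_right mult.assoc)
    also have "\<dots> = (\<Sum>i<Suc N. LINT x|lborel. g (p N i) * (indicat_real (?I N i) x * h x))"
      by (intro Bochner_Integration.integral_sum integrable_mult_right ih)
    finally show ?thesis by (simp only: integral_mult_right_zero set_lebesgue_integral_def real_scaleR_def)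
  qed
  have "(\<lambda>N. LINT x|lborel. (\<Sum>i<Suc N. g (p N i) * indicat_real (?I N i) x) * h x)
      \<longlonglongrightarrow> (LINT x|lborel. (indicator {0<..1} x * g x) * h x)"
  proof (rule integral_dominated_convergence[where w = "\<lambda>x. \<bar>B\<bar> * \<bar>h x\<bar>"])
    show "(\<lambda>x. (indicator {0<..1} x * g x) * h x) \<in> borel_measurable lborel" using gm by measurable
    show "(\<lambda>x. (\<Sum>i<Suc N. g (p N i) * indicat_real (?I N i) x) * h x) \<in> borel_measurable lborel" for N by measurable
    show "integrable lborel (\<lambda>x. \<bar>B\<bar> * \<bar>h x\<bar>)" using h by auto
    show "AE x in lborel. (\<lambda>N. (\<Sum>i<Suc N. g (p N i) * indicat_real (?I N i) x) * h x) \<longlonglongrightarrow> (indicator {0<..1} x * g x) * h x"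
      using lim
    proof eventually_elim
      case (elim x)
      show ?case
      proof (cases "0 < x \<and> x \<le> 1")
        case True
        then have "(\<lambda>N. g (p N (cell (Suc N) x)) * h x) \<longlonglongrightarrow> g x * h x"
          using elim by (intro tendsto_intros) auto
        with True show ?thesis unfolding step_sum_eq[OF zero_less_Suc] by simp
      next
        case False
        then have "indicat_real {0<..1} x = 0" by auto
        with False show ?thesis unfolding step_sum_eq[OF zero_less_Suc] by auto
      qed
    qed
    show "AE x in lborel. norm ((\<Sum>i<Suc N. g (p N i) * indicat_real (?I N i) x) * h x) \<le> \<bar>B\<bar> * \<bar>h x\<bar>" for N
    proof (rule AE_I2)
      fix x
      have "\<bar>if 0 < x \<and> x \<le> 1 then g (p N (cell (Suc N) x)) else 0\<bar> \<le> \<bar>B\<bar>"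
        using B[OF p, of x N] by auto
      then show "norm ((\<Sum>i<Suc N. g (p N i) * indicat_real (?I N i) x) * h x) \<le> \<bar>B\<bar> * \<bar>h x\<bar>"
        unfolding step_sum_eq[OF zero_less_Suc] real_norm_def abs_mult by (intro mult_right_mono) auto
    qed
  qed
  then show ?thesis unfolding eq by (simp add: set_lebesgue_integral_def mult.assoc)
qed

lemma sum_by_parts:
  fixes f w :: "nat \<Rightarrow> real"
  shows "(\<Sum>i<N. f i * (w (Suc i) - w i)) = f N * w N - f 0 * w 0 - (\<Sum>i<N. w (Suc i) * (f (Suc i) - f i))"
  by (induction N) (simp_all add: algebra_simps)

lemma prim_0:
  assumes h: "supp_sq 0 b h"
  shows "prim h 0 = 0"
proof -
  have "AE t in lborel. indicator {..0} t *\<^sub>R h t = 0"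
    using AE_lborel_singleton[of 0]
    by eventually_elim (use supp_sqD(3)[OF h] in \<open>auto simp: indicator_def\<close>)
  then show ?thesis
    unfolding prim_def set_lebesgue_integral_def by (rule integral_eq_zero_AE)
qed

text \<open>Summation by parts moves the increments from the path to the primitive, whose increments
  are cell integrals of \<open>h\<close>. The boundary terms vanish because the primitive is 0 at
  both ends. The limit is the pathwise Wiener integral of \<open>prim h\<close>.\<close>

lemma integral_sum_tendsto:
  fixes w h :: "real \<Rightarrow> real"
  assumes w: "continuous_on {0..1} w" and h: "supp_sq 0 1 h" and tot: "integral\<^sup>L lborel h = 0"
  shows "(\<lambda>N. \<Sum>i<Suc N. prim h (real i / real (Suc N)) * (w (real (Suc i) / real (Suc N)) - w (real i / real (Suc N))))
    \<longlonglongrightarrow> - (LINT x:{0<..1}|lborel. w x * h x)"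
proof -
  have eq: "(\<Sum>i<Suc N. prim h (real i / real (Suc N)) * (w (real (Suc i) / real (Suc N)) - w (real i / real (Suc N))))
    = - (\<Sum>i<Suc N. w (real (Suc i) / real (Suc N)) * (LINT x:{real i / real (Suc N)<..real (Suc i) / real (Suc N)}|lborel. h x))" for N
  proof -
    have "prim h (real (Suc N) / real (Suc N)) = 0" using prim_eq_total[OF h, of 1] tot by simp
    moreover have "prim h (real 0 / real (Suc N)) = 0" using prim_0[OF h] by simp
    moreover have "prim h (real (Suc i) / real (Suc N)) - prim h (real i / real (Suc N))
        = (LINT x:{real i / real (Suc N)<..real (Suc i) / real (Suc N)}|lborel. h x)" for i
      by (rule prim_diff[OF supp_sq_integrable[OF h]]) (simp add: divide_right_mono)
    ultimately show ?thesis
      using sum_by_parts[of "\<lambda>i. prim h (real i / real (Suc N))" "\<lambda>i. w (real i / real (Suc N))" "Suc N"]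
      by (simp only:)
  qed
  have "bounded (w ` {0..1})" by (intro compact_imp_bounded compact_continuous_image w) auto
  then obtain B where B: "\<And>x. x \<in> {0..1} \<Longrightarrow> \<bar>w x\<bar> \<le> B"
    unfolding bounded_iff by (metis imageI real_norm_def)
  have "(\<lambda>N. \<Sum>i<Suc N. w (real (Suc i) / real (Suc N)) * (LINT x:{real i / real (Suc N)<..real (Suc i) / real (Suc N)}|lborel. h x))
    \<longlonglongrightarrow> (LINT x:{0<..1}|lborel. w x * h x)"
  proof (rule Riemann_sum_tendsto[where p = "\<lambda>N i. real (Suc i) / real (Suc N)", OF supp_sq_integrable[OF h] B])
    have c: "real (Suc (cell (Suc N) x)) / real (Suc N) \<in> {0..1}" if "0 < x" "x \<le> 1" for N x
      using cell_props(1)[of "Suc N" x] that by simp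
    then show "real (Suc (cell (Suc N) x)) / real (Suc N) \<in> {0..1}" if "0 < x" "x \<le> 1" for N x
      using that by blast
    show "AE x in lborel. 0 < x \<and> x \<le> 1 \<longrightarrow> (\<lambda>N. w (real (Suc (cell (Suc N) x)) / real (Suc N))) \<longlonglongrightarrow> w x"
    proof (intro AE_I2 impI)
      fix x :: real assume x: "0 < x \<and> x \<le> 1"
      then show "(\<lambda>N. w (real (Suc (cell (Suc N) x)) / real (Suc N))) \<longlonglongrightarrow> w x"
        using c by (intro continuous_on_tendsto_compose[OF w cell_tendsto(2)] always_eventually allI) auto
    qed
    have [measurable]: "(\<lambda>x. indicator {0..1} x *\<^sub>R w x) \<in> borel_measurable borel"
      by (rule borel_measurable_continuous_on_indicator[OF _ w]) simp
    have "(\<lambda>x. indicator {0<..1} x * (indicator {0..1} x *\<^sub>R w x)) \<in> borel_measurable borel" by measurable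
    also have "(\<lambda>x. indicator {0<..1} x * (indicator {0..1} x *\<^sub>R w x)) = (\<lambda>x. indicator {0<..1} x * w x)"
      by (auto simp: indicator_def fun_eq_iff)
    finally show "(\<lambda>x. indicator {0<..1} x * w x) \<in> borel_measurable borel" .
  qed
  from tendsto_minus[OF this] show ?thesis unfolding eq .
qed

text \<open>Evaluation at \<open>t\<close> is the integral of the indicator of {..<t} against the
  increments: for positive \<open>t\<close> the sum telescopes to the value at the right end of the
  cell containing \<open>t\<close>.\<close>

lemma evaluation_sum_tendsto:
  fixes w :: "real \<Rightarrow> real"
  assumes w: "continuous_on {0..1} w" and w0: "w 0 = 0" and t: "t \<in> {0..1}"
  shows "(\<lambda>N. \<Sum>i<Suc N. indicator {..<t} (real i / real (Suc N)) * (w (real (Suc i) / real (Suc N)) - w (real i / real (Suc N))))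
    \<longlonglongrightarrow> w t"
proof (cases "t = 0")
  case True
  then have "(\<Sum>i<Suc N. indicator {..<t} (real i / real (Suc N)) * (w (real (Suc i) / real (Suc N)) - w (real i / real (Suc N)))) = 0" for N
    by (intro sum.neutral) (auto simp: indicator_def divide_less_0_iff)
  with True w0 show ?thesis by (simp only: tendsto_const)
next
  case False
  with t have t01: "0 < t" "t \<le> 1" by auto
  have eq: "(\<Sum>i<Suc N. indicator {..<t} (real i / real (Suc N)) * (w (real (Suc i) / real (Suc N)) - w (real i / real (Suc N))))
    = w (real (Suc (cell (Suc N) t)) / real (Suc N))" for N
  proof -
    let ?c = "cell (Suc N) t"
    note cp = cell_props[OF zero_less_Suc t01, of N]
    have iff: "real i / real (Suc N) < t \<longleftrightarrow> i < Suc ?c" for i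
    proof
      assume "i < Suc ?c"
      then have "real i / real (Suc N) \<le> real ?c / real (Suc N)" by (intro divide_right_mono) auto
      with cp(2) show "real i / real (Suc N) < t" by linarith
    next
      assume *: "real i / real (Suc N) < t"
      show "i < Suc ?c"
      proof (rule ccontr)
        assume "\<not> i < Suc ?c"
        then have "real (Suc ?c) / real (Suc N) \<le> real i / real (Suc N)" by (intro divide_right_mono) auto
        with cp(3) * show False by linarith
      qed
    qed
    have "(\<Sum>i<Suc N. indicator {..<t} (real i / real (Suc N)) * (w (real (Suc i) / real (Suc N)) - w (real i / real (Suc N))))
      = (\<Sum>i<Suc ?c. w (real (Suc i) / real (Suc N)) - w (real i / real (Suc N)))"
    proof (rule sum.mono_neutral_cong_right)
      show "{..<Suc ?c} \<subseteq> {..<Suc N}" using cp(1) by auto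
      show "\<forall>i\<in>{..<Suc N} - {..<Suc ?c}. indicator {..<t} (real i / real (Suc N)) * (w (real (Suc i) / real (Suc N)) - w (real i / real (Suc N))) = 0"
        using iff by (simp add: indicator_def del: of_nat_Suc)
      show "indicator {..<t} (real i / real (Suc N)) * (w (real (Suc i) / real (Suc N)) - w (real i / real (Suc N)))
        = w (real (Suc i) / real (Suc N)) - w (real i / real (Suc N))" if "i \<in> {..<Suc ?c}" for i
        using iff[of i] that by (simp add: indicator_def del: of_nat_Suc)
    qed simp
    also have "\<dots> = w (real (Suc ?c) / real (Suc N)) - w (real 0 / real (Suc N))"
      by (rule sum_lessThan_telescope[of "\<lambda>i. w (real i / real (Suc N))"])
    finally show ?thesis using w0 by simp
  qed
  have "real (Suc (cell (Suc N) t)) / real (Suc N) \<in> {0..1}" for N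
    using cell_props(1)[of "Suc N" t] t01 by simp
  then show ?thesis
    unfolding eq using t
    by (intro continuous_on_tendsto_compose[OF w cell_tendsto(2)[OF t01]] always_eventually allI) auto
qed

text \<open>\<open>L\<close> is the Wiener integral of \<open>q\<close>, with point evaluations and
  the integrated part treated together. Grid sums converge to it path by path, their characteristic
  functions are explicit, and the limiting exponent is the Ito isometry.\<close>

lemma brownian_functional:
  fixes u h :: "real \<Rightarrow> real"
  assumes BM: "standard_brownian_motion M W" and J: "finite J" "J \<subseteq> {0..1}"
    and h: "supp_sq 0 1 h" and tot: "integral\<^sup>L lborel h = 0"
  defines "L \<equiv> \<lambda>\<omega>. (\<Sum>t\<in>J. u t * W t \<omega>) - (LINT x:{0<..1}|lborel. W x \<omega> * h x)"
    and "q \<equiv> \<lambda>x. (\<Sum>t\<in>J. u t * indicator {..<t} x) + prim h x"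
  shows "L \<in> borel_measurable M"
    and "(LINT \<omega>|M. iexp (L \<omega>)) = complex_of_real (exp (- (LINT x:{0<..1}|lborel. (q x)\<^sup>2) / 2))"
proof -
  interpret prob_space M using BM by (simp add: standard_brownian_motion_def)
  let ?D = "\<lambda>N i \<omega>. W (real (Suc i) / real (Suc N)) \<omega> - W (real i / real (Suc N)) \<omega>"
  define LN where "LN N \<omega> = (\<Sum>i<Suc N. q (real i / real (Suc N)) * ?D N i \<omega>)" for N \<omega>
  have lim: "(\<lambda>N. LN N \<omega>) \<longlonglongrightarrow> L \<omega>" if "\<omega> \<in> space M" for \<omega>
  proof -
    have w: "continuous_on {0..1} (\<lambda>t. W t \<omega>)" "W 0 \<omega> = 0"
      using BM that by (auto simp: standard_brownian_motion_def)
    have "LN N \<omega> = (\<Sum>t\<in>J. u t * (\<Sum>i<Suc N. indicator {..<t} (real i / real (Suc N)) * ?D N i \<omega>))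
        + (\<Sum>i<Suc N. prim h (real i / real (Suc N)) * ?D N i \<omega>)" for N
    proof -
      have "LN N \<omega> = (\<Sum>i<Suc N. \<Sum>t\<in>J. u t * (indicator {..<t} (real i / real (Suc N)) * ?D N i \<omega>))
          + (\<Sum>i<Suc N. prim h (real i / real (Suc N)) * ?D N i \<omega>)"
        unfolding LN_def q_def by (simp only: distrib_right sum.distrib sum_distrib_right mult.assoc)
      then show ?thesis by (subst (asm) sum.swap) (simp only: sum_distrib_left)
    qed
    moreover have "(\<lambda>N. (\<Sum>t\<in>J. u t * (\<Sum>i<Suc N. indicator {..<t} (real i / real (Suc N)) * ?D N i \<omega>))
        + (\<Sum>i<Suc N. prim h (real i / real (Suc N)) * ?D N i \<omega>)) \<longlonglongrightarrow> (\<Sum>t\<in>J. u t * W t \<omega>) + - (LINT x:{0<..1}|lborel. W x \<omega> * h x)"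
      using J(2) by (intro tendsto_add tendsto_sum tendsto_mult tendsto_const evaluation_sum_tendsto integral_sum_tendsto w h tot) auto
    ultimately show ?thesis by (simp add: L_def)
  qed
  have W_measurable: "W t \<in> borel_measurable M" if "t \<in> {0..1}" for t
    using BM that by (auto simp: standard_brownian_motion_def)
  have LNm [measurable]: "LN N \<in> borel_measurable M" for N
    unfolding LN_def by (intro borel_measurable_sum borel_measurable_times borel_measurable_diff W_measurable borel_measurable_const) auto
  show Lm [measurable]: "L \<in> borel_measurable M"
    by (rule borel_measurable_LIMSEQ_metric[OF LNm lim])
  have l1: "(\<lambda>N. LINT \<omega>|M. iexp (LN N \<omega>)) \<longlonglongrightarrow> (LINT \<omega>|M. iexp (L \<omega>))"
  proof (rule integral_dominated_convergence[where w = "\<lambda>_. 1"])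
    show "AE \<omega> in M. (\<lambda>N. iexp (LN N \<omega>)) \<longlonglongrightarrow> iexp (L \<omega>)"
      by (rule AE_I2) (intro tendsto_intros lim)
  qed auto
  have [measurable]: "q \<in> borel_measurable borel"
    unfolding q_def using borel_measurable_continuous_onI[OF continuous_prim[OF h]] by measurable
  \<comment> \<open>The jumps of the indicators sit at points of \<open>J\<close>, a finite and
    hence null set.\<close>
  have qc: "isCont q x" if "x \<notin> J" for x
    unfolding q_def
  proof (intro continuous_intros)
    fix t assume "t \<in> J"
    with that have "x \<noteq> t" by auto
    then have "\<forall>\<^sub>F y in nhds x. indicat_real {..<t} y = indicator {..<t} x"
    proof (cases "x < t")
      case True
      have "\<forall>\<^sub>F y in nhds x. y \<in> {..<t}" by (intro eventually_nhds_in_open) (use True in auto)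
      then show ?thesis by eventually_elim (use True in auto)
    next
      case False
      have "\<forall>\<^sub>F y in nhds x. y \<in> {t<..}" by (intro eventually_nhds_in_open) (use False \<open>x \<noteq> t\<close> in auto)
      then show ?thesis by eventually_elim (use False in auto)
    qed
    then show "isCont (indicat_real {..<t}) x"
      using isCont_cong[of "indicat_real {..<t}" "\<lambda>_. indicator {..<t} x" x] by simp
  next
    show "isCont (prim h) x" using continuous_prim[OF h, of UNIV] by (simp add: continuous_on_eq_continuous_at)
  qed
  \<comment> \<open>The factor 2 is the constant b - a + 1 of \<open>prim_square_bound\<close> on
    [0,1].\<close>
  define B where "B = (\<Sum>t\<in>J. \<bar>u t\<bar>) + sqrt (2 * (LINT t|lborel. (h t)\<^sup>2))"
  have qB: "\<bar>(q x)\<^sup>2\<bar> \<le> B\<^sup>2" if "x \<in> {0..1}" for x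
  proof -
    have "\<bar>prim h x\<bar> \<le> sqrt (2 * (LINT t|lborel. (h t)\<^sup>2))"
      using real_sqrt_le_mono[OF prim_square_bound[OF h that]] by simp
    moreover have "\<bar>\<Sum>t\<in>J. u t * indicator {..<t} x\<bar> \<le> (\<Sum>t\<in>J. \<bar>u t\<bar>)"
      by (rule order_trans[OF sum_abs]) (intro sum_mono, auto simp: indicator_def)
    ultimately have "\<bar>q x\<bar> \<le> B" unfolding q_def B_def by linarith
    then have "\<bar>q x\<bar>\<^sup>2 \<le> B\<^sup>2" by (intro power_mono) auto
    then show ?thesis by simp
  qed
  \<comment> \<open>With the indicator of [0,1] as weight function every cell integral is the mesh
    1/(N + 1), so this is the limit of ordinary Riemann sums.\<close>
  have l2: "(\<lambda>N. \<Sum>i<Suc N. (q (real i / real (Suc N)))\<^sup>2 * (LINT x:{real i / real (Suc N)<..real (Suc i) / real (Suc N)}|lborel. indicat_real {0..1} x))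
     \<longlonglongrightarrow> (LINT x:{0<..1}|lborel. (q x)\<^sup>2 * indicat_real {0..1} x)"
  proof (rule Riemann_sum_tendsto[where p = "\<lambda>N i. real i / real (Suc N)" and B = "B\<^sup>2"])
    show "integrable lborel (indicat_real {0..1::real})"
      by (rule integrable_real_indicator) (auto simp: emeasure_lborel_Icc_eq)
    show "real (cell (Suc N) x) / real (Suc N) \<in> {0..1}" if "0 < x" "x \<le> 1" for N x
      using cell_props(1)[of "Suc N" x] that by simp
    have "AE x in lborel. x \<notin> J" using J(1) by (intro AE_not_in finite_imp_null_set_lborel)
    then show "AE x in lborel. 0 < x \<and> x \<le> 1 \<longrightarrow> (\<lambda>N. (q (real (cell (Suc N) x) / real (Suc N)))\<^sup>2) \<longlonglongrightarrow> (q x)\<^sup>2"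
    proof eventually_elim
      case (elim x)
      show ?case
      proof
        assume "0 < x \<and> x \<le> 1"
        then show "(\<lambda>N. (q (real (cell (Suc N) x) / real (Suc N)))\<^sup>2) \<longlonglongrightarrow> (q x)\<^sup>2"
          by (intro tendsto_power isCont_tendsto_compose[OF qc[OF elim]] cell_tendsto(1)) auto
      qed
    qed
  qed (use qB in auto)
  have "(LINT x:{0<..1}|lborel. (q x)\<^sup>2 * indicat_real {0..1} x) = (LINT x:{0<..1}|lborel. (q x)\<^sup>2)"
    unfolding set_lebesgue_integral_def by (intro Bochner_Integration.integral_cong) (auto simp: indicator_def)
  moreover have "(q (real i / real (Suc N)))\<^sup>2 * (LINT x:{real i / real (Suc N)<..real (Suc i) / real (Suc N)}|lborel. indicat_real {0..1} x)
      = (q (real i / real (Suc N)))\<^sup>2 / real (Suc N)" if "i < Suc N" for i N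
  proof -
    have le: "0 \<le> real i / real (Suc N)" "real i / real (Suc N) \<le> real (Suc i) / real (Suc N)" "real (Suc i) / real (Suc N) \<le> 1"
      using that by (simp_all add: divide_right_mono)
    have "(LINT x:{real i / real (Suc N)<..real (Suc i) / real (Suc N)}|lborel. indicat_real {0..1} x)
       = (LINT x|lborel. indicat_real {real i / real (Suc N)<..real (Suc i) / real (Suc N)} x)"
      unfolding set_lebesgue_integral_def
    proof (intro Bochner_Integration.integral_cong refl)
      show "indicat_real {real i / real (Suc N)<..real (Suc i) / real (Suc N)} x *\<^sub>R indicat_real {0..1} x
        = indicat_real {real i / real (Suc N)<..real (Suc i) / real (Suc N)} x" for x
      proof (cases "real i / real (Suc N) < x \<and> x \<le> real (Suc i) / real (Suc N)")
        case True
        then have "0 \<le> x \<and> x \<le> 1" using le by linarith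
        with True show ?thesis by (simp add: indicator_def del: of_nat_Suc)
      qed (auto simp: indicator_def simp del: of_nat_Suc)
    qed
    also have "\<dots> = real (Suc i) / real (Suc N) - real i / real (Suc N)"
      using le(2) by simp
    also have "\<dots> = 1 / real (Suc N)" by (simp add: diff_divide_distrib[symmetric])
    finally show ?thesis by simp
  qed
  ultimately have "(\<lambda>N. \<Sum>i<Suc N. (q (real i / real (Suc N)))\<^sup>2 / real (Suc N)) \<longlonglongrightarrow> (LINT x:{0<..1}|lborel. (q x)\<^sup>2)"
    using l2 by (simp del: of_nat_Suc sum.lessThan_Suc cong: sum.cong_simp)
  then have "(\<lambda>N. complex_of_real (exp (- (\<Sum>i<Suc N. (q (real i / real (Suc N)))\<^sup>2 / real (Suc N)) / 2)))
      \<longlonglongrightarrow> complex_of_real (exp (- (LINT x:{0<..1}|lborel. (q x)\<^sup>2) / 2))"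
    by (intro tendsto_of_real tendsto_exp tendsto_divide tendsto_minus tendsto_const) auto
  moreover have "complex_of_real (exp (- (\<Sum>i<Suc N. (q (real i / real (Suc N)))\<^sup>2 / real (Suc N)) / 2)) = (LINT \<omega>|M. iexp (LN N \<omega>))" for N
    unfolding LN_def using brownian_grid_char[OF BM, of "Suc N" "\<lambda>i. q (real i / real (Suc N))"] by (simp only: zero_less_Suc)
  ultimately show "(LINT \<omega>|M. iexp (L \<omega>)) = complex_of_real (exp (- (LINT x:{0<..1}|lborel. (q x)\<^sup>2) / 2))"
    using LIMSEQ_unique[OF l1] by simp
qed

section \<open>An orthonormal family inside the Sobolev ball\<close>

lemma supp_sq_zero: "supp_sq a b (\<lambda>x. 0)"
  by (simp add: supp_sq_def)

lemma prim_zero: "prim (\<lambda>x. 0) = (\<lambda>x. 0)"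
  by (simp add: prim_def[abs_def] set_lebesgue_integral_def)

lemma supp_sq_sum:
  assumes "finite I" "\<And>i. i \<in> I \<Longrightarrow> supp_sq a b (h i)"
  shows "supp_sq a b (\<lambda>x. \<Sum>i\<in>I. c i * h i x)"
  using assms
proof (induction I rule: finite_induct)
  case (insert i I)
  then show ?case using supp_sq_lincomb[of a b "h i" "\<lambda>x. \<Sum>i\<in>I. c i * h i x" "c i" 1] by simp
qed (simp add: supp_sq_zero)

lemma prim_sum:
  assumes "finite I" "\<And>i. i \<in> I \<Longrightarrow> supp_sq a b (h i)"
  shows "prim (\<lambda>x. \<Sum>i\<in>I. c i * h i x) x = (\<Sum>i\<in>I. c i * prim (h i) x)"
  using assms
proof (induction I rule: finite_induct)
  case (insert i I)
  have "integrable lborel (h i)" "integrable lborel (\<lambda>x. \<Sum>i\<in>I. c i * h i x)"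
    using insert.hyps insert.prems by (auto intro!: supp_sq_integrable[of a b] supp_sq_sum)
  then show ?case using insert prim_lincomb[of "h i" "\<lambda>x. \<Sum>i\<in>I. c i * h i x" "c i" 1 x] by simp
qed (simp add: prim_zero)

lemma chain_sum:
  assumes I: "finite I" and G: "\<And>i. i \<in> I \<Longrightarrow> chain \<beta> a b (G i)"
  shows "chain \<beta> a b (\<lambda>k x. \<Sum>i\<in>I. c i * G i k x)"
  unfolding chain_def
proof (intro conjI allI impI)
  show "supp_sq a b (\<lambda>x. \<Sum>i\<in>I. c i * G i k x)" if "k \<le> \<beta>" for k
    using G that unfolding chain_def by (intro supp_sq_sum I) blast
  show "(\<lambda>x. \<Sum>i\<in>I. c i * G i k x) = prim (\<lambda>x. \<Sum>i\<in>I. c i * G i (Suc k) x)" if "k < \<beta>" for k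
  proof
    fix x
    have "supp_sq a b (G i (Suc k))" if "i \<in> I" for i
      using G[OF that] \<open>k < \<beta>\<close> unfolding chain_def by (meson Suc_leI)
    then have "prim (\<lambda>x. \<Sum>i\<in>I. c i * G i (Suc k) x) x = (\<Sum>i\<in>I. c i * prim (G i (Suc k)) x)"
      by (rule prim_sum[OF I])
    also have "\<dots> = (\<Sum>i\<in>I. c i * G i k x)"
    proof (rule sum.cong[OF refl])
      fix i assume "i \<in> I"
      then have "G i k = prim (G i (Suc k))" using G that unfolding chain_def by blast
      then show "c i * prim (G i (Suc k)) x = c i * G i k x" by metis
    qed
    finally show "(\<Sum>i\<in>I. c i * G i k x) = prim (\<lambda>x. \<Sum>i\<in>I. c i * G i (Suc k) x) x" by (rule sym)
  qed
qed

lemma supp_sq_affine: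
  assumes h: "supp_sq a b h" and s: "s > 0" and sub: "\<And>x. s * x - c \<in> {a..b} \<Longrightarrow> x \<in> {p..q}"
  shows "supp_sq p q (\<lambda>x. r * h (s * x - c))"
    and "(LINT x|lborel. (r * h (s * x - c))\<^sup>2) = r\<^sup>2 / s * (LINT x|lborel. (h x)\<^sup>2)"
    and "prim (\<lambda>x. r * h (s * x - c)) x = r / s * prim h (s * x - c)"
proof -
  have [measurable]: "h \<in> borel_measurable borel" by (rule supp_sqD[OF h])
  have i: "integrable lborel (\<lambda>x. (h (s * x - c))\<^sup>2)"
    using lborel_integrable_real_affine[OF supp_sqD(2)[OF h], of s "- c"] s by simp
  have "h (s * x - c) = 0" if "x \<notin> {p..q}" for x
    using sub[of x] that supp_sqD(3)[OF h] by blast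
  then show "supp_sq p q (\<lambda>x. r * h (s * x - c))"
    using i by (simp add: supp_sq_def power_mult_distrib)
  have "(LINT x|lborel. (h x)\<^sup>2) = s * (LINT x|lborel. (h (s * x - c))\<^sup>2)"
    using lborel_integral_real_affine[of s "\<lambda>x. (h x)\<^sup>2" "- c"] s by simp
  then show "(LINT x|lborel. (r * h (s * x - c))\<^sup>2) = r\<^sup>2 / s * (LINT x|lborel. (h x)\<^sup>2)"
    using s by (simp add: power_mult_distrib)
  have "prim h (s * x - c) = s * (LINT t|lborel. indicator {..s * x - c} (- c + s * t) * h (- c + s * t))"
    using lborel_integral_real_affine[of s "\<lambda>t. indicator {..s * x - c} t * h t" "- c"] s
    by (simp add: prim_def set_lebesgue_integral_def)
  also have "(\<lambda>t. indicat_real {..s * x - c} (- c + s * t) * h (- c + s * t)) = (\<lambda>t. indicator {..x} t * h (s * t - c))"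
    using s by (auto simp: indicator_def fun_eq_iff)
  finally show "prim (\<lambda>x. r * h (s * x - c)) x = r / s * prim h (s * x - c)"
    using s by (simp add: prim_def set_lebesgue_integral_def mult.left_commute)
qed

text \<open>The chain rule: each differentiation contributes a factor \<open>s\<close>, while
  \<open>r\<close> is left free for the normalisation.\<close>

lemma chain_affine:
  assumes G: "chain \<beta> a b G" and s: "s > 0" and sub: "\<And>x. s * x - c \<in> {a..b} \<Longrightarrow> x \<in> {p..q}"
  shows "chain \<beta> p q (\<lambda>k x. r * s ^ k * G k (s * x - c))"
  unfolding chain_def
proof (intro conjI allI impI)
  show "supp_sq p q (\<lambda>x. r * s ^ k * G k (s * x - c))" if "k \<le> \<beta>" for k
    using G that unfolding chain_def by (intro supp_sq_affine(1)[OF _ s sub]) blast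
  show "(\<lambda>x. r * s ^ k * G k (s * x - c)) = prim (\<lambda>x. r * s ^ Suc k * G (Suc k) (s * x - c))" if "k < \<beta>" for k
  proof
    fix x
    have "supp_sq a b (G (Suc k))" and e: "G k = prim (G (Suc k))"
      using G that unfolding chain_def by (meson Suc_leI, blast)
    from supp_sq_affine(3)[where r = "r * s ^ Suc k" and c = c and x = x, OF this(1) s sub]
    show "r * s ^ k * G k (s * x - c) = prim (\<lambda>x. r * s ^ Suc k * G (Suc k) (s * x - c)) x"
      using s unfolding e by simp
  qed
qed

text \<open>With T the squared Euclidean norm of \<theta> and lam the squared norm of the top
  derivative of the kernel, the squared Sobolev norm is T (1 + m^(2\<beta>) lam), at most T
  m^(2\<beta>) (1 + lam) because m \<ge> 1, and hence at most R^2.\<close>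

lemma sobolev_ball_basis:
  fixes m \<beta> :: nat and R :: real
  assumes m: "m > 0" and \<beta>: "\<beta> > 0" and R: "R > 0"
  obtains \<phi> h :: "nat \<Rightarrow> real \<Rightarrow> real"
  where "\<And>i. i \<in> {1..m} \<Longrightarrow> supp_sq 0 1 (h i)" "\<And>i. i \<in> {1..m} \<Longrightarrow> \<phi> i = prim (h i)"
    "\<And>i. i \<in> {1..m} \<Longrightarrow> supp_sq 0 1 (\<phi> i)"
    "\<And>i j. i \<in> {1..m} \<Longrightarrow> j \<in> {1..m} \<Longrightarrow> (LINT x|lborel. \<phi> i x * \<phi> j x) = (if i = j then 1 else 0)"
    "\<And>\<theta>. \<theta> \<in> Theta_ball m \<beta> R \<Longrightarrow> (\<lambda>x. \<Sum>i\<in>{1..m}. \<theta> i * \<phi> i x) \<in> sobolev_ball \<beta> R"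
proof -
  obtain G where G: "chain \<beta> (-1/2) (1/2) G" and G0: "(LINT x|lborel. (G 0 x)\<^sup>2) = 1"
    and \<Gamma>: "sqrt (1 + (LINT x|lborel. (G \<beta> x)\<^sup>2)) \<le> Gamma_const \<beta>"
    using Gamma_const_attained[OF \<beta>] by blast
  define lam where "lam = (LINT x|lborel. (G \<beta> x)\<^sup>2)"
  have lam0: "lam \<ge> 0" by (simp add: lam_def)
  have Gs: "supp_sq (-1/2) (1/2) (G k)" if "k \<le> \<beta>" for k using G that unfolding chain_def by blast
  define s where "s = real m"
  have s: "s > 0" "s \<ge> 1" using m by (simp_all add: s_def)
  \<comment> \<open>The factor \<open>sqrt s\<close> restores the unit norm after compression by
    \<open>s\<close>, and the shift centres the i-th copy at the midpoint of {(i - 1) / s..i /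
    s}.\<close>
  define \<psi> where "\<psi> i k x = sqrt s * s ^ k * G k (s * x - (real i - 1/2))" for i k x
  have sub': "x \<in> {(real i - 1) / s..real i / s}" if "s * x - (real i - 1/2) \<in> {-1/2..1/2}" for x i
    using that s by (simp add: field_simps)
  have sub: "x \<in> {0..1}" if "s * x - (real i - 1/2) \<in> {-1/2..1/2}" "i \<in> {1..m}" for x i
  proof -
    have "0 \<le> (real i - 1) / s" "real i / s \<le> 1" using that(2) s by (simp_all add: s_def)
    then show ?thesis using sub'[OF that(1)] by simp
  qed
  have ch: "chain \<beta> 0 1 (\<psi> i)" if "i \<in> {1..m}" for i
    unfolding \<psi>_def using that by (intro chain_affine[OF G s(1)] sub)
  have \<psi>s: "supp_sq 0 1 (\<psi> i k)" if "i \<in> {1..m}" "k \<le> \<beta>" for i k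
    using ch[OF that(1)] that(2) unfolding chain_def by blast
  have \<psi>2: "(LINT x|lborel. (\<psi> i k x)\<^sup>2) = (s ^ k)\<^sup>2 * (LINT x|lborel. (G k x)\<^sup>2)" if "i \<in> {1..m}" "k \<le> \<beta>" for i k
    unfolding \<psi>_def using s supp_sq_affine(2)[where r = "sqrt s * s ^ k" and c = "real i - 1/2", OF Gs[OF that(2)] s(1) sub[OF _ that(1)]]
    by (simp add: power_mult_distrib)
  \<comment> \<open>Neighbouring closed supports share grid points, where top derivatives need not
    vanish; off this countable set all products of different members are zero.\<close>
  have "countable (range (\<lambda>j::nat. real j / s))" by simp
  then have "AE x in lborel. x \<notin> range (\<lambda>j::nat. real j / s)"
    by (intro AE_not_in countable_imp_null_set_lborel)
  then have orth: "AE x in lborel. \<forall>k i j. k \<le> \<beta> \<longrightarrow> i \<in> {1..m} \<longrightarrow> j \<in> {1..m} \<longrightarrow> i \<noteq> j \<longrightarrow> \<psi> i k x * \<psi> j k x = 0"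
  proof eventually_elim
    case (elim x)
    show ?case
    proof (intro allI impI, rule ccontr)
      fix k i j assume k: "k \<le> \<beta>" and ij: "i \<in> {1..m}" "j \<in> {1..m}" "i \<noteq> j" and nz: "\<psi> i k x * \<psi> j k x \<noteq> 0"
      then have "G k (s * x - (real i - 1/2)) \<noteq> 0" "G k (s * x - (real j - 1/2)) \<noteq> 0" by (auto simp: \<psi>_def)
      then have "s * x - (real i - 1/2) \<in> {-1/2..1/2}" "s * x - (real j - 1/2) \<in> {-1/2..1/2}"
        using supp_sqD(3)[OF Gs[OF k]] by blast+
      then have b: "real i - 1 \<le> s * x" "s * x \<le> real i" "real j - 1 \<le> s * x" "s * x \<le> real j" by auto
      have ne: "s * x \<noteq> real l" for l
      proof
        assume "s * x = real l"
        then have "x = real l / s" using s by (simp add: field_simps)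
        then show False using elim by blast
      qed
      have "s * x < real i" "s * x < real j" using b ne[of i] ne[of j] by linarith+
      then have "real i < real j + 1" "real j < real i + 1" using b by linarith+
      then have "i = j" by linarith
      with ij show False by simp
    qed
  qed
  have mm: "(\<lambda>x. \<psi> i k x) \<in> borel_measurable borel" if "i \<in> {1..m}" "k \<le> \<beta>" for i k
    using \<psi>s[OF that] by (rule supp_sqD)
  have ortho: "(LINT x|lborel. \<psi> i 0 x * \<psi> j 0 x) = (if i = j then 1 else 0)" if ij: "i \<in> {1..m}" "j \<in> {1..m}" for i j
  proof (cases "i = j")
    case True
    then show ?thesis using \<psi>2[OF ij(1), of 0] G0 by (simp add: power2_eq_square)
  next
    case False
    have "AE x in lborel. \<psi> i 0 x * \<psi> j 0 x = 0"
      using orth by eventually_elim (use ij False in blast)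
    then have "(LINT x|lborel. \<psi> i 0 x * \<psi> j 0 x) = 0" by (rule integral_eq_zero_AE)
    then show ?thesis using False by simp
  qed
  have L2F: "(LINT x|lborel. (\<Sum>i\<in>{1..m}. \<theta> i * \<psi> i k x)\<^sup>2) = (\<Sum>i\<in>{1..m}. (\<theta> i)\<^sup>2) * ((s ^ k)\<^sup>2 * (LINT x|lborel. (G k x)\<^sup>2))"
    if k: "k \<le> \<beta>" for k \<theta>
  proof -
    have "(LINT x|lborel. (\<Sum>i\<in>{1..m}. \<theta> i * \<psi> i k x)\<^sup>2) = (LINT x|lborel. (\<Sum>i\<in>{1..m}. (\<theta> i)\<^sup>2 * (\<psi> i k x)\<^sup>2))"
    proof (rule integral_cong_AE)
      show "(\<lambda>x. (\<Sum>i\<in>{1..m}. \<theta> i * \<psi> i k x)\<^sup>2) \<in> borel_measurable lborel"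
        using mm k by (auto intro!: borel_measurable_power borel_measurable_sum borel_measurable_times)
      show "(\<lambda>x. \<Sum>i\<in>{1..m}. (\<theta> i)\<^sup>2 * (\<psi> i k x)\<^sup>2) \<in> borel_measurable lborel"
        using mm k by (auto intro!: borel_measurable_power borel_measurable_sum borel_measurable_times)
      show "AE x in lborel. (\<Sum>i\<in>{1..m}. \<theta> i * \<psi> i k x)\<^sup>2 = (\<Sum>i\<in>{1..m}. (\<theta> i)\<^sup>2 * (\<psi> i k x)\<^sup>2)"
        using orth
      proof eventually_elim
        case (elim x)
        have "(\<Sum>i\<in>{1..m}. \<theta> i * \<psi> i k x)\<^sup>2 = (\<Sum>i\<in>{1..m}. \<Sum>j\<in>{1..m}. (\<theta> i * \<psi> i k x) * (\<theta> j * \<psi> j k x))"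
          by (simp only: power2_eq_square sum_product)
        also have "\<dots> = (\<Sum>i\<in>{1..m}. \<Sum>j\<in>{1..m}. if j = i then (\<theta> i)\<^sup>2 * (\<psi> i k x)\<^sup>2 else 0)"
        proof (intro sum.cong refl)
          fix i j assume ij: "i \<in> {1..m}" "j \<in> {1..m}"
          show "(\<theta> i * \<psi> i k x) * (\<theta> j * \<psi> j k x) = (if j = i then (\<theta> i)\<^sup>2 * (\<psi> i k x)\<^sup>2 else 0)"
          proof (cases "j = i")
            case False
            then have "\<psi> i k x * \<psi> j k x = 0" using elim ij k by blast
            then show ?thesis using False by auto
          qed (simp add: power2_eq_square)
        qed
        also have "\<dots> = (\<Sum>i\<in>{1..m}. (\<theta> i)\<^sup>2 * (\<psi> i k x)\<^sup>2)"
          by (intro sum.cong refl) (simp add: sum.delta)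
        finally show ?case .
      qed
    qed
    also have "\<dots> = (\<Sum>i\<in>{1..m}. (\<theta> i)\<^sup>2 * (LINT x|lborel. (\<psi> i k x)\<^sup>2))"
      using \<psi>s[OF _ k] supp_sqD(2) by (subst Bochner_Integration.integral_sum) (auto intro: integrable_mult_right)
    also have "\<dots> = (\<Sum>i\<in>{1..m}. (\<theta> i)\<^sup>2 * ((s ^ k)\<^sup>2 * (LINT x|lborel. (G k x)\<^sup>2)))"
      by (intro sum.cong refl) (simp add: \<psi>2 k)
    finally show ?thesis by (simp only: sum_distrib_right)
  qed
  have ball: "(\<lambda>x. \<Sum>i\<in>{1..m}. \<theta> i * \<psi> i 0 x) \<in> sobolev_ball \<beta> R" if \<theta>: "\<theta> \<in> Theta_ball m \<beta> R" for \<theta>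
  proof -
    let ?F = "\<lambda>k x. \<Sum>i\<in>{1..m}. \<theta> i * \<psi> i k x"
    have F: "chain \<beta> 0 1 ?F" by (rule chain_sum[OF _ ch]) auto
    define T where "T = (\<Sum>i\<in>{1..m}. (\<theta> i)\<^sup>2)"
    have T0: "T \<ge> 0" by (simp add: T_def sum_nonneg)
    have \<Gamma>0: "Gamma_const \<beta> > 0"
    proof -
      have "1 \<le> sqrt (1 + lam)" using lam0 by simp
      then show ?thesis using \<Gamma> unfolding lam_def by linarith
    qed
    have "sqrt T \<le> R / (Gamma_const \<beta> * s ^ \<beta>)"
      using \<theta> by (simp add: Theta_ball_def L2_set_def T_def s_def)
    then have "sqrt T * (Gamma_const \<beta> * s ^ \<beta>) \<le> R"
      using \<Gamma>0 s by (simp add: pos_le_divide_eq)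
    then have "(sqrt T * (Gamma_const \<beta> * s ^ \<beta>))\<^sup>2 \<le> R\<^sup>2"
      using \<Gamma>0 s T0 by (intro power_mono mult_nonneg_nonneg) auto
    then have 1: "T * ((Gamma_const \<beta>)\<^sup>2 * (s ^ \<beta>)\<^sup>2) \<le> R\<^sup>2"
      using T0 by (simp add: power_mult_distrib)
    have "(sqrt (1 + lam))\<^sup>2 \<le> (Gamma_const \<beta>)\<^sup>2"
      using \<Gamma> lam0 by (intro power_mono) (auto simp: lam_def)
    then have 2: "1 + lam \<le> (Gamma_const \<beta>)\<^sup>2" using lam0 by simp
    have s1: "1 \<le> (s ^ \<beta>)\<^sup>2" using s by (simp add: one_le_power)
    have "(sobolev_norm \<beta> {0..1} (?F 0))\<^sup>2 = (LINT x|lborel. (?F 0 x)\<^sup>2) + (LINT x|lborel. (?F \<beta> x)\<^sup>2)"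
      by (rule chain_sobolev_norm[OF F order_refl])
    also have "\<dots> = T * (1 + (s ^ \<beta>)\<^sup>2 * lam)"
      by (simp only: L2F[OF le0] L2F[OF order_refl] G0 T_def[symmetric] lam_def[symmetric] power_0 distrib_left) simp
    also have "\<dots> \<le> T * ((s ^ \<beta>)\<^sup>2 * (1 + lam))"
      using s1 T0 by (intro mult_left_mono) (auto simp: distrib_left)
    also have "\<dots> \<le> T * ((s ^ \<beta>)\<^sup>2 * (Gamma_const \<beta>)\<^sup>2)"
      using 2 T0 by (intro mult_left_mono) auto
    also have "\<dots> \<le> R\<^sup>2" using 1 by (simp only: mult.commute)
    finally have "sobolev_norm \<beta> {0..1} (?F 0) \<le> R"
      by (rule power2_le_imp_le) (use R in simp)
    moreover have "?F 0 \<in> sobolev_space \<beta> {0..1}" by (rule chain_in_sobolev_space[OF F]) auto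
    ultimately show ?thesis unfolding sobolev_ball_def by blast
  qed
  show thesis
  proof (rule that[of "\<lambda>i. \<psi> i (Suc 0)" "\<lambda>i. \<psi> i 0"])
    show "supp_sq 0 1 (\<psi> i (Suc 0))" if "i \<in> {1..m}" for i using \<psi>s[OF that] \<beta> by simp
    show "supp_sq 0 1 (\<psi> i 0)" if "i \<in> {1..m}" for i using \<psi>s[OF that] by simp
    show "\<psi> i 0 = prim (\<psi> i (Suc 0))" if "i \<in> {1..m}" for i using ch[OF that] \<beta> unfolding chain_def by blast
    show "(LINT x|lborel. \<psi> i 0 x * \<psi> j 0 x) = (if i = j then 1 else 0)" if "i \<in> {1..m}" "j \<in> {1..m}" for i j
      by (rule ortho[OF that])
    show "(\<lambda>x. \<Sum>i\<in>{1..m}. \<theta> i * \<psi> i 0 x) \<in> sobolev_ball \<beta> R" if "\<theta> \<in> Theta_ball m \<beta> R" for \<theta>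
      by (rule ball[OF that])
  qed
qed

section \<open>The law of the data along the family\<close>

text \<open>Pythagoras for the projection onto the span. Besides Bessel's inequality, the exact
  identity yields the variance of the remainder process.\<close>

lemma orthonormal_expansion:
  fixes \<phi> :: "'i \<Rightarrow> 'a \<Rightarrow> real"
  assumes I: "finite I" and u: "integrable M (\<lambda>x. (u x)\<^sup>2)"
    and u\<phi>: "\<And>i. i \<in> I \<Longrightarrow> integrable M (\<lambda>x. u x * \<phi> i x)"
    and \<phi>\<phi>: "\<And>i j. i \<in> I \<Longrightarrow> j \<in> I \<Longrightarrow> integrable M (\<lambda>x. \<phi> i x * \<phi> j x)"
    and ortho: "\<And>i j. i \<in> I \<Longrightarrow> j \<in> I \<Longrightarrow> (LINT x|M. \<phi> i x * \<phi> j x) = (if i = j then 1 else 0)"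
  defines "c \<equiv> \<lambda>i. LINT x|M. u x * \<phi> i x"
  shows "(LINT x|M. (u x - (\<Sum>i\<in>I. c i * \<phi> i x))\<^sup>2) = (LINT x|M. (u x)\<^sup>2) - (\<Sum>i\<in>I. (c i)\<^sup>2)"
proof -
  have e: "(u x - (\<Sum>i\<in>I. c i * \<phi> i x))\<^sup>2 = (u x)\<^sup>2 - (\<Sum>i\<in>I. (2 * c i) * (u x * \<phi> i x)) + (\<Sum>i\<in>I. \<Sum>j\<in>I. (c i * c j) * (\<phi> i x * \<phi> j x))" for x
  proof -
    let ?F = "\<Sum>i\<in>I. c i * \<phi> i x"
    have "(u x - ?F)\<^sup>2 = (u x)\<^sup>2 - 2 * u x * ?F + ?F * ?F" by (simp add: power2_eq_square algebra_simps)
    also have "?F * ?F = (\<Sum>i\<in>I. \<Sum>j\<in>I. (c i * \<phi> i x) * (c j * \<phi> j x))" by (rule sum_product)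
    finally show ?thesis by (simp add: sum_distrib_left mult_ac)
  qed
  have i2: "integrable M (\<lambda>x. \<Sum>i\<in>I. (2 * c i) * (u x * \<phi> i x))"
    by (intro Bochner_Integration.integrable_sum integrable_mult_right u\<phi>)
  have i3: "integrable M (\<lambda>x. \<Sum>i\<in>I. \<Sum>j\<in>I. (c i * c j) * (\<phi> i x * \<phi> j x))"
    by (intro Bochner_Integration.integrable_sum integrable_mult_right \<phi>\<phi>)
  have A: "(LINT x|M. (\<Sum>i\<in>I. (2 * c i) * (u x * \<phi> i x))) = (\<Sum>i\<in>I. (2 * c i) * c i)"
  proof -
    have "(LINT x|M. (\<Sum>i\<in>I. (2 * c i) * (u x * \<phi> i x))) = (\<Sum>i\<in>I. LINT x|M. (2 * c i) * (u x * \<phi> i x))"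
      by (intro Bochner_Integration.integral_sum integrable_mult_right u\<phi>)
    also have "\<dots> = (\<Sum>i\<in>I. (2 * c i) * c i)" by (simp only: integral_mult_right_zero c_def)
    finally show ?thesis .
  qed
  have B: "(LINT x|M. (\<Sum>i\<in>I. \<Sum>j\<in>I. (c i * c j) * (\<phi> i x * \<phi> j x))) = (\<Sum>i\<in>I. c i * c i)"
  proof -
    have "(LINT x|M. (\<Sum>i\<in>I. \<Sum>j\<in>I. (c i * c j) * (\<phi> i x * \<phi> j x))) = (\<Sum>i\<in>I. LINT x|M. (\<Sum>j\<in>I. (c i * c j) * (\<phi> i x * \<phi> j x)))"
      by (intro Bochner_Integration.integral_sum Bochner_Integration.integrable_sum integrable_mult_right \<phi>\<phi>)
    also have "\<dots> = (\<Sum>i\<in>I. \<Sum>j\<in>I. LINT x|M. (c i * c j) * (\<phi> i x * \<phi> j x))"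
      by (intro sum.cong refl Bochner_Integration.integral_sum integrable_mult_right \<phi>\<phi>)
    also have "\<dots> = (\<Sum>i\<in>I. \<Sum>j\<in>I. if i = j then c i * c j else 0)"
      by (intro sum.cong refl) (simp add: integral_mult_right_zero ortho del: integral_mult_right)
    also have "\<dots> = (\<Sum>i\<in>I. c i * c i)" using I by (intro sum.cong refl) (simp add: sum.delta')
    finally show ?thesis .
  qed
  have "(LINT x|M. (u x - (\<Sum>i\<in>I. c i * \<phi> i x))\<^sup>2) = (LINT x|M. (u x)\<^sup>2) - (\<Sum>i\<in>I. (2 * c i) * c i) + (\<Sum>i\<in>I. c i * c i)"
    unfolding e Bochner_Integration.integral_add[OF Bochner_Integration.integrable_diff[OF u i2] i3]
      Bochner_Integration.integral_diff[OF u i2] A B ..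
  also have "(\<Sum>i\<in>I. (2 * c i) * c i) = 2 * (\<Sum>i\<in>I. c i * c i)" by (simp add: sum_distrib_left mult.assoc)
  finally show ?thesis by (simp add: power2_eq_square)
qed

lemma Bessel_inequality:
  fixes \<phi> :: "'i \<Rightarrow> 'a \<Rightarrow> real"
  assumes I: "finite I" and u: "integrable M (\<lambda>x. (u x)\<^sup>2)"
    and u\<phi>: "\<And>i. i \<in> I \<Longrightarrow> integrable M (\<lambda>x. u x * \<phi> i x)"
    and \<phi>\<phi>: "\<And>i j. i \<in> I \<Longrightarrow> j \<in> I \<Longrightarrow> integrable M (\<lambda>x. \<phi> i x * \<phi> j x)"
    and ortho: "\<And>i j. i \<in> I \<Longrightarrow> j \<in> I \<Longrightarrow> (LINT x|M. \<phi> i x * \<phi> j x) = (if i = j then 1 else 0)"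
  shows "(\<Sum>i\<in>I. (LINT x|M. u x * \<phi> i x)\<^sup>2) \<le> (LINT x|M. (u x)\<^sup>2)"
proof -
  have "0 \<le> (LINT x|M. (u x - (\<Sum>i\<in>I. (LINT x|M. u x * \<phi> i x) * \<phi> i x))\<^sup>2)" by simp
  also have "\<dots> = (LINT x|M. (u x)\<^sup>2) - (\<Sum>i\<in>I. (LINT x|M. u x * \<phi> i x)\<^sup>2)"
    by (rule orthonormal_expansion[OF I u u\<phi> \<phi>\<phi> ortho])
  finally show ?thesis by simp
qed

section \<open>Laws on the space of continuous paths\<close>

lemma space_path_space: "space path_space = {w. continuous_on {0..1} w} \<inter> extensional {0..1}"
  by (auto simp: path_space_def space_restrict_space space_PiM PiE_def)

lemma measurable_path_space:
  assumes "f \<in> measurable M (PiM {0..1} (\<lambda>_. borel))" "\<And>x. x \<in> space M \<Longrightarrow> continuous_on {0..1} (f x)"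
  shows "f \<in> measurable M path_space"
  unfolding path_space_def using assms by (intro measurable_restrict_space2) auto

text \<open>Cylinder sets determine a law on the full product. Measurable sets of
  \<open>path_space\<close> are traces of product sets, and both maps take continuous values, so a
  trace and the full set have the same preimages.\<close>

lemma distr_path_space_eqI:
  assumes f: "f \<in> measurable M path_space" and g: "g \<in> measurable N path_space"
    and P: "prob_space M" "prob_space N"
    and eq: "\<And>J A. finite J \<Longrightarrow> J \<subseteq> {0..1} \<Longrightarrow> (\<And>t. t \<in> J \<Longrightarrow> A t \<in> sets borel) \<Longrightarrow>
      (LINT x|M. (\<Prod>t\<in>J. indicat_real (A t) (f x t))) = (LINT x|N. (\<Prod>t\<in>J. indicat_real (A t) (g x t)))"
  shows "distr M path_space f = distr N path_space g"
proof -
  interpret M: prob_space M by fact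
  interpret N: prob_space N by fact
  let ?P = "PiM {0..1::real} (\<lambda>_. borel :: real measure)"
  have inc: "(\<lambda>x. x) \<in> measurable path_space ?P"
    unfolding path_space_def by (rule measurable_restrict_space1) simp
  have fP: "f \<in> measurable M ?P" and gP: "g \<in> measurable N ?P"
    using measurable_compose[OF f inc] measurable_compose[OF g inc] by simp_all
  interpret fd: prob_space "distr M ?P f" using fP by (rule M.prob_space_distr)
  have cyl: "emeasure (distr L ?P k) (prod_emb {0..1} (\<lambda>_. borel) J (Pi\<^sub>E J A)) = ennreal (LINT x|L. (\<Prod>t\<in>J. indicat_real (A t) (k x t)))"
    if J: "finite J" "J \<subseteq> {0..1}" and A: "\<And>t. t \<in> J \<Longrightarrow> A t \<in> sets borel" and L: "prob_space L" and k: "k \<in> measurable L ?P"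
    for J A k and L :: "'c measure"
  proof -
    interpret L: prob_space L by fact
    let ?S = "prod_emb {0..1} (\<lambda>_. borel :: real measure) J (Pi\<^sub>E J A)"
    have S: "?S \<in> sets ?P" using J A by (intro sets_PiM_I) auto
    have m: "k -` ?S \<inter> space L \<in> sets L" using k S by (rule measurable_sets)
    have "emeasure (distr L ?P k) ?S = ennreal (measure L (k -` ?S \<inter> space L))"
      using k S by (simp add: emeasure_distr L.emeasure_eq_measure)
    also have "measure L (k -` ?S \<inter> space L) = (LINT x|L. indicat_real (k -` ?S \<inter> space L) x)"
      using m by simp
    also have "\<dots> = (LINT x|L. (\<Prod>t\<in>J. indicat_real (A t) (k x t)))"
    proof (rule Bochner_Integration.integral_cong[OF refl])
      fix x assume x: "x \<in> space L"
      then have "k x \<in> extensional {0..1}"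
        using measurable_space[OF k x] by (simp add: space_PiM PiE_def)
      then have iff: "x \<in> k -` ?S \<inter> space L \<longleftrightarrow> (\<forall>t\<in>J. k x t \<in> A t)"
        using x by (simp add: prod_emb_iff Pi_iff)
      show "indicat_real (k -` ?S \<inter> space L) x = (\<Prod>t\<in>J. indicat_real (A t) (k x t))"
      proof (cases "\<forall>t\<in>J. k x t \<in> A t")
        case True
        then have "(\<Prod>t\<in>J. indicat_real (A t) (k x t)) = 1" by (intro prod.neutral) simp
        moreover have "x \<in> k -` ?S \<inter> space L" using iff True by (rule iffD2)
        ultimately show ?thesis by (simp only: indicator_simps)
      next
        case False
        then obtain t where "t \<in> J" "k x t \<notin> A t" by blast
        then have "(\<Prod>t\<in>J. indicat_real (A t) (k x t)) = 0"
          by (intro prod_zero[OF J(1)] bexI[of _ t]) simp_all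
        moreover have "x \<notin> k -` ?S \<inter> space L" using iff False by blast
        then have "indicat_real (k -` ?S \<inter> space L) x = 0" by (rule indicator_simps(2))
        ultimately show ?thesis by (simp only:)
      qed
    qed
    finally show ?thesis .
  qed
  have PP: "distr M ?P f = distr N ?P g"
  proof (rule measure_eqI_PiM_infinite[where I = "{0..1}" and M = "\<lambda>_. borel"])
    fix A :: "real \<Rightarrow> real set" and J :: "real set" assume "finite J" "J \<subseteq> {0..1}" "\<And>i. i \<in> J \<Longrightarrow> A i \<in> sets borel"
    then show "emeasure (distr M ?P f) (prod_emb {0..1} (\<lambda>_. borel) J (Pi\<^sub>E J A)) = emeasure (distr N ?P g) (prod_emb {0..1} (\<lambda>_. borel) J (Pi\<^sub>E J A))"
      by (simp only: cyl[OF _ _ _ P(1) fP] cyl[OF _ _ _ P(2) gP] eq)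
  qed (auto intro: fd.finite_measure)
  show ?thesis
  proof (rule measure_eqI)
    fix S assume "S \<in> sets (distr M path_space f)"
    then have S: "S \<in> sets path_space" by simp
    then obtain B where B: "B \<in> sets ?P" "S = {w. continuous_on {0..1} w} \<inter> B"
      by (auto simp: path_space_def sets_restrict_space)
    have "f -` S \<inter> space M = f -` B \<inter> space M" "g -` S \<inter> space N = g -` B \<inter> space N"
      using measurable_space[OF f] measurable_space[OF g] B(2) by (auto simp: space_path_space)
    moreover have "emeasure M (f -` B \<inter> space M) = emeasure N (g -` B \<inter> space N)"
      using arg_cong[OF PP, of "\<lambda>\<mu>. emeasure \<mu> B"] B(1) fP gP by (simp add: emeasure_distr)
    ultimately show "emeasure (distr M path_space f) S = emeasure (distr N path_space g) S"
      using f g S by (simp add: emeasure_distr)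
  qed simp
qed

section \<open>The characteristic function of the sequence model\<close>

lemma prob_space_integrable_iexp:
  assumes "prob_space M" and [measurable]: "f \<in> borel_measurable M"
  shows "integrable M (\<lambda>x. iexp (f x))"
proof -
  interpret prob_space M by fact
  show ?thesis by (rule integrable_const_bound[where B = 1]) auto
qed

lemma sequence_law_char:
  assumes "n > 0"
  shows "(LINT x|sequence_law m n \<theta>. iexp (\<Sum>i\<in>{1..m}. c i * x i))
    = iexp (\<Sum>i\<in>{1..m}. c i * \<theta> i) * complex_of_real (exp (- (\<Sum>i\<in>{1..m}. (c i)\<^sup>2 / n) / 2))"
proof -
  let ?N = "\<lambda>_::nat. std_normal_distribution"
  interpret product_sigma_finite ?N
    unfolding product_sigma_finite_def
    by (intro allI prob_space_imp_sigma_finite prob_space_normal_density) simp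
  have "(LINT x|sequence_law m n \<theta>. iexp (\<Sum>i\<in>{1..m}. c i * x i))
    = (LINT e|PiM {1..m} ?N. iexp (\<Sum>i\<in>{1..m}. c i * (\<theta> i + e i / sqrt n)))"
    unfolding sequence_law_def by (subst integral_distr) (auto intro!: Bochner_Integration.integral_cong)
  also have "\<dots> = (LINT e|PiM {1..m} ?N. iexp (\<Sum>i\<in>{1..m}. c i * \<theta> i) * (\<Prod>i\<in>{1..m}. iexp ((c i / sqrt n) * e i)))"
  proof (rule Bochner_Integration.integral_cong[OF refl])
    fix e :: "nat \<Rightarrow> real"
    have "(\<Sum>i\<in>{1..m}. c i * (\<theta> i + e i / sqrt n)) = (\<Sum>i\<in>{1..m}. c i * \<theta> i) + (\<Sum>i\<in>{1..m}. (c i / sqrt n) * e i)"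
      by (simp add: distrib_left sum.distrib)
    then show "iexp (\<Sum>i\<in>{1..m}. c i * (\<theta> i + e i / sqrt n)) = iexp (\<Sum>i\<in>{1..m}. c i * \<theta> i) * (\<Prod>i\<in>{1..m}. iexp ((c i / sqrt n) * e i))"
      by (simp only: of_real_add distrib_left exp_add of_real_sum sum_distrib_left exp_sum[OF finite_atLeastAtMost])
  qed
  also have "\<dots> = iexp (\<Sum>i\<in>{1..m}. c i * \<theta> i) * (LINT e|PiM {1..m} ?N. (\<Prod>i\<in>{1..m}. iexp ((c i / sqrt n) * e i)))"
    by (rule integral_mult_right_zero)
  also have "(LINT e|PiM {1..m} ?N. (\<Prod>i\<in>{1..m}. iexp ((c i / sqrt n) * e i))) = (\<Prod>i\<in>{1..m}. LINT x|std_normal_distribution. iexp ((c i / sqrt n) * x))"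
  proof (rule product_integral_prod)
    interpret rd: real_distribution std_normal_distribution by (rule real_dist_normal_dist)
    show "integrable std_normal_distribution (\<lambda>x. iexp ((c i / sqrt n) * x))" for i
      by (intro rd.integrable_iexp) auto
  qed simp
  also have "\<dots> = (\<Prod>i\<in>{1..m}. complex_of_real (exp (- ((c i)\<^sup>2 / n) / 2)))"
  proof (rule prod.cong[OF refl])
    fix i
    have "(LINT x|std_normal_distribution. iexp ((c i / sqrt n) * x)) = char std_normal_distribution (c i / sqrt n)"
      by (simp add: char_def)
    also have "\<dots> = complex_of_real (exp (- ((c i / sqrt n)\<^sup>2) / 2))" by (simp add: char_std_normal_distribution)
    finally show "(LINT x|std_normal_distribution. iexp ((c i / sqrt n) * x)) = complex_of_real (exp (- ((c i)\<^sup>2 / n) / 2))"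
      using assms by (simp add: power_divide)
  qed
  also have "\<dots> = complex_of_real (exp (\<Sum>i\<in>{1..m}. - ((c i)\<^sup>2 / n) / 2))"
    by (simp add: exp_sum)
  also have "(\<Sum>i\<in>{1..m}. - ((c i)\<^sup>2 / n) / 2) = - (\<Sum>i\<in>{1..m}. (c i)\<^sup>2 / n) / 2"
    by (simp add: sum_negf flip: sum_divide_distrib)
  finally show ?thesis .
qed

lemma prob_space_sequence_law: "prob_space (sequence_law m n \<theta>)"
proof -
  have "prob_space (PiM {1..m} (\<lambda>_::nat. std_normal_distribution))"
    by (intro prob_space_PiM prob_space_normal_density) simp
  then show ?thesis unfolding sequence_law_def
    by (rule prob_space.prob_space_distr) (auto intro!: measurable_restrict)
qed

lemma sets_sequence_law [simp, measurable_cong]: "sets (sequence_law m n \<theta>) = sets (Rm m)"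
  by (simp add: sequence_law_def)

text \<open>The path observed in the white noise model is rebuilt from an observation \<open>x\<close> of the sequence
  model and an independent Brownian motion whose components along the \<open>\<phi> i\<close> are removed. As
  \<open>h i\<close> is the derivative of \<open>\<phi> i\<close>, the Wiener integral of \<open>\<phi> i\<close> is minus the integral of \<open>W * h i\<close>.\<close>

definition rebuild :: "nat \<Rightarrow> real \<Rightarrow> (nat \<Rightarrow> real \<Rightarrow> real) \<Rightarrow> (nat \<Rightarrow> real \<Rightarrow> real) \<Rightarrow> (real \<Rightarrow> 'a \<Rightarrow> real)
    \<Rightarrow> (nat \<Rightarrow> real) \<times> 'a \<Rightarrow> real \<Rightarrow> real" where
  "rebuild m n \<phi> h W = (\<lambda>(x, \<omega>). \<lambda>t\<in>{0..1}. (\<Sum>i\<in>{1..m}. x i * prim (\<phi> i) t)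
     + (W t \<omega> + (\<Sum>i\<in>{1..m}. (LINT s:{0<..1}|lborel. W s \<omega> * h i s) * prim (\<phi> i) t)) / sqrt n)"

section \<open>Equality of the laws of the observed and the rebuilt path\<close>

locale white_noise_basis =
  fixes m :: nat and n :: real and M :: "'a measure" and W :: "real \<Rightarrow> 'a \<Rightarrow> real" and \<phi> h :: "nat \<Rightarrow> real \<Rightarrow> real"
  assumes n: "n > 0" and BM: "standard_brownian_motion M W"
    and h: "\<And>i. i \<in> {1..m} \<Longrightarrow> supp_sq 0 1 (h i)" and \<phi>h: "\<And>i. i \<in> {1..m} \<Longrightarrow> \<phi> i = prim (h i)"
    and \<phi>: "\<And>i. i \<in> {1..m} \<Longrightarrow> supp_sq 0 1 (\<phi> i)"
    and ortho: "\<And>i j. i \<in> {1..m} \<Longrightarrow> j \<in> {1..m} \<Longrightarrow> (LINT x|lborel. \<phi> i x * \<phi> j x) = (if i = j then 1 else 0)"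
begin

lemma prob_M: "prob_space M" using BM by (simp add: standard_brownian_motion_def)

lemma W_measurable: "t \<in> {0..1} \<Longrightarrow> W t \<in> borel_measurable M"
  using BM by (auto simp: standard_brownian_motion_def)

lemma h_total:
  assumes "i \<in> {1..m}"
  shows "integral\<^sup>L lborel (h i) = 0"
proof -
  have "integral\<^sup>L lborel (h i) = prim (h i) 2" by (rule prim_eq_total[OF h[OF assms], symmetric]) simp
  also have "\<dots> = \<phi> i 2" by (simp only: \<phi>h[OF assms])
  also have "\<dots> = 0" by (rule supp_sqD(3)[OF \<phi>[OF assms]]) simp
  finally show ?thesis .
qed

lemma white_noise_path_eq:
  assumes "t \<in> {0..1}"
  shows "(LINT s:{0..t}|lborel. (\<Sum>i\<in>{1..m}. \<theta> i * \<phi> i s)) = (\<Sum>i\<in>{1..m}. \<theta> i * prim (\<phi> i) t)"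
proof -
  have s: "supp_sq 0 1 (\<lambda>s. \<Sum>i\<in>{1..m}. \<theta> i * \<phi> i s)" by (rule supp_sq_sum) (use \<phi> in auto)
  have "(LINT s:{0..t}|lborel. (\<Sum>i\<in>{1..m}. \<theta> i * \<phi> i s)) = prim (\<lambda>s. \<Sum>i\<in>{1..m}. \<theta> i * \<phi> i s) t"
    unfolding prim_def set_lebesgue_integral_def
  proof (rule Bochner_Integration.integral_cong[OF refl])
    fix x
    show "indicator {0..t} x *\<^sub>R (\<Sum>i\<in>{1..m}. \<theta> i * \<phi> i x) = indicator {..t} x *\<^sub>R (\<Sum>i\<in>{1..m}. \<theta> i * \<phi> i x)"
      using supp_sqD(3)[OF s, of x] by (cases "0 \<le> x") (auto simp: indicator_def)
  qed
  also have "\<dots> = (\<Sum>i\<in>{1..m}. \<theta> i * prim (\<phi> i) t)" by (rule prim_sum) (use \<phi> in auto)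
  finally show ?thesis .
qed

text \<open>Read as a scalar product: \<open>prim (\<phi> i) t\<close> is the coefficient of the
  indicator of {..<t} along \<open>\<phi> i\<close>, which ties values of the path to
  projections.\<close>

lemma phi_int_indicator:
  assumes "t \<in> {0..1}" "i \<in> {1..m}"
  shows "(LINT x:{0<..1}|lborel. indicator {..<t} x * \<phi> i x) = prim (\<phi> i) t"
  unfolding prim_def set_lebesgue_integral_def
proof (rule integral_cong_AE)
  have [measurable]: "\<phi> i \<in> borel_measurable borel" by (rule supp_sqD[OF \<phi>[OF assms(2)]])
  show "(\<lambda>x. indicat_real {0<..1} x *\<^sub>R (indicator {..<t} x * \<phi> i x)) \<in> borel_measurable lborel" by measurable
  show "(\<lambda>x. indicat_real {..t} x *\<^sub>R \<phi> i x) \<in> borel_measurable lborel" by measurable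
  show "AE x in lborel. indicat_real {0<..1} x *\<^sub>R (indicator {..<t} x * \<phi> i x) = indicat_real {..t} x *\<^sub>R \<phi> i x"
    using AE_lborel_singleton[of 0] AE_lborel_singleton[of t]
  proof eventually_elim
    case (elim x)
    show ?case
    proof (cases "x \<in> {0..1}")
      case True
      then show ?thesis using elim assms(1) by (auto simp: indicator_def)
    qed (use supp_sqD(3)[OF \<phi>[OF assms(2)], of x] in auto)
  qed
qed

text \<open>Measurability is given for the single variables \<open>W t\<close>, so that of the
  integral is taken from the limit of grid sums, through \<open>brownian_functional\<close> with
  empty \<open>J\<close>.\<close>

lemma W_functional_measurable:
  assumes "i \<in> {1..m}"
  shows "(\<lambda>\<omega>. LINT s:{0<..1}|lborel. W s \<omega> * h i s) \<in> borel_measurable M"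
proof -
  have "(\<lambda>\<omega>. (\<Sum>t\<in>{}. 0 * W t \<omega>) - (LINT x:{0<..1}|lborel. W x \<omega> * h i x)) \<in> borel_measurable M"
    by (rule brownian_functional(1)[OF BM _ _ h[OF assms] h_total[OF assms]]) auto
  then have "(\<lambda>\<omega>. - (LINT x:{0<..1}|lborel. W x \<omega> * h i x)) \<in> borel_measurable M" by simp
  then show ?thesis using borel_measurable_uminus by fastforce
qed

lemma W_h_integrable:
  assumes "\<omega> \<in> space M" "i \<in> {1..m}"
  shows "set_integrable lborel {0<..1} (\<lambda>s. W s \<omega> * h i s)"
proof -
  have "continuous_on {0..1} (\<lambda>t. W t \<omega>)" using BM assms(1) by (auto simp: standard_brownian_motion_def)
  from supp_sq_mult_integrable[OF h[OF assms(2)] this]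
  have "integrable lborel (\<lambda>s. indicator {0<..1} s *\<^sub>R (h i s * W s \<omega>))"
    by (intro integrable_mult_indicator) auto
  then show ?thesis by (simp add: set_integrable_def mult.commute)
qed

definition obs :: "(nat \<Rightarrow> real) \<Rightarrow> 'a \<Rightarrow> real \<Rightarrow> real" where
  "obs \<theta> \<omega> = (\<lambda>x\<in>{0..1}. (LINT t:{0..x}|lborel. (\<Sum>i\<in>{1..m}. \<theta> i * \<phi> i t)) + W x \<omega> / sqrt n)"

lemma obs_eq: "t \<in> {0..1} \<Longrightarrow> obs \<theta> \<omega> t = (\<Sum>i\<in>{1..m}. \<theta> i * prim (\<phi> i) t) + W t \<omega> / sqrt n"
  unfolding obs_def by (simp only: restrict_apply' white_noise_path_eq)

lemma obs_measurable: "obs \<theta> \<in> measurable M path_space"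
proof (rule measurable_path_space)
  show "obs \<theta> \<in> measurable M (PiM {0..1} (\<lambda>_. borel))"
    unfolding obs_def using W_measurable
    by (intro measurable_restrict borel_measurable_add borel_measurable_divide borel_measurable_const) auto
  fix \<omega> assume "\<omega> \<in> space M"
  then have c: "continuous_on {0..1} (\<lambda>t. W t \<omega>)" using BM by (auto simp: standard_brownian_motion_def)
  have "continuous_on {0..1} (\<lambda>t. (\<Sum>i\<in>{1..m}. \<theta> i * prim (\<phi> i) t) + W t \<omega> / sqrt n)"
    using n by (intro continuous_intros c continuous_prim[OF \<phi>]) auto
  then show "continuous_on {0..1} (obs \<theta> \<omega>)"
    by (rule continuous_on_eq) (simp only: obs_eq)
qed

lemma rebuild_measurable: "rebuild m n \<phi> h W \<in> measurable (sequence_law m n \<theta> \<Otimes>\<^sub>M M) path_space"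
proof (rule measurable_path_space)
  have x: "(\<lambda>p. fst p i) \<in> borel_measurable (sequence_law m n \<theta> \<Otimes>\<^sub>M M)" if "i \<in> {1..m}" for i
    using that by measurable
  have w: "(\<lambda>p. W t (snd p)) \<in> borel_measurable (sequence_law m n \<theta> \<Otimes>\<^sub>M M)" if "t \<in> {0..1}" for t
    using W_measurable[OF that] by measurable
  have e: "(\<lambda>p. LINT s:{0<..1}|lborel. W s (snd p) * h i s) \<in> borel_measurable (sequence_law m n \<theta> \<Otimes>\<^sub>M M)" if "i \<in> {1..m}" for i
    by (rule measurable_compose[OF measurable_snd W_functional_measurable[OF that]])
  show "rebuild m n \<phi> h W \<in> measurable (sequence_law m n \<theta> \<Otimes>\<^sub>M M) (PiM {0..1} (\<lambda>_. borel))"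
    unfolding rebuild_def case_prod_beta
    by (intro measurable_restrict borel_measurable_add borel_measurable_divide borel_measurable_const borel_measurable_sum borel_measurable_times x w e)
  fix p assume p: "p \<in> space (sequence_law m n \<theta> \<Otimes>\<^sub>M M)"
  obtain x \<omega> where xo: "p = (x, \<omega>)" by (cases p)
  with p have "\<omega> \<in> space M" by (simp add: space_pair_measure)
  then have c: "continuous_on {0..1} (\<lambda>t. W t \<omega>)" using BM by (auto simp: standard_brownian_motion_def)
  have "continuous_on {0..1} (\<lambda>t. (\<Sum>i\<in>{1..m}. x i * prim (\<phi> i) t)
     + (W t \<omega> + (\<Sum>i\<in>{1..m}. (LINT s:{0<..1}|lborel. W s \<omega> * h i s) * prim (\<phi> i) t)) / sqrt n)"
    using n by (intro continuous_intros c continuous_prim[OF \<phi>]) auto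
  then show "continuous_on {0..1} (rebuild m n \<phi> h W p)"
    unfolding xo by (rule continuous_on_eq) (simp add: rebuild_def)
qed

text \<open>A linear combination of path values is its drift plus the Wiener integral of s / sqrt n.
  All noise comes from point evaluations, hence the zero function in the role of
  \<open>h\<close>.\<close>

lemma char_obs:
  fixes u :: "real \<Rightarrow> real"
  assumes J: "finite J" "J \<subseteq> {0..1}"
  defines "s \<equiv> \<lambda>x. \<Sum>t\<in>J. u t * indicator {..<t} x" and "a \<equiv> \<lambda>i. \<Sum>t\<in>J. u t * prim (\<phi> i) t"
  shows "(LINT \<omega>|M. iexp (\<Sum>t\<in>J. u t * obs \<theta> \<omega> t))
    = iexp (\<Sum>i\<in>{1..m}. a i * \<theta> i) * complex_of_real (exp (- ((LINT x:{0<..1}|lborel. (s x)\<^sup>2) / n) / 2))"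
proof -
  let ?L = "\<lambda>\<omega>. (\<Sum>t\<in>J. (u t / sqrt n) * W t \<omega>) - (LINT x:{0<..1}|lborel. W x \<omega> * 0)"
  have "(\<Sum>t\<in>J. u t * obs \<theta> \<omega> t) = (\<Sum>i\<in>{1..m}. a i * \<theta> i) + ?L \<omega>" for \<omega>
  proof -
    have "(\<Sum>t\<in>J. u t * obs \<theta> \<omega> t) = (\<Sum>t\<in>J. u t * (\<Sum>i\<in>{1..m}. \<theta> i * prim (\<phi> i) t) + (u t / sqrt n) * W t \<omega>)"
    proof (intro sum.cong refl)
      fix t assume "t \<in> J"
      then have "t \<in> {0..1}" using J(2) by blast
      from obs_eq[OF this] show "u t * obs \<theta> \<omega> t = u t * (\<Sum>i\<in>{1..m}. \<theta> i * prim (\<phi> i) t) + (u t / sqrt n) * W t \<omega>"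
        by (simp only: distrib_left times_divide_eq_left times_divide_eq_right)
    qed
    also have "\<dots> = (\<Sum>t\<in>J. \<Sum>i\<in>{1..m}. u t * prim (\<phi> i) t * \<theta> i) + (\<Sum>t\<in>J. (u t / sqrt n) * W t \<omega>)"
      by (simp add: sum.distrib sum_distrib_left mult_ac)
    also have "(\<Sum>t\<in>J. \<Sum>i\<in>{1..m}. u t * prim (\<phi> i) t * \<theta> i) = (\<Sum>i\<in>{1..m}. a i * \<theta> i)"
      unfolding a_def by (subst sum.swap) (simp only: sum_distrib_right)
    finally show ?thesis by simp
  qed
  then have "(LINT \<omega>|M. iexp (\<Sum>t\<in>J. u t * obs \<theta> \<omega> t)) = (LINT \<omega>|M. iexp (\<Sum>i\<in>{1..m}. a i * \<theta> i) * iexp (?L \<omega>))"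
    by (simp only: of_real_add distrib_left exp_add)
  also have "\<dots> = iexp (\<Sum>i\<in>{1..m}. a i * \<theta> i) * (LINT \<omega>|M. iexp (?L \<omega>))"
    by (rule integral_mult_right_zero)
  also have "(LINT \<omega>|M. iexp (?L \<omega>)) = complex_of_real (exp (- (LINT x:{0<..1}|lborel. ((\<Sum>t\<in>J. (u t / sqrt n) * indicator {..<t} x) + prim (\<lambda>x. 0) x)\<^sup>2) / 2))"
    by (rule brownian_functional(2)[OF BM J supp_sq_zero]) simp
  also have "(\<lambda>x. ((\<Sum>t\<in>J. (u t / sqrt n) * indicator {..<t} x) + prim (\<lambda>x. 0) x)\<^sup>2) = (\<lambda>x. (s x)\<^sup>2 / n)"
  proof
    fix x
    have "(\<Sum>t\<in>J. (u t / sqrt n) * indicator {..<t} x) + prim (\<lambda>x. 0) x = s x / sqrt n"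
      by (simp add: s_def prim_zero sum_divide_distrib)
    then show "((\<Sum>t\<in>J. (u t / sqrt n) * indicator {..<t} x) + prim (\<lambda>x. 0) x)\<^sup>2 = (s x)\<^sup>2 / n"
      using n by (simp add: power_divide)
  qed
  finally show ?thesis by simp
qed

text \<open>After the projection the integrand is (s - \<Sum> a i * \<phi> i) / sqrt n, with
  \<open>a i\<close> the coefficient of \<open>s\<close> along \<open>\<phi> i\<close>. Its squared
  norm is smaller by the sum of the (a i)^2 / n, which is precisely the variance contributed by the
  independent Gaussian part \<open>x\<close>.\<close>

lemma char_rebuild:
  fixes u :: "real \<Rightarrow> real"
  assumes J: "finite J" "J \<subseteq> {0..1}"
  defines "s \<equiv> \<lambda>x. \<Sum>t\<in>J. u t * indicator {..<t} x" and "a \<equiv> \<lambda>i. \<Sum>t\<in>J. u t * prim (\<phi> i) t"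
  shows "(LINT p|(sequence_law m n \<theta> \<Otimes>\<^sub>M M). iexp (\<Sum>t\<in>J. u t * rebuild m n \<phi> h W p t))
    = iexp (\<Sum>i\<in>{1..m}. a i * \<theta> i) * complex_of_real (exp (- ((LINT x:{0<..1}|lborel. (s x)\<^sup>2) / n) / 2))"
proof -
  let ?S = "sequence_law m n \<theta>"
  interpret S: prob_space ?S by (rule prob_space_sequence_law)
  interpret M: prob_space M by (rule prob_M)
  interpret pair_prob_space ?S M ..
  \<comment> \<open>Sign and scale are such that \<open>prim H\<close> is the correction to be added
    to s / sqrt n, and minus the integral of W * H is its Wiener integral.\<close>
  define H where "H x = (\<Sum>i\<in>{1..m}. (- a i / sqrt n) * h i x)" for x
  have H: "supp_sq 0 1 H" unfolding H_def by (rule supp_sq_sum) (use h in auto)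
  have Hprim: "prim H x = (\<Sum>i\<in>{1..m}. (- a i / sqrt n) * \<phi> i x)" for x
    unfolding H_def using h \<phi>h by (subst prim_sum) auto
  have Htot: "integral\<^sup>L lborel H = 0"
  proof -
    have "prim H 2 = (\<Sum>i\<in>{1..m}. (- a i / sqrt n) * \<phi> i 2)" by (rule Hprim)
    also have "\<dots> = 0" using supp_sqD(3)[OF \<phi>, of _ 2] by (intro sum.neutral) auto
    finally show ?thesis using prim_eq_total[OF H, of 2] by simp
  qed
  let ?L = "\<lambda>\<omega>. (\<Sum>t\<in>J. (u t / sqrt n) * W t \<omega>) - (LINT x:{0<..1}|lborel. W x \<omega> * H x)"
  have dec: "(\<Sum>t\<in>J. u t * rebuild m n \<phi> h W (x, \<omega>) t) = (\<Sum>i\<in>{1..m}. a i * x i) + ?L \<omega>" if "\<omega> \<in> space M" for x \<omega>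
  proof -
    let ?e = "\<lambda>i. LINT s:{0<..1}|lborel. W s \<omega> * h i s"
    have "(\<Sum>t\<in>J. u t * rebuild m n \<phi> h W (x, \<omega>) t)
      = (\<Sum>t\<in>J. (\<Sum>i\<in>{1..m}. u t * prim (\<phi> i) t * x i) + (u t / sqrt n) * W t \<omega> + (\<Sum>i\<in>{1..m}. u t * prim (\<phi> i) t * (?e i / sqrt n)))"
    proof (intro sum.cong refl)
      fix t assume "t \<in> J"
      then have t: "t \<in> {0..1}" using J by auto
      have "u t * rebuild m n \<phi> h W (x, \<omega>) t = u t * (\<Sum>i\<in>{1..m}. x i * prim (\<phi> i) t) + (u t / sqrt n) * W t \<omega> + (u t / sqrt n) * (\<Sum>i\<in>{1..m}. ?e i * prim (\<phi> i) t)"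
        using t by (simp add: rebuild_def distrib_left add_divide_distrib)
      then show "u t * rebuild m n \<phi> h W (x, \<omega>) t = (\<Sum>i\<in>{1..m}. u t * prim (\<phi> i) t * x i) + (u t / sqrt n) * W t \<omega> + (\<Sum>i\<in>{1..m}. u t * prim (\<phi> i) t * (?e i / sqrt n))"
        by (simp add: sum_distrib_left mult_ac)
    qed
    also have "\<dots> = (\<Sum>t\<in>J. \<Sum>i\<in>{1..m}. u t * prim (\<phi> i) t * x i) + (\<Sum>t\<in>J. (u t / sqrt n) * W t \<omega>) + (\<Sum>t\<in>J. \<Sum>i\<in>{1..m}. u t * prim (\<phi> i) t * (?e i / sqrt n))"
      by (simp only: sum.distrib)
    also have "(\<Sum>t\<in>J. \<Sum>i\<in>{1..m}. u t * prim (\<phi> i) t * x i) = (\<Sum>i\<in>{1..m}. a i * x i)"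
      unfolding a_def by (subst sum.swap) (simp only: sum_distrib_right)
    also have "(\<Sum>t\<in>J. \<Sum>i\<in>{1..m}. u t * prim (\<phi> i) t * (?e i / sqrt n)) = (\<Sum>i\<in>{1..m}. a i * (?e i / sqrt n))"
      unfolding a_def by (subst sum.swap) (simp only: sum_distrib_right)
    also have "(\<Sum>i\<in>{1..m}. a i * (?e i / sqrt n)) = - (LINT x:{0<..1}|lborel. W x \<omega> * H x)"
    proof -
      have "(LINT x:{0<..1}|lborel. W x \<omega> * H x) = (LINT x|lborel. (\<Sum>i\<in>{1..m}. (- a i / sqrt n) * (indicator {0<..1} x *\<^sub>R (W x \<omega> * h i x))))"
        unfolding set_lebesgue_integral_def H_def by (simp add: sum_distrib_left mult_ac)
      also have "\<dots> = (\<Sum>i\<in>{1..m}. (- a i / sqrt n) * ?e i)"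
        using W_h_integrable[OF that] unfolding set_integrable_def set_lebesgue_integral_def
        by (subst Bochner_Integration.integral_sum) (auto intro!: integrable_mult_right sum.cong simp: integral_mult_right_zero)
      finally show ?thesis by (simp add: sum_negf)
    qed
    finally show ?thesis by simp
  qed
  have Lm: "?L \<in> borel_measurable M" by (rule brownian_functional(1)[OF BM J H Htot])
  have xm: "(\<lambda>x. \<Sum>i\<in>{1..m}. a i * x i) \<in> borel_measurable ?S"
    by (intro borel_measurable_sum borel_measurable_times borel_measurable_const) measurable
  have i1: "integrable ?S (\<lambda>x. iexp (\<Sum>i\<in>{1..m}. a i * x i))" by (rule prob_space_integrable_iexp[OF S.prob_space_axioms xm])
  have i2: "integrable M (\<lambda>\<omega>. iexp (?L \<omega>))" by (rule prob_space_integrable_iexp[OF M.prob_space_axioms Lm])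
  have "(LINT p|(?S \<Otimes>\<^sub>M M). iexp (\<Sum>t\<in>J. u t * rebuild m n \<phi> h W p t))
    = (LINT p|(?S \<Otimes>\<^sub>M M). (\<lambda>(x, \<omega>). iexp (\<Sum>i\<in>{1..m}. a i * x i) * iexp (?L \<omega>)) p)"
  proof (rule Bochner_Integration.integral_cong[OF refl])
    fix p assume "p \<in> space (?S \<Otimes>\<^sub>M M)"
    then obtain x \<omega> where p: "p = (x, \<omega>)" "\<omega> \<in> space M" by (auto simp: space_pair_measure)
    show "iexp (\<Sum>t\<in>J. u t * rebuild m n \<phi> h W p t) = (\<lambda>(x, \<omega>). iexp (\<Sum>i\<in>{1..m}. a i * x i) * iexp (?L \<omega>)) p"
      unfolding p(1) dec[OF p(2)] prod.case by (simp only: of_real_add distrib_left exp_add)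
  qed
  also have "\<dots> = (LINT x|?S. LINT \<omega>|M. iexp (\<Sum>i\<in>{1..m}. a i * x i) * iexp (?L \<omega>))"
  proof -
    have "(\<lambda>(x, \<omega>). iexp (\<Sum>i\<in>{1..m}. a i * x i) * iexp (?L \<omega>)) \<in> borel_measurable (?S \<Otimes>\<^sub>M M)"
    proof -
      have [measurable]: "(\<lambda>p. \<Sum>i\<in>{1..m}. a i * fst p i) \<in> borel_measurable (?S \<Otimes>\<^sub>M M)" "(\<lambda>p. ?L (snd p)) \<in> borel_measurable (?S \<Otimes>\<^sub>M M)"
        using measurable_compose[OF measurable_fst xm] measurable_compose[OF measurable_snd Lm] by simp_all
      have "(\<lambda>p. iexp (\<Sum>i\<in>{1..m}. a i * fst p i) * iexp (?L (snd p))) \<in> borel_measurable (?S \<Otimes>\<^sub>M M)" by measurable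
      then show ?thesis unfolding case_prod_beta' .
    qed
    then have "integrable (?S \<Otimes>\<^sub>M M) (\<lambda>(x, \<omega>). iexp (\<Sum>i\<in>{1..m}. a i * x i) * iexp (?L \<omega>))"
      by (rule P.integrable_const_bound[where B = 1, rotated]) (rule AE_I2, simp add: norm_mult split: prod.splits)
    from integral_fst'[OF this] show ?thesis by simp
  qed
  also have "\<dots> = (LINT x|?S. iexp (\<Sum>i\<in>{1..m}. a i * x i)) * (LINT \<omega>|M. iexp (?L \<omega>))"
    by (simp only: integral_mult_right_zero integral_mult_left_zero)
  also have "\<dots> = iexp (\<Sum>i\<in>{1..m}. a i * \<theta> i) * complex_of_real (exp (- (\<Sum>i\<in>{1..m}. (a i)\<^sup>2 / n) / 2))
      * complex_of_real (exp (- (LINT x:{0<..1}|lborel. ((\<Sum>t\<in>J. (u t / sqrt n) * indicator {..<t} x) + prim H x)\<^sup>2) / 2))"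
    unfolding sequence_law_char[OF n] brownian_functional(2)[OF BM J H Htot] ..
  also have "(LINT x:{0<..1}|lborel. ((\<Sum>t\<in>J. (u t / sqrt n) * indicator {..<t} x) + prim H x)\<^sup>2)
      = (LINT x:{0<..1}|lborel. (s x)\<^sup>2) / n - (\<Sum>i\<in>{1..m}. (a i)\<^sup>2 / n)"
  proof -
    let ?I = "indicat_real {0<..1::real}"
    have [measurable]: "s \<in> borel_measurable borel" unfolding s_def by measurable
    have sb: "\<bar>s x\<bar> \<le> (\<Sum>t\<in>J. \<bar>u t\<bar>)" for x
      unfolding s_def by (rule order_trans[OF sum_abs]) (intro sum_mono, auto simp: indicator_def)
    have sbi: "integrable lborel (\<lambda>x. ?I x * f x)" if "f \<in> borel_measurable borel" and b: "\<And>x. \<bar>f x\<bar> \<le> C" for f C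
    proof (rule Bochner_Integration.integrable_bound[of _ "\<lambda>x. C * ?I x"])
      show "AE x in lborel. norm (?I x * f x) \<le> norm (C * ?I x)"
        using b by (intro AE_I2) (auto simp: indicator_def intro: order_trans[OF _ abs_ge_self])
      show "integrable lborel (\<lambda>x. C * ?I x)"
        by (intro integrable_mult_right integrable_real_indicator) auto
      show "(\<lambda>x. ?I x * f x) \<in> borel_measurable lborel"
        unfolding measurable_lborel2 by (intro borel_measurable_times that(1) borel_measurable_indicator) simp
    qed
    have s2i: "integrable lborel (\<lambda>x. ?I x * (s x)\<^sup>2)"
    proof (rule sbi)
      fix x
      have "\<bar>s x\<bar>\<^sup>2 \<le> (\<Sum>t\<in>J. \<bar>u t\<bar>)\<^sup>2" using sb by (intro power_mono) auto
      then show "\<bar>(s x)\<^sup>2\<bar> \<le> (\<Sum>t\<in>J. \<bar>u t\<bar>)\<^sup>2" by simp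
    qed measurable
    have \<phi>m: "\<phi> i \<in> borel_measurable borel" if "i \<in> {1..m}" for i by (rule supp_sqD[OF \<phi>[OF that]])
    have I\<phi>: "AE x in lborel. ?I x * \<phi> i x = \<phi> i x" if "i \<in> {1..m}" for i
      using AE_lborel_singleton[of 0]
    proof eventually_elim
      case (elim x)
      then show ?case using supp_sqD(3)[OF \<phi>[OF that], of x] by (cases "x \<in> {0..1}") auto
    qed
    have tphi: "integrable lborel (\<lambda>x. ?I x * (indicator {..<t} x * \<phi> i x))" if "i \<in> {1..m}" for i t
    proof -
      have "integrable lborel (\<lambda>x. (?I x * indicator {..<t} x) *\<^sub>R \<phi> i x)"
        using integrable_mult_indicator[OF _ supp_sq_integrable[OF \<phi>[OF that]], of "{0<..1} \<inter> {..<t}"]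
        by (simp add: indicator_inter_arith)
      then show ?thesis by (simp add: mult.assoc)
    qed
    have s\<phi>eq: "?I x * (s x * \<phi> i x) = (\<Sum>t\<in>J. u t * (?I x * (indicator {..<t} x * \<phi> i x)))" for i x
      by (simp add: s_def sum_distrib_left sum_distrib_right mult_ac)
    have s\<phi>i: "integrable lborel (\<lambda>x. ?I x * (s x * \<phi> i x))" if "i \<in> {1..m}" for i
      unfolding s\<phi>eq by (intro Bochner_Integration.integrable_sum integrable_mult_right tphi that)
    have s\<phi>: "(LINT x|lborel. ?I x * (s x * \<phi> i x)) = a i" if "i \<in> {1..m}" for i
    proof -
      have "(LINT x|lborel. ?I x * (s x * \<phi> i x)) = (\<Sum>t\<in>J. u t * (LINT x|lborel. ?I x * (indicator {..<t} x * \<phi> i x)))"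
        unfolding s\<phi>eq using tphi[OF that] by (subst Bochner_Integration.integral_sum) (auto intro!: integrable_mult_right)
      also have "\<dots> = a i"
        unfolding a_def using phi_int_indicator[OF _ that] J(2)
        by (intro sum.cong refl) (auto simp: set_lebesgue_integral_def)
      finally show ?thesis .
    qed
    have \<phi>\<phi>i: "integrable lborel (\<lambda>x. \<phi> i x * \<phi> j x)" if "i \<in> {1..m}" "j \<in> {1..m}" for i j
    proof -
      have "continuous_on {0..1} (\<phi> j)" unfolding \<phi>h[OF that(2)] by (rule continuous_prim[OF h[OF that(2)]])
      then show ?thesis by (rule supp_sq_mult_integrable[OF \<phi>[OF that(1)]])
    qed
    \<comment> \<open>To the left of 0 the step function \<open>s\<close> is a constant, in general
      nonzero, so it is cut to (0,1] before the expansion over the whole line.\<close>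
    define U where "U x = ?I x * s x" for x
    have U\<phi>: "U x * \<phi> i x = ?I x * (s x * \<phi> i x)" for i x by (simp only: U_def mult.assoc)
    have U2: "(U x)\<^sup>2 = ?I x * (s x)\<^sup>2" for x by (simp add: U_def indicator_def)
    have "(LINT x|lborel. (U x - (\<Sum>i\<in>{1..m}. (LINT x|lborel. U x * \<phi> i x) * \<phi> i x))\<^sup>2)
        = (LINT x|lborel. (U x)\<^sup>2) - (\<Sum>i\<in>{1..m}. (LINT x|lborel. U x * \<phi> i x)\<^sup>2)"
    proof (rule orthonormal_expansion[OF _ _ _ \<phi>\<phi>i ortho])
      show "integrable lborel (\<lambda>x. (U x)\<^sup>2)" unfolding U2 by (rule s2i)
      show "integrable lborel (\<lambda>x. U x * \<phi> i x)" if "i \<in> {1..m}" for i unfolding U\<phi> by (rule s\<phi>i[OF that])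
    qed auto
    moreover have "(\<Sum>i\<in>{1..m}. (LINT x|lborel. U x * \<phi> i x) * \<phi> i x) = (\<Sum>i\<in>{1..m}. a i * \<phi> i x)" for x
      unfolding U\<phi> by (intro sum.cong refl) (simp only: s\<phi>)
    moreover have "(\<Sum>i\<in>{1..m}. (LINT x|lborel. U x * \<phi> i x)\<^sup>2) = (\<Sum>i\<in>{1..m}. (a i)\<^sup>2)"
      unfolding U\<phi> by (intro sum.cong refl) (simp only: s\<phi>)
    ultimately have ex: "(LINT x|lborel. (U x - (\<Sum>i\<in>{1..m}. a i * \<phi> i x))\<^sup>2) = (LINT x|lborel. ?I x * (s x)\<^sup>2) - (\<Sum>i\<in>{1..m}. (a i)\<^sup>2)"
      by (simp only: U2)
    have "(LINT x:{0<..1}|lborel. ((\<Sum>t\<in>J. (u t / sqrt n) * indicator {..<t} x) + prim H x)\<^sup>2)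
      = (LINT x|lborel. (U x - (\<Sum>i\<in>{1..m}. a i * \<phi> i x))\<^sup>2 / n)"
      unfolding set_lebesgue_integral_def real_scaleR_def
    proof (rule integral_cong_AE)
      have [measurable]: "prim H \<in> borel_measurable borel" by (rule borel_measurable_continuous_onI[OF continuous_prim[OF H]])
      show "(\<lambda>x. ?I x * ((\<Sum>t\<in>J. (u t / sqrt n) * indicator {..<t} x) + prim H x)\<^sup>2) \<in> borel_measurable lborel" by measurable
      have [measurable]: "U \<in> borel_measurable borel" unfolding U_def[abs_def] by measurable
      have [measurable]: "(\<lambda>x. \<Sum>i\<in>{1..m}. a i * \<phi> i x) \<in> borel_measurable borel"
        by (intro borel_measurable_sum borel_measurable_times borel_measurable_const \<phi>m)
      show "(\<lambda>x. (U x - (\<Sum>i\<in>{1..m}. a i * \<phi> i x))\<^sup>2 / n) \<in> borel_measurable lborel" by measurable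
      have "AE x in lborel. \<forall>i\<in>{1..m}. ?I x * \<phi> i x = \<phi> i x"
        by (rule AE_finite_allI[OF _ I\<phi>]) simp
      then show "AE x in lborel. ?I x * ((\<Sum>t\<in>J. (u t / sqrt n) * indicator {..<t} x) + prim H x)\<^sup>2
          = (U x - (\<Sum>i\<in>{1..m}. a i * \<phi> i x))\<^sup>2 / n"
      proof eventually_elim
        case (elim x)
        define F where "F = (\<Sum>i\<in>{1..m}. a i * \<phi> i x)"
        have "(\<Sum>t\<in>J. (u t / sqrt n) * indicator {..<t} x) + prim H x = (s x - F) / sqrt n"
          unfolding Hprim s_def F_def by (simp add: sum_divide_distrib sum_negf diff_divide_distrib)
        then have "?I x * ((\<Sum>t\<in>J. (u t / sqrt n) * indicator {..<t} x) + prim H x)\<^sup>2 = ?I x * ((s x - F) / sqrt n)\<^sup>2"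
          by (simp only:)
        also have "\<dots> = (?I x * s x - ?I x * F)\<^sup>2 / n"
          using n by (auto simp: power_divide indicator_def)
        also have "?I x * F = F" unfolding F_def using elim by (auto simp: sum_distrib_left mult.left_commute intro!: sum.cong)
        finally show ?case by (simp only: F_def U_def)
      qed
    qed
    also have "\<dots> = ((LINT x|lborel. ?I x * (s x)\<^sup>2) - (\<Sum>i\<in>{1..m}. (a i)\<^sup>2)) / n"
      unfolding integral_divide_zero ex ..
    finally show ?thesis
      by (simp add: set_lebesgue_integral_def diff_divide_distrib sum_divide_distrib)
  qed
  finally show ?thesis
    by (simp add: mult.assoc exp_add[symmetric] flip: of_real_mult)
       (simp add: algebra_simps diff_divide_distrib)
qed

text \<open>Sufficiency of the sequence observation: \<open>rebuild\<close> does not contain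
  \<theta>, which enters through the law of \<open>x\<close> alone. Equal characteristic functions
  for all finite families of coordinates give equal laws of paths.\<close>

lemma law_rebuild:
  "distr (sequence_law m n \<theta> \<Otimes>\<^sub>M M) path_space (rebuild m n \<phi> h W) = white_noise_law M W n (\<lambda>x. \<Sum>i\<in>{1..m}. \<theta> i * \<phi> i x)"
proof -
  let ?S = "sequence_law m n \<theta>"
  interpret S: prob_space ?S by (rule prob_space_sequence_law)
  interpret M: prob_space M by (rule prob_M)
  interpret pair_prob_space ?S M ..
  have P: "prob_space (?S \<Otimes>\<^sub>M M)" by (rule P.prob_space_axioms)
  have comp: "(\<lambda>w. w t) \<in> borel_measurable path_space" if "t \<in> {0..1}" for t
    unfolding path_space_def using that by (intro measurable_restrict_space1 measurable_component_singleton)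
  have "distr (?S \<Otimes>\<^sub>M M) path_space (rebuild m n \<phi> h W) = distr M path_space (obs \<theta>)"
  proof (rule distr_path_space_eqI[OF rebuild_measurable obs_measurable P prob_M])
    fix J A assume J: "finite J" "J \<subseteq> {0..1::real}" and A: "\<And>t. t \<in> J \<Longrightarrow> A t \<in> sets (borel :: real measure)"
    show "(LINT p|(?S \<Otimes>\<^sub>M M). (\<Prod>t\<in>J. indicat_real (A t) (rebuild m n \<phi> h W p t))) = (LINT \<omega>|M. (\<Prod>t\<in>J. indicat_real (A t) (obs \<theta> \<omega> t)))"
    proof (rule joint_law_eq_by_char[OF P prob_M J(1)])
      show "(\<lambda>p. rebuild m n \<phi> h W p t) \<in> borel_measurable (?S \<Otimes>\<^sub>M M)" if "t \<in> J" for t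
        using J(2) that by (intro measurable_compose[OF rebuild_measurable comp]) auto
      show "(\<lambda>\<omega>. obs \<theta> \<omega> t) \<in> borel_measurable M" if "t \<in> J" for t
        using J(2) that by (intro measurable_compose[OF obs_measurable comp]) auto
      show "(LINT p|(?S \<Otimes>\<^sub>M M). iexp (\<Sum>t\<in>J. u t * rebuild m n \<phi> h W p t)) = (LINT \<omega>|M. iexp (\<Sum>t\<in>J. u t * obs \<theta> \<omega> t))" for u
        unfolding char_rebuild[OF J] char_obs[OF J] ..
    qed (rule A)
  qed
  then show ?thesis by (simp add: white_noise_law_def obs_def[abs_def])
qed

end

section \<open>The averaged estimator\<close>

text \<open>Jensen's inequality for the square, in extended values: an infinite right-hand side is
  trivial, and a finite one supplies the integrability that Cauchy-Schwarz asks for.\<close>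

lemma square_integral_le_nn_integral:
  fixes f :: "'a \<Rightarrow> real"
  assumes "prob_space M" and f: "f \<in> borel_measurable M"
  shows "ennreal ((integral\<^sup>L M f)\<^sup>2) \<le> (\<integral>\<^sup>+x. ennreal ((f x)\<^sup>2) \<partial>M)"
proof -
  interpret prob_space M by fact
  show ?thesis
  proof (cases "(\<integral>\<^sup>+x. ennreal ((f x)\<^sup>2) \<partial>M) = \<infinity>")
    case False
    then have i2: "integrable M (\<lambda>x. (f x)\<^sup>2)"
      using f by (intro integrableI_bounded) (auto simp: less_top)
    have i: "integrable M f" using f i2 by (rule square_integrable_imp_integrable)
    have "(integral\<^sup>L M (\<lambda>x. 1 * f x))\<^sup>2 \<le> integral\<^sup>L M (\<lambda>x. 1\<^sup>2) * integral\<^sup>L M (\<lambda>x. (f x)\<^sup>2)"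
      using i i2 by (intro integral_Cauchy_Schwarz) auto
    then have "(integral\<^sup>L M f)\<^sup>2 \<le> integral\<^sup>L M (\<lambda>x. (f x)\<^sup>2)" by (simp add: prob_space)
    then show ?thesis using nn_integral_eq_integral[OF i2] by (simp add: ennreal_leI)
  qed simp
qed

text \<open>As a probability space the unit interval pairs with the law of the data, so that
  Fubini's theorem and the embedding of L2 into L1 are available on the product.\<close>

abbreviation unit_interval :: "real measure" where
  "unit_interval \<equiv> restrict_space lborel {0..1}"

lemma prob_space_unit_interval: "prob_space unit_interval"
  by (rule prob_spaceI) (simp add: emeasure_restrict_space space_restrict_space)

context white_noise_basis
begin

definition smooth_coeff :: "((real \<Rightarrow> real) \<Rightarrow> real \<Rightarrow> real) \<Rightarrow> nat \<Rightarrow> (real \<Rightarrow> real) \<Rightarrow> real" where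
  "smooth_coeff fhat i y = (LINT t|unit_interval. fhat y t * \<phi> i t)"

text \<open>The integral over \<omega> is the conditional expectation given \<open>x\<close>, in a
  version free of \<theta>. Where it does not exist the value defaults to 0, a null event when bias
  and variance are finite.\<close>

definition theta_est :: "((real \<Rightarrow> real) \<Rightarrow> real \<Rightarrow> real) \<Rightarrow> (nat \<Rightarrow> real) \<Rightarrow> nat \<Rightarrow> real" where
  "theta_est fhat x = (\<lambda>i\<in>{1..m}. LINT \<omega>|M. smooth_coeff fhat i (rebuild m n \<phi> h W (x, \<omega>)))"

section \<open>The orthonormal family on the unit interval\<close>

lemma phi_continuous: "i \<in> {1..m} \<Longrightarrow> continuous_on S (\<phi> i)"
  using continuous_prim[OF h] \<phi>h by simp

lemma phi_measurable: "i \<in> {1..m} \<Longrightarrow> \<phi> i \<in> borel_measurable unit_interval"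
  using supp_sqD(1)[OF \<phi>] by (intro measurable_restrict_space1) simp

lemma phi_bounded:
  obtains C where "C \<ge> 0" "\<And>i t. i \<in> {1..m} \<Longrightarrow> \<bar>\<phi> i t\<bar> \<le> C"
proof -
  have "\<exists>B. \<forall>t. \<bar>\<phi> i t\<bar> \<le> B" if i: "i \<in> {1..m}" for i
  proof -
    have "bounded (\<phi> i ` {0..1})"
      by (intro compact_imp_bounded compact_continuous_image phi_continuous i) simp
    then obtain B where B: "\<And>t. t \<in> {0..1} \<Longrightarrow> \<bar>\<phi> i t\<bar> \<le> B"
      unfolding bounded_iff by (metis imageI real_norm_def)
    have "\<bar>\<phi> i t\<bar> \<le> \<bar>B\<bar>" for t
      using B[of t] supp_sqD(3)[OF \<phi>[OF i], of t] by (cases "t \<in> {0..1}") auto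
    then show ?thesis by blast
  qed
  then obtain B where B: "\<And>i t. i \<in> {1..m} \<Longrightarrow> \<bar>\<phi> i t\<bar> \<le> B i" by metis
  have "\<bar>\<phi> i t\<bar> \<le> (\<Sum>i\<in>{1..m}. \<bar>B i\<bar>)" if "i \<in> {1..m}" for i t
  proof -
    have "\<bar>\<phi> i t\<bar> \<le> \<bar>B i\<bar>" using B[OF that, of t] by linarith
    also have "\<dots> \<le> (\<Sum>i\<in>{1..m}. \<bar>B i\<bar>)" using that by (intro member_le_sum) auto
    finally show ?thesis .
  qed
  then show thesis by (intro that[of "\<Sum>i\<in>{1..m}. \<bar>B i\<bar>"] sum_nonneg) auto
qed

lemma unit_integral:
  fixes f :: "real \<Rightarrow> real"
  assumes "\<And>t. t \<notin> {0..1} \<Longrightarrow> f t = 0"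
  shows "(LINT t|unit_interval. f t) = (LINT t|lborel. f t)"
proof -
  have "(LINT t|unit_interval. f t) = (LINT t|lborel. indicator {0..1} t *\<^sub>R f t)"
    by (rule integral_restrict_space) simp
  also have "\<dots> = (LINT t|lborel. f t)"
    using assms by (intro Bochner_Integration.integral_cong) (auto simp: indicator_def)
  finally show ?thesis .
qed

lemma phi_phi_integrable:
  assumes "i \<in> {1..m}" "j \<in> {1..m}"
  shows "integrable unit_interval (\<lambda>t. \<phi> i t * \<phi> j t)"
proof -
  have "integrable lborel (\<lambda>t. \<phi> i t * \<phi> j t)"
    by (rule supp_sq_mult_integrable[OF \<phi>[OF assms(1)] phi_continuous[OF assms(2)]])
  from integrable_mult_indicator[OF _ this, of "{0..1}"] show ?thesis by (simp add: integrable_restrict_space)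
qed

lemma ortho_unit:
  assumes "i \<in> {1..m}" "j \<in> {1..m}"
  shows "(LINT t|unit_interval. \<phi> i t * \<phi> j t) = (if i = j then 1 else 0)"
  unfolding ortho[OF assms, symmetric]
  by (rule unit_integral) (use supp_sqD(3)[OF \<phi>[OF assms(1)]] in auto)

text \<open>In extended values an infinite right-hand side is trivial, so the inequality applies to
  every section of the centred estimate, square integrable or not.\<close>

lemma Bessel_unit:
  fixes u :: "real \<Rightarrow> real"
  assumes u: "u \<in> borel_measurable unit_interval"
  shows "ennreal (\<Sum>i\<in>{1..m}. (LINT t|unit_interval. u t * \<phi> i t)\<^sup>2) \<le> (\<integral>\<^sup>+t. ennreal ((u t)\<^sup>2) \<partial>unit_interval)"
proof (cases "(\<integral>\<^sup>+t. ennreal ((u t)\<^sup>2) \<partial>unit_interval) = \<infinity>")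
  case False
  then have u2: "integrable unit_interval (\<lambda>t. (u t)\<^sup>2)"
    using u by (intro integrableI_bounded) (auto simp: less_top)
  have u\<phi>: "integrable unit_interval (\<lambda>t. u t * \<phi> i t)" if "i \<in> {1..m}" for i
  proof (rule Bochner_Integration.integrable_bound)
    have "integrable unit_interval (\<lambda>t. \<phi> i t * \<phi> i t)" by (rule phi_phi_integrable[OF that that])
    with u2 show "integrable unit_interval (\<lambda>t. (u t)\<^sup>2 + \<phi> i t * \<phi> i t)" by (rule Bochner_Integration.integrable_add)
    show "(\<lambda>t. u t * \<phi> i t) \<in> borel_measurable unit_interval" using u phi_measurable[OF that] by (rule borel_measurable_times)
    have "\<bar>p * q\<bar> \<le> \<bar>p\<^sup>2 + q * q\<bar>" for p q :: real
    proof -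
      have "2 * \<bar>p\<bar> * \<bar>q\<bar> \<le> p\<^sup>2 + q\<^sup>2" using sum_squares_bound[of "\<bar>p\<bar>" "\<bar>q\<bar>"] by simp
      moreover have "0 \<le> \<bar>p\<bar> * \<bar>q\<bar>" by simp
      ultimately have "\<bar>p\<bar> * \<bar>q\<bar> \<le> p\<^sup>2 + q\<^sup>2" by linarith
      then show ?thesis by (simp add: abs_mult power2_eq_square)
    qed
    then show "AE t in unit_interval. norm (u t * \<phi> i t) \<le> norm ((u t)\<^sup>2 + \<phi> i t * \<phi> i t)" by simp
  qed
  have "(\<Sum>i\<in>{1..m}. (LINT t|unit_interval. u t * \<phi> i t)\<^sup>2) \<le> (LINT t|unit_interval. (u t)\<^sup>2)"
    by (rule Bessel_inequality[OF _ u2 u\<phi> phi_phi_integrable ortho_unit]) auto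
  then show ?thesis using nn_integral_eq_integral[OF u2] by (simp add: ennreal_leI)
qed simp

text \<open>Finite integrated variance puts the centred estimate in L2 of the product space, and
  finite integrated bias puts \<open>e - f\<close> in L2 of the interval. Together they make
  \<open>fhat\<close> integrable on the product, which justifies the exchanges of integrals.\<close>

lemma estimator_bounds:
  fixes \<theta> :: "nat \<Rightarrow> real"
  defines "f \<equiv> \<lambda>x. \<Sum>i\<in>{1..m}. \<theta> i * \<phi> i x" and "P \<equiv> white_noise_law M W n"
  assumes fhat: "(\<lambda>(y, x). fhat y x) \<in> borel_measurable (path_space \<Otimes>\<^sub>M restrict_space borel {0..1})"
    and bias: "IBias_sq P f fhat < \<infinity>" and var: "IVar P f fhat < \<infinity>"
  shows "\<And>i. i \<in> {1..m} \<Longrightarrow> integrable (sequence_law m n \<theta>) (\<lambda>x. theta_est fhat x i)"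
    and "ennreal ((L2_set (\<lambda>i. (\<integral>x. theta_est fhat x i \<partial>sequence_law m n \<theta>) - \<theta> i) {1..m})\<^sup>2) \<le> IBias_sq P f fhat"
    and "(\<Sum>i=1..m. ext_variance (sequence_law m n \<theta>) (\<lambda>x. theta_est fhat x i)) \<le> IVar P f fhat"
proof -
  let ?S = "sequence_law m n \<theta>" and ?Q = "P f" and ?U = unit_interval
  let ?g = "rebuild m n \<phi> h W"
  interpret S: prob_space ?S by (rule prob_space_sequence_law)
  interpret M: prob_space M by (rule prob_M)
  interpret SM: pair_prob_space ?S M ..
  have Q: "?Q = distr (?S \<Otimes>\<^sub>M M) path_space ?g"
    unfolding P_def f_def by (rule law_rebuild[symmetric])
  interpret Q: prob_space ?Q
    unfolding Q by (rule SM.P.prob_space_distr[OF rebuild_measurable])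
  interpret U: prob_space ?U by (rule prob_space_unit_interval)
  interpret QU: pair_prob_space ?Q ?U ..
  have setsQ [measurable_cong]: "sets ?Q = sets path_space" unfolding Q by simp
  have setsU: "sets ?U = sets (restrict_space borel {0..1::real})" by (simp cong: sets_restrict_space_cong)
  have fhatQ: "case_prod fhat \<in> borel_measurable (?Q \<Otimes>\<^sub>M ?U)"
    using fhat by (subst measurable_cong_sets[OF sets_pair_measure_cong[OF setsQ setsU] refl])
  define e where "e t = (LINT y|?Q. fhat y t)" for t
  define v where "v y t = fhat y t - e t" for y t
  have em: "e \<in> borel_measurable ?U"
    unfolding e_def
    by (rule Q.borel_measurable_lebesgue_integral) (use measurable_pair_swap[OF fhatQ] in simp)
  have fm: "f \<in> borel_measurable ?U"
    unfolding f_def by (intro borel_measurable_sum borel_measurable_times borel_measurable_const phi_measurable)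
  have vm: "case_prod v \<in> borel_measurable (?Q \<Otimes>\<^sub>M ?U)"
  proof -
    have "(\<lambda>p. case_prod fhat p - e (snd p)) \<in> borel_measurable (?Q \<Otimes>\<^sub>M ?U)"
      by (intro borel_measurable_diff fhatQ measurable_compose[OF measurable_snd em])
    then show ?thesis by (simp add: v_def case_prod_beta')
  qed
  have restr: "(\<integral>\<^sup>+x\<in>{0..1}. k x \<partial>lborel) = (\<integral>\<^sup>+x. k x \<partial>?U)" for k
    by (subst nn_integral_restrict_space) auto
  have bias_eq: "IBias_sq P f fhat = (\<integral>\<^sup>+t. ennreal ((e t - f t)\<^sup>2) \<partial>?U)"
    unfolding IBias_sq_def restr e_def ..
  have var_eq: "IVar P f fhat = (\<integral>\<^sup>+t. (\<integral>\<^sup>+y. ennreal ((v y t)\<^sup>2) \<partial>?Q) \<partial>?U)"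
    unfolding IVar_def restr ext_variance_def v_def e_def ..
  have v2m: "(\<lambda>p. ennreal ((case_prod v p)\<^sup>2)) \<in> borel_measurable (?Q \<Otimes>\<^sub>M ?U)"
    using vm by measurable
  have var_prod: "IVar P f fhat = (\<integral>\<^sup>+p. ennreal ((case_prod v p)\<^sup>2) \<partial>(?Q \<Otimes>\<^sub>M ?U))"
    unfolding var_eq using QU.nn_integral_snd[OF v2m] by simp
  have iv: "integrable (?Q \<Otimes>\<^sub>M ?U) (case_prod v)"
  proof (rule QU.P.square_integrable_imp_integrable[OF vm])
    show "integrable (?Q \<Otimes>\<^sub>M ?U) (\<lambda>p. (case_prod v p)\<^sup>2)"
    proof (rule integrableI_bounded)
      show "(\<lambda>p. (case_prod v p)\<^sup>2) \<in> borel_measurable (?Q \<Otimes>\<^sub>M ?U)" using vm by (rule borel_measurable_power)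
      show "(\<integral>\<^sup>+p. ennreal (norm ((case_prod v p)\<^sup>2)) \<partial>(?Q \<Otimes>\<^sub>M ?U)) < \<infinity>"
        using var unfolding var_prod by simp
    qed
  qed
  obtain C where C0: "C \<ge> 0" and C: "\<And>i t. i \<in> {1..m} \<Longrightarrow> \<bar>\<phi> i t\<bar> \<le> C" using phi_bounded by blast
  have if1: "integrable ?U f"
  proof (rule U.integrable_const_bound[where B = "\<Sum>i\<in>{1..m}. \<bar>\<theta> i\<bar> * C", OF _ fm], rule AE_I2)
    fix t
    have "\<bar>f t\<bar> \<le> (\<Sum>i\<in>{1..m}. \<bar>\<theta> i * \<phi> i t\<bar>)" unfolding f_def by (rule sum_abs)
    also have "\<dots> \<le> (\<Sum>i\<in>{1..m}. \<bar>\<theta> i\<bar> * C)"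
      unfolding abs_mult by (intro sum_mono mult_left_mono C) auto
    finally show "norm (f t) \<le> (\<Sum>i\<in>{1..m}. \<bar>\<theta> i\<bar> * C)" by simp
  qed
  have ief: "integrable ?U (\<lambda>t. e t - f t)"
  proof (rule U.square_integrable_imp_integrable)
    show "(\<lambda>t. e t - f t) \<in> borel_measurable ?U" using em fm by (rule borel_measurable_diff)
    then show "integrable ?U (\<lambda>t. (e t - f t)\<^sup>2)"
      using bias unfolding bias_eq by (intro integrableI_bounded borel_measurable_power) simp_all
  qed
  have ie: "integrable ?U e" using Bochner_Integration.integrable_add[OF ief if1] by simp
  have mult_phi: "integrable ?U (\<lambda>t. k t * \<phi> i t)" if "integrable ?U k" "i \<in> {1..m}" for k i
  proof (rule Bochner_Integration.integrable_bound)
    show "integrable ?U (\<lambda>t. C * norm (k t))" using that(1) by (intro integrable_mult_right integrable_norm)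
    show "(\<lambda>t. k t * \<phi> i t) \<in> borel_measurable ?U"
      using that by (intro borel_measurable_times phi_measurable) auto
    show "AE t in ?U. norm (k t * \<phi> i t) \<le> norm (C * norm (k t))"
    proof (rule AE_I2)
      fix t
      have "\<bar>k t\<bar> * \<bar>\<phi> i t\<bar> \<le> \<bar>k t\<bar> * C" by (rule mult_left_mono[OF C[OF that(2)]]) simp
      then show "norm (k t * \<phi> i t) \<le> norm (C * norm (k t))" using C0 by (simp add: abs_mult mult.commute)
    qed
  qed
  have iesnd: "integrable (?Q \<Otimes>\<^sub>M ?U) (\<lambda>p. e (snd p))"
  proof (rule QU.Fubini_integrable)
    show "(\<lambda>p. e (snd p)) \<in> borel_measurable (?Q \<Otimes>\<^sub>M ?U)" by (rule measurable_compose[OF measurable_snd em])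
    show "integrable ?Q (\<lambda>x. LINT y|?U. norm (e (snd (x, y))))" by simp
    show "AE x in ?Q. integrable ?U (\<lambda>y. e (snd (x, y)))" using ie by simp
  qed
  have ifhat: "integrable (?Q \<Otimes>\<^sub>M ?U) (case_prod fhat)"
    using Bochner_Integration.integrable_add[OF iv iesnd] by (simp add: v_def case_prod_beta')
  have ifp: "integrable (?Q \<Otimes>\<^sub>M ?U) (\<lambda>(y, t). fhat y t * \<phi> i t)" if i: "i \<in> {1..m}" for i
  proof (rule Bochner_Integration.integrable_bound)
    show "integrable (?Q \<Otimes>\<^sub>M ?U) (\<lambda>p. C * norm (case_prod fhat p))" using ifhat by (intro integrable_mult_right integrable_norm)
    have "(\<lambda>p. case_prod fhat p * \<phi> i (snd p)) \<in> borel_measurable (?Q \<Otimes>\<^sub>M ?U)"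
      by (intro borel_measurable_times fhatQ measurable_compose[OF measurable_snd phi_measurable[OF i]])
    then show "(\<lambda>(y, t). fhat y t * \<phi> i t) \<in> borel_measurable (?Q \<Otimes>\<^sub>M ?U)" by (simp add: case_prod_beta')
    show "AE p in ?Q \<Otimes>\<^sub>M ?U. norm (case p of (y, t) \<Rightarrow> fhat y t * \<phi> i t) \<le> norm (C * norm (case_prod fhat p))"
    proof (rule AE_I2, clarify)
      fix y t
      have "\<bar>fhat y t\<bar> * \<bar>\<phi> i t\<bar> \<le> \<bar>fhat y t\<bar> * C" by (rule mult_left_mono[OF C[OF i]]) simp
      then show "norm (fhat y t * \<phi> i t) \<le> norm (C * norm (fhat y t))" using C0 by (simp add: abs_mult mult.commute)
    qed
  qed
  \<comment> \<open>The common mean of the coefficient of the estimate and of its conditional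
    expectation.\<close>
  define b where "b i = (LINT t|?U. e t * \<phi> i t)" for i
  let ?s = "smooth_coeff fhat"
  have si: "integrable ?Q (?s i)" if "i \<in> {1..m}" for i
    using QU.integrable_fst'[OF ifp[OF that]] by (simp add: smooth_coeff_def[abs_def])
  have sE: "integral\<^sup>L ?Q (?s i) = b i" if "i \<in> {1..m}" for i
  proof -
    have "integral\<^sup>L ?Q (?s i) = (LINT y|?Q. LINT t|?U. fhat y t * \<phi> i t)" by (simp add: smooth_coeff_def[abs_def])
    also have "\<dots> = (LINT t|?U. LINT y|?Q. fhat y t * \<phi> i t)"
      by (rule QU.Fubini_integral[OF ifp[OF that], symmetric])
    also have "\<dots> = b i" unfolding b_def e_def by (simp only: integral_mult_left_zero)
    finally show ?thesis .
  qed
  \<comment> \<open>Almost everywhere only: the integral splits for those paths on which the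
    integrand of the coefficient is integrable.\<close>
  have sv: "AE y in ?Q. ?s i y - b i = (LINT t|?U. v y t * \<phi> i t)" if i: "i \<in> {1..m}" for i
    using QU.AE_integrable_fst'[OF ifp[OF i]]
  proof eventually_elim
    case (elim y)
    have "?s i y - b i = (LINT t|?U. fhat y t * \<phi> i t - e t * \<phi> i t)"
      unfolding smooth_coeff_def b_def
      by (rule Bochner_Integration.integral_diff[symmetric]) (use elim mult_phi[OF ie i] in simp_all)
    then show ?case by (simp only: v_def left_diff_distrib)
  qed
  have sm: "?s i \<in> borel_measurable path_space" if "i \<in> {1..m}" for i
    using borel_measurable_integrable[OF si[OF that]] by (simp cong: measurable_cong_sets add: setsQ)
  have sgi: "integrable (?S \<Otimes>\<^sub>M M) (\<lambda>p. ?s i (?g p))" if "i \<in> {1..m}" for i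
    using si[OF that] unfolding Q by (subst (asm) integrable_distr_eq[OF rebuild_measurable sm[OF that]])
  have T: "theta_est fhat x i = (LINT \<omega>|M. ?s i (?g (x, \<omega>)))" if "i \<in> {1..m}" for i x
    using that by (simp only: theta_est_def restrict_apply')
  have Ti: "integrable ?S (\<lambda>x. theta_est fhat x i)" if "i \<in> {1..m}" for i
    unfolding T[OF that] by (rule SM.integrable_fst'[OF sgi[OF that]])
  have TE: "(LINT x|?S. theta_est fhat x i) = b i" if "i \<in> {1..m}" for i
  proof -
    have "(LINT x|?S. theta_est fhat x i) = (LINT p|(?S \<Otimes>\<^sub>M M). ?s i (?g p))"
      unfolding T[OF that] by (rule SM.integral_fst'[OF sgi[OF that]])
    also have "\<dots> = integral\<^sup>L ?Q (?s i)"
      unfolding Q by (rule integral_distr[symmetric, OF rebuild_measurable sm[OF that]])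
    finally show ?thesis using sE[OF that] by simp
  qed
  show "integrable ?S (\<lambda>x. theta_est fhat x i)" if "i \<in> {1..m}" for i by (rule Ti[OF that])
  show "ennreal ((L2_set (\<lambda>i. (\<integral>x. theta_est fhat x i \<partial>?S) - \<theta> i) {1..m})\<^sup>2) \<le> IBias_sq P f fhat"
  proof -
    \<comment> \<open>Orthonormality recovers \<open>\<theta> i\<close> as the coefficient of
      \<open>f\<close>, so the bias vector consists of the coefficients of
      \<open>e - f\<close>.\<close>
    have coef: "(LINT t|?U. (e t - f t) * \<phi> i t) = b i - \<theta> i" if i: "i \<in> {1..m}" for i
    proof -
      have "(LINT t|?U. f t * \<phi> i t) = (LINT t|?U. (\<Sum>j\<in>{1..m}. \<theta> j * (\<phi> j t * \<phi> i t)))"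
        by (simp only: f_def sum_distrib_right mult.assoc)
      also have "\<dots> = (\<Sum>j\<in>{1..m}. LINT t|?U. \<theta> j * (\<phi> j t * \<phi> i t))"
        by (intro Bochner_Integration.integral_sum integrable_mult_right phi_phi_integrable i)
      also have "\<dots> = (\<Sum>j\<in>{1..m}. if j = i then \<theta> j else 0)"
      proof (intro sum.cong refl)
        fix j assume "j \<in> {1..m}"
        then have "(LINT t|?U. \<theta> j * (\<phi> j t * \<phi> i t)) = \<theta> j * (if j = i then 1 else 0)"
          by (simp only: integral_mult_right_zero ortho_unit[OF _ i])
        then show "(LINT t|?U. \<theta> j * (\<phi> j t * \<phi> i t)) = (if j = i then \<theta> j else 0)" by (cases "j = i") simp_all
      qed
      also have "\<dots> = \<theta> i" using i by (simp add: sum.delta)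
      finally have "(LINT t|?U. f t * \<phi> i t) = \<theta> i" .
      then show ?thesis
        unfolding left_diff_distrib b_def
        using Bochner_Integration.integral_diff[OF mult_phi[OF ie i] mult_phi[OF if1 i]] by simp
    qed
    have "(L2_set (\<lambda>i. (\<integral>x. theta_est fhat x i \<partial>?S) - \<theta> i) {1..m})\<^sup>2 = (\<Sum>i\<in>{1..m}. (LINT t|?U. (e t - f t) * \<phi> i t)\<^sup>2)"
      unfolding L2_set_def by (subst real_sqrt_pow2) (auto intro!: sum_nonneg sum.cong simp: TE coef simp del: One_nat_def)
    then show ?thesis
      unfolding bias_eq using Bessel_unit[OF borel_measurable_diff[OF em fm]] by (simp only:)
  qed
  show "(\<Sum>i=1..m. ext_variance ?S (\<lambda>x. theta_est fhat x i)) \<le> IVar P f fhat"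
  proof -
    have sdm: "(\<lambda>y. ennreal ((?s i y - b i)\<^sup>2)) \<in> borel_measurable path_space" if "i \<in> {1..m}" for i
      using sm[OF that] by measurable
    \<comment> \<open>Conditional Jensen: averaging over \<omega> for fixed \<open>x\<close> can
      only lower the variance, and the equality of laws brings the double integral back to the law
      of the data.\<close>
    have one: "ext_variance ?S (\<lambda>x. theta_est fhat x i) \<le> (\<integral>\<^sup>+y. ennreal ((?s i y - b i)\<^sup>2) \<partial>?Q)" if i: "i \<in> {1..m}" for i
    proof -
      have "ext_variance ?S (\<lambda>x. theta_est fhat x i) = (\<integral>\<^sup>+x. ennreal ((theta_est fhat x i - b i)\<^sup>2) \<partial>?S)"
        unfolding ext_variance_def TE[OF i] ..
      also have "\<dots> \<le> (\<integral>\<^sup>+x. (\<integral>\<^sup>+\<omega>. ennreal ((?s i (?g (x, \<omega>)) - b i)\<^sup>2) \<partial>M) \<partial>?S)"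
      proof (rule nn_integral_mono_AE)
        show "AE x in ?S. ennreal ((theta_est fhat x i - b i)\<^sup>2) \<le> (\<integral>\<^sup>+\<omega>. ennreal ((?s i (?g (x, \<omega>)) - b i)\<^sup>2) \<partial>M)"
          using SM.AE_integrable_fst'[OF sgi[OF i]]
        proof eventually_elim
          case (elim x)
          have "theta_est fhat x i - b i = (LINT \<omega>|M. ?s i (?g (x, \<omega>)) - b i)"
            unfolding T[OF i] using elim by (simp add: M.prob_space)
          moreover have "(\<lambda>\<omega>. ?s i (?g (x, \<omega>)) - b i) \<in> borel_measurable M"
            using elim by (intro borel_measurable_diff borel_measurable_const borel_measurable_integrable)
          ultimately show ?case using square_integral_le_nn_integral[OF M.prob_space_axioms] by (simp only:)
        qed
      qed
      also have "\<dots> = (\<integral>\<^sup>+p. ennreal ((?s i (?g p) - b i)\<^sup>2) \<partial>(?S \<Otimes>\<^sub>M M))"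
        by (rule M.nn_integral_fst) (rule measurable_compose[OF rebuild_measurable sdm[OF i]])
      also have "\<dots> = (\<integral>\<^sup>+y. ennreal ((?s i y - b i)\<^sup>2) \<partial>?Q)"
        unfolding Q by (rule nn_integral_distr[symmetric, OF rebuild_measurable]) (simp only: measurable_distr_eq1 sdm[OF i])
      finally show ?thesis .
    qed
    have "(\<Sum>i\<in>{1..m}. ext_variance ?S (\<lambda>x. theta_est fhat x i)) \<le> (\<Sum>i\<in>{1..m}. \<integral>\<^sup>+y. ennreal ((?s i y - b i)\<^sup>2) \<partial>?Q)"
      by (intro sum_mono one)
    also have "\<dots> = (\<integral>\<^sup>+y. (\<Sum>i\<in>{1..m}. ennreal ((?s i y - b i)\<^sup>2)) \<partial>?Q)"
      by (rule nn_integral_sum[symmetric]) (use sdm in \<open>simp cong: measurable_cong_sets add: setsQ\<close>)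
    \<comment> \<open>Bessel's inequality is applied path by path to the centred estimate; Tonelli's
      theorem then restores the order of integration in the integrated variance.\<close>
    also have "\<dots> \<le> (\<integral>\<^sup>+y. (\<integral>\<^sup>+t. ennreal ((v y t)\<^sup>2) \<partial>?U) \<partial>?Q)"
    proof (rule nn_integral_mono_AE)
      have "AE y in ?Q. \<forall>i\<in>{1..m}. ?s i y - b i = (LINT t|?U. v y t * \<phi> i t)"
        by (rule AE_finite_allI[OF _ sv]) simp
      then show "AE y in ?Q. (\<Sum>i\<in>{1..m}. ennreal ((?s i y - b i)\<^sup>2)) \<le> (\<integral>\<^sup>+t. ennreal ((v y t)\<^sup>2) \<partial>?U)"
        using AE_space
      proof eventually_elim
        case (elim y)
        have "(\<Sum>i\<in>{1..m}. ennreal ((?s i y - b i)\<^sup>2)) = ennreal (\<Sum>i\<in>{1..m}. (LINT t|?U. v y t * \<phi> i t)\<^sup>2)"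
          using elim(1) by (subst sum_ennreal) (auto intro!: arg_cong[where f = ennreal] sum.cong simp del: One_nat_def)
        also have "\<dots> \<le> (\<integral>\<^sup>+t. ennreal ((v y t)\<^sup>2) \<partial>?U)"
          using measurable_Pair2[OF vm elim(2)] by (intro Bessel_unit) simp
        finally show ?case .
      qed
    qed
    also have "\<dots> = IVar P f fhat"
      unfolding var_prod using U.nn_integral_fst[OF v2m] by simp
    finally show ?thesis .
  qed
qed

lemma theta_est_measurable:
  assumes fhat: "(\<lambda>(y, x). fhat y x) \<in> borel_measurable (path_space \<Otimes>\<^sub>M restrict_space borel {0..1})"
  shows "theta_est fhat \<in> measurable (Rm m) (Rm m)"
  unfolding theta_est_def
proof (rule measurable_restrict)
  fix i assume i: "i \<in> {1..m}"
  interpret M: prob_space M by (rule prob_M)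
  interpret U: prob_space unit_interval by (rule prob_space_unit_interval)
  have setsU: "sets unit_interval = sets (restrict_space borel {0..1::real})" by (simp cong: sets_restrict_space_cong)
  have "case_prod fhat \<in> borel_measurable (path_space \<Otimes>\<^sub>M unit_interval)"
    using fhat by (subst measurable_cong_sets[OF sets_pair_measure_cong[OF refl setsU] refl])
  then have "(\<lambda>p. case_prod fhat p * \<phi> i (snd p)) \<in> borel_measurable (path_space \<Otimes>\<^sub>M unit_interval)"
    by (intro borel_measurable_times measurable_compose[OF measurable_snd phi_measurable[OF i]])
  then have "(\<lambda>(y, t). fhat y t * \<phi> i t) \<in> borel_measurable (path_space \<Otimes>\<^sub>M unit_interval)"
    by (simp add: case_prod_beta')
  then have s: "smooth_coeff fhat i \<in> borel_measurable path_space"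
    unfolding smooth_coeff_def[abs_def] by (rule U.borel_measurable_lebesgue_integral)
  have "rebuild m n \<phi> h W \<in> measurable (Rm m \<Otimes>\<^sub>M M) path_space"
  proof -
    \<comment> \<open>Only sigma-algebras are compared, and they are the same for every parameter,
      so \<open>undefined\<close> may stand for \<theta>.\<close>
    have "measurable (sequence_law m n undefined \<Otimes>\<^sub>M M) path_space = measurable (Rm m \<Otimes>\<^sub>M M) path_space"
      by (rule measurable_cong_sets[OF sets_pair_measure_cong[OF sets_sequence_law refl] refl])
    with rebuild_measurable[of undefined] show ?thesis by (simp only:)
  qed
  from measurable_compose[OF this s]
  show "(\<lambda>x. LINT \<omega>|M. smooth_coeff fhat i (rebuild m n \<phi> h W (x, \<omega>))) \<in> borel_measurable (Rm m)"
    by (intro M.borel_measurable_lebesgue_integral) (simp add: case_prod_beta')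
qed

end

text \<open>The noise is centred, so the observation is an unbiased estimator; this serves the case
  of infinite integrated variance.\<close>

lemma sequence_law_mean:
  assumes i: "i \<in> {1..m}"
  shows "integrable (sequence_law m n \<theta>) (\<lambda>x. x i)" and "(\<integral>x. x i \<partial>sequence_law m n \<theta>) = \<theta> i"
proof -
  let ?N = "\<lambda>_::nat. std_normal_distribution"
  interpret product_prob_space ?N "{1..m}"
    by (intro product_prob_spaceI prob_space_normal_density) simp
  have c: "(\<lambda>e. e i) \<in> measurable (PiM {1..m} ?N) std_normal_distribution"
    by (rule measurable_component_singleton[OF i])
  have r: "(\<lambda>e. \<lambda>i\<in>{1..m}. \<theta> i + e i / sqrt n) \<in> measurable (PiM {1..m} ?N) (Rm m)"
    by (intro measurable_restrict borel_measurable_add borel_measurable_divide borel_measurable_const) auto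
  have xi: "(\<lambda>x. x i) \<in> borel_measurable (Rm m)"
    using i by (intro measurable_component_singleton)
  have D: "distr (PiM {1..m} ?N) std_normal_distribution (\<lambda>e. e i) = std_normal_distribution"
    by (rule PiM_component[OF i])
  have i1: "integrable std_normal_distribution (\<lambda>x. x)"
    using integrable_std_normal_distribution_moment[of 1] by simp
  have m1: "(LINT x|std_normal_distribution. x) = 0"
    using integral_std_normal_distribution_moment_odd[of 1] by simp
  have "integrable (distr (PiM {1..m} ?N) std_normal_distribution (\<lambda>e. e i)) (\<lambda>x. x)"
    unfolding D by (rule i1)
  from integrable_distr[OF c this] have ie: "integrable (PiM {1..m} ?N) (\<lambda>e. e i)" .
  have "(LINT e|PiM {1..m} ?N. e i) = (LINT x|distr (PiM {1..m} ?N) std_normal_distribution (\<lambda>e. e i). x)"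
    by (rule integral_distr[symmetric, OF c]) simp
  then have me: "(LINT e|PiM {1..m} ?N. e i) = 0" unfolding D m1 .
  have eq: "(\<lambda>i\<in>{1..m}. \<theta> i + e i / sqrt n) i = \<theta> i + e i / sqrt n" for e :: "nat \<Rightarrow> real"
    using i by (rule restrict_apply')
  have int: "integrable (PiM {1..m} ?N) (\<lambda>e. \<theta> i + e i / sqrt n)"
    using ie by (intro Bochner_Integration.integrable_add integrable_const integrable_divide) auto
  show "integrable (sequence_law m n \<theta>) (\<lambda>x. x i)"
    unfolding sequence_law_def integrable_distr_eq[OF r xi] eq by (rule int)
  show "(\<integral>x. x i \<partial>sequence_law m n \<theta>) = \<theta> i"
  proof -
    have "(LINT e|PiM {1..m} ?N. \<theta> i + e i / sqrt n)
        = (LINT e|PiM {1..m} ?N. \<theta> i) + (LINT e|PiM {1..m} ?N. e i / sqrt n)"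
      by (intro Bochner_Integration.integral_add integrable_const integrable_divide impI ie)
    also have "(LINT e|PiM {1..m} ?N. e i / sqrt n) = 0"
      unfolding integral_divide_zero me by simp
    also have "(LINT e|PiM {1..m} ?N. \<theta> i) = \<theta> i"
      unfolding lebesgue_integral_const P.prob_space by simp
    finally show ?thesis
      unfolding sequence_law_def integral_distr[OF r xi] eq by simp
  qed
qed

theorem proposition5p3:
  fixes m \<beta> :: nat and R n :: real
    and M :: "'a measure" and W :: "real \<Rightarrow> 'a \<Rightarrow> real"
    and fhat :: "(real \<Rightarrow> real) \<Rightarrow> real \<Rightarrow> real"
  assumes "m > 0" and "\<beta> > 0" and "R > 0" and "n > 0"
    and "standard_brownian_motion M W"
    and "is_regression_estimator (white_noise_law M W n) (sobolev_ball \<beta> R) fhat"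
  shows "\<exists>\<theta>hat \<in> measurable (Rm m) (Rm m).
      (\<forall>\<theta>\<in>Theta_ball m \<beta> R. \<forall>i\<in>{1..m}. integrable (sequence_law m n \<theta>) (\<lambda>x. \<theta>hat x i)) \<and>
      (SUP \<theta>\<in>Theta_ball m \<beta> R.
          ennreal ((L2_set (\<lambda>i. (\<integral>x. \<theta>hat x i \<partial>sequence_law m n \<theta>) - \<theta> i) {1..m})\<^sup>2))
        \<le> (SUP f\<in>sobolev_ball \<beta> R. IBias_sq (white_noise_law M W n) f fhat) \<and>
      (SUP \<theta>\<in>Theta_ball m \<beta> R.
          \<Sum>i=1..m. ext_variance (sequence_law m n \<theta>) (\<lambda>x. \<theta>hat x i))
        \<le> (SUP f\<in>sobolev_ball \<beta> R. IVar (white_noise_law M W n) f fhat)"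
proof -
  let ?P = "white_noise_law M W n"
  let ?B = "SUP f\<in>sobolev_ball \<beta> R. IBias_sq ?P f fhat" and ?V = "SUP f\<in>sobolev_ball \<beta> R. IVar ?P f fhat"
  have fhat: "(\<lambda>(y, x). fhat y x) \<in> borel_measurable (path_space \<Otimes>\<^sub>M restrict_space borel {0..1})"
    using assms(6) by (simp add: is_regression_estimator_def)
  obtain \<phi> h :: "nat \<Rightarrow> real \<Rightarrow> real"
    where h: "\<And>i. i \<in> {1..m} \<Longrightarrow> supp_sq 0 1 (h i)" and \<phi>h: "\<And>i. i \<in> {1..m} \<Longrightarrow> \<phi> i = prim (h i)"
      and \<phi>: "\<And>i. i \<in> {1..m} \<Longrightarrow> supp_sq 0 1 (\<phi> i)"
      and ortho: "\<And>i j. i \<in> {1..m} \<Longrightarrow> j \<in> {1..m} \<Longrightarrow> (LINT x|lborel. \<phi> i x * \<phi> j x) = (if i = j then 1 else 0)"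
      and ball: "\<And>\<theta>. \<theta> \<in> Theta_ball m \<beta> R \<Longrightarrow> (\<lambda>x. \<Sum>i\<in>{1..m}. \<theta> i * \<phi> i x) \<in> sobolev_ball \<beta> R"
    by (rule sobolev_ball_basis[OF assms(1-3)]) (rule that)
  interpret white_noise_basis m n M W \<phi> h
    by (rule white_noise_basis.intro[OF assms(4,5) h \<phi>h \<phi> ortho])
  txt \<open>If one supremum is infinite, only the other bound matters: the zero estimator has no variance, and
    the observation itself has no bias.\<close>
  consider "?B = \<infinity>" | "?V = \<infinity>" | "?B < \<infinity>" "?V < \<infinity>"
    using less_top[of ?B] less_top[of ?V] unfolding infinity_ennreal_def by blast
  then show ?thesis
  proof cases
    case 1
    have v: "ext_variance (sequence_law m n \<theta>) (\<lambda>x. (\<lambda>i\<in>{1..m}. 0) i) = 0" for \<theta> and i :: nat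
    proof -
      interpret prob_space "sequence_law m n \<theta>" by (rule prob_space_sequence_law)
      show ?thesis by (simp add: ext_variance_def prob_space)
    qed
    have "(\<lambda>x. \<lambda>i\<in>{1..m}. 0) \<in> measurable (Rm m) (Rm m)"
      by (intro measurable_restrict) simp
    moreover have "integrable (sequence_law m n \<theta>) (\<lambda>x. (\<lambda>i\<in>{1..m}. 0 :: real) i)" for \<theta> i
    proof -
      interpret prob_space "sequence_law m n \<theta>" by (rule prob_space_sequence_law)
      show ?thesis by simp
    qed
    ultimately show ?thesis
      unfolding 1 by (intro bexI[of _ "\<lambda>x. \<lambda>i\<in>{1..m}. 0"] conjI ballI SUP_least) (simp_all only: v sum.neutral_const zero_le top_greatest infinity_ennreal_def)
  next
    case 2
    have z: "(L2_set (\<lambda>i. (\<integral>x. x i \<partial>sequence_law m n \<theta>) - \<theta> i) {1..m})\<^sup>2 = 0" for \<theta>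
      unfolding L2_set_def by (simp add: sequence_law_mean(2))
    show ?thesis
      unfolding 2
      by (intro bexI[of _ "\<lambda>x. x"] conjI ballI SUP_least sequence_law_mean measurable_ident_sets refl)
        (simp_all only: z ennreal_0 zero_le top_greatest infinity_ennreal_def)
  next
    case 3
    \<comment> \<open>By \<open>ball\<close> the function belonging to \<theta> takes part in both
      suprema, so their finiteness bounds its risks and \<open>estimator_bounds\<close> applies with
      the same \<open>theta_est fhat\<close> for all \<theta>.\<close>
    have fin: "IBias_sq ?P (\<lambda>x. \<Sum>i\<in>{1..m}. \<theta> i * \<phi> i x) fhat \<le> ?B" "IVar ?P (\<lambda>x. \<Sum>i\<in>{1..m}. \<theta> i * \<phi> i x) fhat \<le> ?V"
      if "\<theta> \<in> Theta_ball m \<beta> R" for \<theta>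
      by (rule SUP_upper[OF ball[OF that]])+
    have fin': "IBias_sq ?P (\<lambda>x. \<Sum>i\<in>{1..m}. \<theta> i * \<phi> i x) fhat < \<infinity>" "IVar ?P (\<lambda>x. \<Sum>i\<in>{1..m}. \<theta> i * \<phi> i x) fhat < \<infinity>"
      if "\<theta> \<in> Theta_ball m \<beta> R" for \<theta>
      using le_less_trans[OF fin(1)[OF that] 3(1)] le_less_trans[OF fin(2)[OF that] 3(2)] by blast+
    note est = estimator_bounds[OF fhat fin']
    show ?thesis
    proof (intro bexI[of _ "theta_est fhat"] conjI ballI SUP_least theta_est_measurable[OF fhat])
      fix \<theta> assume \<theta>: "\<theta> \<in> Theta_ball m \<beta> R"
      show "integrable (sequence_law m n \<theta>) (\<lambda>x. theta_est fhat x i)" if "i \<in> {1..m}" for i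
        by (rule est(1)[OF \<theta> \<theta> that])
      show "ennreal ((L2_set (\<lambda>i. (\<integral>x. theta_est fhat x i \<partial>sequence_law m n \<theta>) - \<theta> i) {1..m})\<^sup>2) \<le> ?B"
        by (rule order_trans[OF est(2)[OF \<theta> \<theta>] fin(1)[OF \<theta>]])
      show "(\<Sum>i=1..m. ext_variance (sequence_law m n \<theta>) (\<lambda>x. theta_est fhat x i)) \<le> ?V"
        by (rule order_trans[OF est(3)[OF \<theta> \<theta>] fin(2)[OF \<theta>]])
    qed
  qed
qed

end
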